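(* Fix $\beta>0$ and consider oriented Poisson percolation on $\mathcal L$ with parameter $\beta$ at time $t>0$. For any $\eta>0$, as $t\to\infty$, $$P\bigl(\ell_t(k)\le -(1-\eta)\Gamma_t(k)\ \text{ and }\ (1-\eta)\Gamma_t(k)\le r_t(k)\ \text{ for all integers } 0\le k\le(1-\eta)N\bigr)\to 1.$$
   Context: Lattice: $\mathcal L=\{(m,n)\in\mathbb Z^2: m+n \text{ is even}\}$ with oriented edges $(m,n)\to(m+1,n+1)$ and $(m,n)\to(m-1,n+1)$. Poisson percolation: fix $\beta>0$. At time $t$, edges are open independently, and an edge with midpoint $(x,y)$, $y>0$, is open with probability $\rho(y,t)=1-\exp(-ty^{-\beta})$. Write $(x,m)\to(y,n)$ if there is an oriented path of open edges from $(x,m)$ to $(y,n)$ (every site is connected to itself). Let $\mathbb C_0(t)=\{(x,n):(0,0)\to(x,n)\}$, $r_t(k)=\max\{x:(x,k)\in\mathbb C_0(t)\}$ and $\ell_t(k)=\min\{x:(x,k)\in\mathbb C_0(t)\}$, with $\max\emptyset=-\infty$ and $\min\emptyset=+\infty$. Homogeneous percolation: in homogeneous oriented bond percolation on $\mathcal L$ with parameter $p$, each edge is open independently with probability $p$; $P_p$ denotes its law. Let $\mathcal C_0$ be the set of sites reachable from the origin by oriented open paths and $p_c=\inf\{p:P_p(|\mathcal C_0|=\infty)>0\}$. Let $r_k=\sup\{x:\exists\, y\le 0\text{ with }(y,0)\to(x,k)\}$ be the rightmost site at height $k$ reachable from $(-\infty,0]\times\{0\}$. For $p\ge p_c$, the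 right-edge speed $\alpha(p)$ is the almost sure limit of $r_k/k$ as $k\to\infty$ (it exists; $\alpha(1)=1$, $\alpha(p_c)=0$). Scaling and shape: let $n(p,t)=\max\{y>0:\rho(y,t)\ge p\}$ ($y$ real) and $N=n(p_c,t)$. Let $f(y)=\rho(yt^{1/\beta},t)=1-\exp(-y^{-\beta})$ (with $f(0)=1$), and let $y_c$ be defined by $f(y_c)=p_c$. Define $g$ by $g(0)=0$, $g'(y)=\alpha(f(y))$ for $0\le y\le y_c$, and $g(y)=g(y_c)$ for $y>y_c$. Set $\Gamma_t(y)=t^{1/\beta}g(y/t^{1/\beta})$. *)

theory Defs
  imports "HOL-Probability.Probability"
begin

section \<open>The oriented lattice and its open paths\<close>

type_synonym site = "int \<times> int"
type_synonym edge = "site \<times> site"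

definition sites :: "site set" where
  "sites = {(m, n). even (m + n)}"

definition edges :: "edge set" where
  "edges = {((m, n), (m', n')) | m n m' n'.
     (m, n) \<in> sites \<and> n' = n + 1 \<and> (m' = m + 1 \<or> m' = m - 1)}"

definition mid_height :: "edge \<Rightarrow> real" where
  "mid_height e = (of_int (snd (fst e)) + of_int (snd (snd e))) / 2"

definition reaches :: "(edge \<Rightarrow> bool) \<Rightarrow> site \<Rightarrow> site \<Rightarrow> bool" where
  "reaches \<omega> u v \<longleftrightarrow> u \<in> sites \<and> (u, v) \<in> {e \<in> edges. \<omega> e}\<^sup>*"

definition cluster :: "(edge \<Rightarrow> bool) \<Rightarrow> site set" where
  "cluster \<omega> = {v. reaches \<omega> (0, 0) v}"

text \<open>At each height the cluster of the origin is finite, so the supremum and infimum below are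
  a maximum and a minimum; on the empty set they are \<open>-\<infinity>\<close> and \<open>\<infinity>\<close>.\<close>

definition cluster_right :: "(edge \<Rightarrow> bool) \<Rightarrow> nat \<Rightarrow> ereal" where
  "cluster_right \<omega> k = (SUP x \<in> {x. (x, int k) \<in> cluster \<omega>}. ereal (of_int x))"

definition cluster_left :: "(edge \<Rightarrow> bool) \<Rightarrow> nat \<Rightarrow> ereal" where
  "cluster_left \<omega> k = (INF x \<in> {x. (x, int k) \<in> cluster \<omega>}. ereal (of_int x))"


section \<open>Homogeneous percolation\<close>

definition homogeneous :: "real \<Rightarrow> (edge \<Rightarrow> bool) measure" where
  "homogeneous p = PiM edges (\<lambda>e. measure_pmf (bernoulli_pmf p))"

definition p_crit :: real where
  "p_crit = Inf {p \<in> {0..1}.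
     measure (homogeneous p) {\<omega> \<in> space (homogeneous p). infinite (cluster \<omega>)} > 0}"

definition half_line_right :: "(edge \<Rightarrow> bool) \<Rightarrow> nat \<Rightarrow> ereal" where
  "half_line_right \<omega> k = (SUP x \<in> {x. \<exists>y\<le>0. reaches \<omega> (y, 0) (x, int k)}. ereal (of_int x))"

definition right_edge_speed :: "(real \<Rightarrow> real) \<Rightarrow> bool" where
  "right_edge_speed \<alpha> \<longleftrightarrow> (\<forall>p\<in>{p_crit..1}. AE \<omega> in homogeneous p.
     (\<lambda>k. half_line_right \<omega> k / ereal (real k)) \<longlonglongrightarrow> ereal (\<alpha> p))"


section \<open>Poisson percolation\<close>

text \<open>Only used for heights \<open>y > 0\<close>.\<close>
definition rho :: "real \<Rightarrow> real \<Rightarrow> real \<Rightarrow> real" where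
  "rho \<beta> y t = 1 - exp (- (t * y powr (-\<beta>)))"

text \<open>The law of the set of open edges at time \<open>t\<close>. Configurations have no meaningful value at
  edges of nonpositive mid-height, but no path from the origin uses such an edge.\<close>
definition poisson_perc :: "real \<Rightarrow> real \<Rightarrow> (edge \<Rightarrow> bool) measure" where
  "poisson_perc \<beta> t = PiM {e \<in> edges. mid_height e > 0}
     (\<lambda>e. measure_pmf (bernoulli_pmf (rho \<beta> (mid_height e) t)))"

definition height_at :: "real \<Rightarrow> real \<Rightarrow> real \<Rightarrow> real" where
  "height_at \<beta> p t = (GREATEST y. y > 0 \<and> rho \<beta> y t \<ge> p)"

definition crit_height :: "real \<Rightarrow> real \<Rightarrow> real" where
  "crit_height \<beta> t = height_at \<beta> p_crit t"


section \<open>The limiting shape\<close>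

text \<open>For \<open>y, t > 0\<close> this is \<open>rho \<beta> (y * t powr (1 / \<beta>)) t\<close>, for every \<open>t\<close>.\<close>
definition profile :: "real \<Rightarrow> real \<Rightarrow> real" where
  "profile \<beta> y = (if y = 0 then 1 else 1 - exp (- (y powr (-\<beta>))))"

definition y_crit :: "real \<Rightarrow> real" where
  "y_crit \<beta> = (THE y. y \<ge> 0 \<and> profile \<beta> y = p_crit)"

text \<open>The derivative is one-sided at the two end points of \<open>{0..y_crit \<beta>}\<close>. These
  conditions determine \<open>g\<close> on \<open>{0..}\<close>, the only place where it is used.\<close>
definition shape_function :: "real \<Rightarrow> (real \<Rightarrow> real) \<Rightarrow> (real \<Rightarrow> real) \<Rightarrow> bool" where
  "shape_function \<beta> \<alpha> g \<longleftrightarrow> g 0 = 0 \<and>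
     (\<forall>y\<in>{0..y_crit \<beta>}.
        (g has_real_derivative \<alpha> (profile \<beta> y)) (at y within {0..y_crit \<beta>})) \<and>
     (\<forall>y>y_crit \<beta>. g y = g (y_crit \<beta>))"

definition scaled_shape :: "real \<Rightarrow> (real \<Rightarrow> real) \<Rightarrow> real \<Rightarrow> real \<Rightarrow> real" where
  "scaled_shape \<beta> g t y = t powr (1 / \<beta>) * g (y / t powr (1 / \<beta>))"

end

theory Submission
  imports Defs
begin

text \<open>The cluster of the origin survives and has the same right edge as the half-line process as
  long as the right edge of the left half line stays right of the left edge of the right half line,
  because paths in the plane cross. By reflection it is enough to bound the right edge from below.

  The speed \<open>\<alpha>\<close> is strictly increasing: if \<open>\<phi>\<^sub>p(\<theta>, n)\<close> is the exponential moment of the right edge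
  at height \<open>n\<close>, raising the parameter from \<open>p\<close> to \<open>q\<close> one level at a time gives
  \<open>\<phi>\<^sub>q(\<theta>, n) \<ge> (1 + (q - p)(1 - exp (-2\<theta>)))\<^sup>n \<phi>\<^sub>p(\<theta>, n)\<close>; with submultiplicativity and
  \<open>\<theta> = 1/n\<close> this becomes \<open>exp (\<alpha>(q)) \<ge> (1 + q - p) exp (\<alpha>(p))\<close>. A contour argument gives
  \<open>p\<^sub>c < 1\<close>.

  On the scale \<open>t\<^bsup>1/\<beta>\<^esup>\<close> the environment dominates one that is homogeneous on finitely many slabs
  with decreasing parameters, hence strictly decreasing speeds. A path of a slower slab that starts
  one slab lower and slightly ahead of the present path is overtaken by it, so the two meet, and the
  law of large numbers in each slab gives a lower Riemann sum for the integral of \<open>\<alpha>\<close>. Near the origin the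
  parameter is close to 1 and the homogeneous law of large numbers applies directly.\<close>

section \<open>Paths and crossings\<close>

text \<open>Stacking slabs naively fails for lower bounds. At the top of a slab the set reached from
  the half line is not itself a half line: filling in every site left of its right edge only adds
  paths, which is fine for upper bounds and for submultiplicativity, while a path continued from the
  rightmost site alone may die out. The crossing argument replaces this restart. It works only if
  the next slab is strictly slower, and this is what strict monotonicity of \<alpha> is for.
  Monotonicity also gives positive speed above \<open>p_crit\<close> without any information at
  \<open>p_crit\<close> itself.

  About the speed only a law of large numbers at fixed parameters is given, without a rate. Hence
  the number of slabs stays fixed while their length grows, and good events are intersected finitely
  often. Continuity of \<alpha> is not given either: the Riemann sums are controlled by monotonicity
  alone, and the continuity at 1 that matters near the origin is read off from the derivative of
  \<open>g\<close> at 0.\<close>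

fun conn :: "(edge \<Rightarrow> bool) \<Rightarrow> int \<Rightarrow> nat \<Rightarrow> int \<Rightarrow> int \<Rightarrow> bool" where
  "conn \<omega> b 0 x y \<longleftrightarrow> x = y \<and> even (x + b)"
| "conn \<omega> b (Suc n) x y \<longleftrightarrow> even (x + b) \<and>
     (\<exists>x'\<in>{x + 1, x - 1}. \<omega> ((x, b), (x', b + 1)) \<and> conn \<omega> (b + 1) n x' y)"

lemma conn_Suc:
  "conn \<omega> b (Suc n) x y \<longleftrightarrow> even (x + b) \<and>
     (\<omega> ((x, b), (x + 1, b + 1)) \<and> conn \<omega> (b + 1) n (x + 1) y \<or>
      \<omega> ((x, b), (x - 1, b + 1)) \<and> conn \<omega> (b + 1) n (x - 1) y)"
  by auto

lemma conn_even: "conn \<omega> b n x y \<Longrightarrow> even (x + b)"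
  by (cases n) auto

lemma conn_even_end: "conn \<omega> b n x y \<Longrightarrow> even (y + b + int n)"
  by (induction n arbitrary: b x) (fastforce simp: algebra_simps)+

lemma conn_add:
  "conn \<omega> b (m + n) x y \<longleftrightarrow> (\<exists>z. conn \<omega> b m x z \<and> conn \<omega> (b + int m) n z y)"
proof (induction m arbitrary: b x)
  case 0
  then show ?case using conn_even by auto
next
  case (Suc m)
  have "b + 1 + int m = b + int (Suc m)" by simp
  then show ?case using Suc by (simp only: add_Suc conn.simps) blast
qed

lemma conn_split:
  assumes "conn \<omega> b n x y" "m \<le> n"
  obtains z where "conn \<omega> b m x z" "conn \<omega> (b + int m) (n - m) z y"
  using assms conn_add[of \<omega> b m "n - m" x y] by auto

lemma conn_join:
  "conn \<omega> b m x z \<Longrightarrow> conn \<omega> (b + int m) n z y \<Longrightarrow> conn \<omega> b (m + n) x y"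
  using conn_add by blast

lemma conn_bound: "conn \<omega> b n x y \<Longrightarrow> \<bar>y - x\<bar> \<le> int n"
  by (induction n arbitrary: b x) fastforce+

lemma conn_mono:
  assumes "conn \<omega> b n x y"
    and "\<And>x x' k. b \<le> k \<Longrightarrow> k < b + int n \<Longrightarrow> ((x, k), (x', k + 1)) \<in> edges \<Longrightarrow>
      \<omega> ((x, k), (x', k + 1)) \<Longrightarrow> \<omega>' ((x, k), (x', k + 1))"
  shows "conn \<omega>' b n x y"
  using assms
proof (induction n arbitrary: b x)
  case (Suc n)
  then obtain x' where x': "x' \<in> {x + 1, x - 1}" "\<omega> ((x, b), (x', b + 1))" "conn \<omega> (b + 1) n x' y"
    "even (x + b)"
    by auto
  moreover have "((x, b), (x', b + 1)) \<in> edges" using x' by (auto simp: edges_def sites_def)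
  then have "\<omega>' ((x, b), (x', b + 1))" using Suc.prems(2) x' by simp
  moreover have "conn \<omega>' (b + 1) n x' y" using Suc.IH[OF x'(3)] Suc.prems(2) by simp
  ultimately show ?case using Suc.prems(1) by (simp only: conn.simps) blast
qed simp

lemma conn_cong:
  assumes "\<And>x x' k. b \<le> k \<Longrightarrow> k < b + int n \<Longrightarrow> ((x, k), (x', k + 1)) \<in> edges \<Longrightarrow>
      \<omega> ((x, k), (x', k + 1)) = \<omega>' ((x, k), (x', k + 1))"
  shows "conn \<omega> b n x y = conn \<omega>' b n x y"
  using conn_mono[of \<omega> b n x y \<omega>'] conn_mono[of \<omega>' b n x y \<omega>] assms by blast

section \<open>Symmetries of the lattice\<close>

definition reflect :: "edge \<Rightarrow> edge" where
  "reflect = (\<lambda>((x, k), (x', k')). ((- x, k), (- x', k')))"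

lemma conn_reflect: "conn (\<omega> \<circ> reflect) b n x y \<longleftrightarrow> conn \<omega> b n (- x) (- y)"
proof (induction n arbitrary: b x)
  case (Suc n)
  have "(\<exists>x'\<in>{x + 1, x - 1}. \<omega> ((- x, b), (- x', b + 1)) \<and> conn \<omega> (b + 1) n (- x') (- y)) \<longleftrightarrow>
    (\<exists>x'\<in>{- x + 1, - x - 1}. \<omega> ((- x, b), (x', b + 1)) \<and> conn \<omega> (b + 1) n x' (- y))"
    by auto
  then show ?case using Suc by (auto simp: reflect_def)
qed auto

definition translate :: "int \<Rightarrow> int \<Rightarrow> edge \<Rightarrow> edge" where
  "translate a h = (\<lambda>((x, k), (x', k')). ((x + a, k + h), (x' + a, k' + h)))"

lemma conn_translate:
  assumes "even (a + h)"
  shows "conn (\<omega> \<circ> translate a h) b n x y \<longleftrightarrow> conn \<omega> (b + h) n (x + a) (y + a)"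
proof (induction n arbitrary: b x)
  case 0
  then show ?case using assms by (auto simp: algebra_simps)
next
  case (Suc n)
  have e: "even (x + b) \<longleftrightarrow> even (x + a + (b + h))" using assms by presburger
  have eqs: "x + 1 + a = x + a + 1" "x - 1 + a = x + a - 1" "b + 1 + h = b + h + 1" by auto
  have c: "conn (\<omega> \<circ> translate a h) (b + 1) n (x + 1) y = conn \<omega> (b + h + 1) n (x + a + 1) (y + a)"
    "conn (\<omega> \<circ> translate a h) (b + 1) n (x - 1) y = conn \<omega> (b + h + 1) n (x + a - 1) (y + a)"
    unfolding Suc.IH eqs by (rule refl)+
  have o: "(\<omega> \<circ> translate a h) ((x, b), (x', b + 1)) = \<omega> ((x + a, b + h), (x' + a, b + h + 1))" for x'
    by (simp add: translate_def algebra_simps)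
  show ?case by (simp only: conn_Suc c o e eqs)
qed

text \<open>Two paths at the same level have an even distance, which changes by at most 2 per step.\<close>

lemma conn_cross:
  assumes "conn \<omega> b n x1 y1" "conn \<omega>' b n x2 y2" "x1 \<le> x2" "y2 \<le> y1"
  obtains m z where "m \<le> n" "conn \<omega> b m x1 z" "conn \<omega>' b m x2 z"
    "conn \<omega> (b + int m) (n - m) z y1" "conn \<omega>' (b + int m) (n - m) z y2"
proof -
  have "\<exists>m z. m \<le> n \<and> conn \<omega> b m x1 z \<and> conn \<omega>' b m x2 z \<and>
    conn \<omega> (b + int m) (n - m) z y1 \<and> conn \<omega>' (b + int m) (n - m) z y2"
    using assms
  proof (induction n arbitrary: b x1 x2)
    case 0
    then have "x1 = x2" by auto
    with 0 show ?case by (intro exI[of _ 0] exI[of _ x1]) auto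
  next
    case (Suc n)
    show ?case
    proof (cases "x1 = x2")
      case True
      then show ?thesis using Suc.prems conn_even[OF Suc.prems(1)]
        by (intro exI[of _ 0] exI[of _ x1]) auto
    next
      case False
      obtain z1 where z1: "z1 \<in> {x1 + 1, x1 - 1}" "\<omega> ((x1, b), (z1, b + 1))" "conn \<omega> (b + 1) n z1 y1"
        using Suc.prems(1) by auto
      obtain z2 where z2: "z2 \<in> {x2 + 1, x2 - 1}" "\<omega>' ((x2, b), (z2, b + 1))" "conn \<omega>' (b + 1) n z2 y2"
        using Suc.prems(2) by auto
      have ev: "even (x1 + b)" "even (x2 + b)" using Suc.prems(1,2) by auto
      with False Suc.prems(3) have "x1 + 2 \<le> x2" by presburger
      with z1 z2 have "z1 \<le> z2" by auto
      from Suc.IH[OF z1(3) z2(3) this Suc.prems(4)] obtain m z where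
        m: "m \<le> n" "conn \<omega> (b + 1) m z1 z" "conn \<omega>' (b + 1) m z2 z"
        "conn \<omega> (b + 1 + int m) (n - m) z y1" "conn \<omega>' (b + 1 + int m) (n - m) z y2" by blast
      have "conn \<omega> b (Suc m) x1 z" "conn \<omega>' b (Suc m) x2 z"
        using m z1 z2 ev by (simp_all only: conn.simps) blast+
      moreover have eq: "b + 1 + int m = b + int (Suc m)" by simp
      ultimately show ?thesis using m(1) m(4,5)[unfolded eq]
        by (intro exI[of _ "Suc m"] exI[of _ z] conjI) simp_all
    qed
  qed
  then show ?thesis using that by blast
qed

section \<open>The half-line process and survival of the origin's cluster\<close>

definition half_line :: "(edge \<Rightarrow> bool) \<Rightarrow> int \<Rightarrow> nat \<Rightarrow> int \<Rightarrow> int \<Rightarrow> bool" where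
  "half_line \<omega> b n X y \<longleftrightarrow> (\<exists>x\<le>X. conn \<omega> b n x y)"

lemma half_line_mono:
  assumes "half_line \<omega> b n X y" "X \<le> X'"
    and "\<And>x x' k. b \<le> k \<Longrightarrow> k < b + int n \<Longrightarrow> ((x, k), (x', k + 1)) \<in> edges \<Longrightarrow>
      \<omega> ((x, k), (x', k + 1)) \<Longrightarrow> \<omega>' ((x, k), (x', k + 1))"
  shows "half_line \<omega>' b n X' y"
proof -
  obtain x where x: "x \<le> X" "conn \<omega> b n x y" using assms(1) by (auto simp: half_line_def)
  have "conn \<omega>' b n x y" by (rule conn_mono[OF x(2)]) (use assms(3) in blast)
  then show ?thesis using x(1) assms(2) unfolding half_line_def by (meson order_trans)
qed

lemma half_line_cong:
  assumes "\<And>x x' k. b \<le> k \<Longrightarrow> k < b + int n \<Longrightarrow> ((x, k), (x', k + 1)) \<in> edges \<Longrightarrow>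
      \<omega> ((x, k), (x', k + 1)) = \<omega>' ((x, k), (x', k + 1))"
  shows "half_line \<omega> b n X y = half_line \<omega>' b n X y"
  unfolding half_line_def using conn_cong[of b n \<omega> \<omega>'] assms by blast

lemma half_line_bound: "half_line \<omega> b n X y \<Longrightarrow> y \<le> X + int n"
  unfolding half_line_def using conn_bound by fastforce

lemma half_line_add:
  "half_line \<omega> b (m + n) X y \<longleftrightarrow> (\<exists>z. half_line \<omega> b m X z \<and> conn \<omega> (b + int m) n z y)"
  unfolding half_line_def conn_add by blast

lemma half_line_translate:
  assumes "even (a + h)"
  shows "half_line (\<omega> \<circ> translate a h) b n X y \<longleftrightarrow> half_line \<omega> (b + h) n (X + a) (y + a)"
proof -
  have "(\<exists>x\<le>X. conn \<omega> (b + h) n (x + a) (y + a)) \<longleftrightarrow> (\<exists>x\<le>X + a. conn \<omega> (b + h) n x (y + a))"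
    by (metis add.commute add_le_cancel_left diff_add_cancel diff_le_eq)
  then show ?thesis unfolding half_line_def conn_translate[OF assms] .
qed

lemma conn_imp_half_line: "conn \<omega> b n x y \<Longrightarrow> half_line \<omega> b n x y"
  unfolding half_line_def by blast

text \<open>A path that ends to the right of a point reached from \<open>0\<close> must cross the path to that point.\<close>

lemma conn_of_half_line:
  assumes "half_line \<omega> 0 k 0 y" "conn \<omega> 0 k 0 z" "z \<le> y"
  shows "conn \<omega> 0 k 0 y"
proof -
  obtain x where x: "x \<le> 0" "conn \<omega> 0 k x y" using assms(1) by (auto simp: half_line_def)
  from conn_cross[OF x(2) assms(2) x(1) assms(3)] obtain m w where
    m: "m \<le> k" "conn \<omega> 0 m 0 w" "conn \<omega> (0 + int m) (k - m) w y" by metis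
  from conn_join[OF m(2,3)] m(1) show ?thesis by simp
qed

text \<open>If the cluster died at level \<open>Suc k\<close>, the predecessors \<open>x1\<close>
  and \<open>- x2\<close> of the two edges would lie strictly left and right of \<open>z\<close>, as
  a crossing would otherwise join them to the origin. By parity both are at distance at least 2 from
  \<open>z\<close>, so after one more step \<open>y1\<close> is still left and \<open>- y2\<close>
  still right of \<open>z\<close>. This contradicts \<open>- y2 \<le> 0 \<le> y1\<close>.\<close>

lemma origin_survives:
  assumes R: "\<And>k. k \<le> K \<Longrightarrow> \<exists>y\<ge>0. half_line \<omega> 0 k 0 y"
    and L: "\<And>k. k \<le> K \<Longrightarrow> \<exists>y\<ge>0. half_line (\<omega> \<circ> reflect) 0 k 0 y"
    and "k \<le> K"
  shows "\<exists>z. conn \<omega> 0 k 0 z"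
  using \<open>k \<le> K\<close>
proof (induction k)
  case (Suc k)
  then obtain z where z: "conn \<omega> 0 k 0 z" by auto
  show ?case
  proof (rule ccontr)
    assume dead: "\<nexists>z. conn \<omega> 0 (Suc k) 0 z"
    obtain y1 where y1: "y1 \<ge> 0" "half_line \<omega> 0 (k + 1) 0 y1" using R[of "Suc k"] Suc.prems by auto
    obtain y2 where y2: "y2 \<ge> 0" "half_line (\<omega> \<circ> reflect) 0 (k + 1) 0 y2"
      using L[of "Suc k"] Suc.prems by auto
    obtain x1 where x1: "half_line \<omega> 0 k 0 x1" "conn \<omega> (0 + int k) 1 x1 y1"
      using y1(2) unfolding half_line_add by blast
    obtain x2 where x2: "half_line (\<omega> \<circ> reflect) 0 k 0 x2" "conn (\<omega> \<circ> reflect) (0 + int k) 1 x2 y2"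
      using y2(2) unfolding half_line_add by blast
    have x2': "conn \<omega> (0 + int k) 1 (- x2) (- y2)" using x2(2) conn_reflect by blast
    have n1: "\<not> conn \<omega> 0 k 0 x1" using dead conn_join[OF _ x1(2), of 0] by auto
    have n2: "\<not> conn \<omega> 0 k 0 (- x2)" using dead conn_join[OF _ x2', of 0] by auto
    have zr: "conn (\<omega> \<circ> reflect) 0 k 0 (- z)" using z by (simp add: conn_reflect)
    have "x1 < z" using conn_of_half_line[OF x1(1) z] n1 by force
    moreover have "z < - x2"
      using conn_of_half_line[OF x2(1) zr] n2 by (force simp: conn_reflect)
    moreover have "even (x1 + int k)" "even (z + int k)" "even (- x2 + int k)"
      using conn_even[OF x1(2)] conn_even_end[OF z] conn_even[OF x2'] by auto
    ultimately have "x1 + 2 \<le> z" "z + 2 \<le> - x2" by presburger+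
    moreover have "y1 \<le> x1 + 1" "- y2 \<ge> - x2 - 1" using conn_bound[OF x1(2)] conn_bound[OF x2'] by auto
    ultimately show False using y1(1) y2(1) by linarith
  qed
qed (auto intro!: exI[of _ 0])

lemma origin_catches_half_line:
  assumes "\<And>k. k \<le> K \<Longrightarrow> \<exists>y\<ge>0. half_line \<omega> 0 k 0 y"
    and "\<And>k. k \<le> K \<Longrightarrow> \<exists>y\<ge>0. half_line (\<omega> \<circ> reflect) 0 k 0 y"
    and "k \<le> K" "half_line \<omega> 0 k 0 y"
  shows "\<exists>z\<ge>y. conn \<omega> 0 k 0 z"
proof -
  obtain z where "conn \<omega> 0 k 0 z" using origin_survives[OF assms(1,2,3)] by blast
  then show ?thesis using conn_of_half_line[OF assms(4)] by (meson linorder_le_cases order_refl)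
qed

section \<open>Step-indexed paths and reachability\<close>

lemma reaches_conn: "reaches \<omega> (x, b) (y, c) \<longleftrightarrow> (\<exists>n. c = b + int n \<and> conn \<omega> b n x y)"
proof
  assume "reaches \<omega> (x, b) (y, c)"
  then have "((x, b), (y, c)) \<in> {e \<in> edges. \<omega> e}\<^sup>*" and s: "(x, b) \<in> sites"
    by (auto simp: reaches_def)
  then show "\<exists>n. c = b + int n \<and> conn \<omega> b n x y"
  proof (induction "(y, c)" arbitrary: y c rule: rtrancl_induct)
    case base
    then show ?case by (intro exI[of _ 0]) (auto simp: sites_def)
  next
    case (step v)
    obtain y' c' where v: "v = (y', c')" by (cases v)
    then obtain n where n: "c' = b + int n" "conn \<omega> b n x y'" using step by auto
    have "conn \<omega> (b + int n) 1 y' y" "c = c' + 1" using step.hyps(2) v n(1)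
      by (auto simp: edges_def sites_def)
    then show ?case using n(1) conn_join[OF n(2), of 1 y]
      by (intro exI[of _ "n + 1"]) (simp del: conn.simps)
  qed
next
  assume "\<exists>n. c = b + int n \<and> conn \<omega> b n x y"
  then obtain n where n: "c = b + int n" "conn \<omega> b n x y" by blast
  then have "(x, b) \<in> sites" using conn_even by (auto simp: sites_def)
  moreover have "((x, b), (y, b + int n)) \<in> {e \<in> edges. \<omega> e}\<^sup>*"
    using n(2)
  proof (induction n arbitrary: b x)
    case (Suc n)
    then obtain x' where x': "x' \<in> {x + 1, x - 1}" "\<omega> ((x, b), (x', b + 1))" "conn \<omega> (b + 1) n x' y"
      "even (x + b)" by auto
    have e: "((x, b), (x', b + 1)) \<in> {e \<in> edges. \<omega> e}"
      using x' by (auto simp: edges_def sites_def)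
    have eq: "b + 1 + int n = b + int (Suc n)" by simp
    show ?case by (rule converse_rtrancl_into_rtrancl[OF e Suc.IH[OF x'(3), unfolded eq]])
  qed simp
  ultimately show "reaches \<omega> (x, b) (y, c)" using n(1) by (simp add: reaches_def)
qed

lemma reaches_origin_level: "reaches \<omega> (x, 0) (y, int k) \<longleftrightarrow> conn \<omega> 0 k x y"
  by (auto simp: reaches_conn)

lemma cluster_conn: "(y, int k) \<in> cluster \<omega> \<longleftrightarrow> conn \<omega> 0 k 0 y"
  by (simp add: cluster_def reaches_origin_level)

lemma half_line_right_eq:
  "half_line_right \<omega> k = (SUP x \<in> {x. half_line \<omega> 0 k 0 x}. ereal (of_int x))"
  by (simp add: half_line_right_def reaches_origin_level half_line_def)

lemma infinite_cluster_iff: "infinite (cluster \<omega>) \<longleftrightarrow> (\<forall>k. \<exists>y. conn \<omega> 0 k 0 y)"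
proof
  assume inf: "infinite (cluster \<omega>)"
  show "\<forall>k. \<exists>y. conn \<omega> 0 k 0 y"
  proof (rule ccontr)
    assume "\<not> (\<forall>k. \<exists>y. conn \<omega> 0 k 0 y)"
    then obtain K where K: "\<And>y. \<not> conn \<omega> 0 K 0 y" by blast
    have "cluster \<omega> \<subseteq> {- int K..int K} \<times> {0..int K}"
    proof
      fix v assume "v \<in> cluster \<omega>"
      then obtain y c where v: "v = (y, c)" "reaches \<omega> (0, 0) (y, c)"
        by (cases v) (auto simp: cluster_def)
      then obtain n where n: "c = int n" "conn \<omega> 0 n 0 y" by (auto simp: reaches_conn)
      have "n \<le> K"
      proof (rule ccontr)
        assume "\<not> n \<le> K"
        then show False using K conn_split[OF n(2), of K] by (meson linorder_le_cases)
      qed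
      then show "v \<in> {- int K..int K} \<times> {0..int K}" using v n conn_bound[OF n(2)] by auto
    qed
    with inf show False using finite_subset by blast
  qed
next
  assume "\<forall>k. \<exists>y. conn \<omega> 0 k 0 y"
  then have "\<forall>k. int k \<in> snd ` cluster \<omega>" by (force simp flip: cluster_conn)
  then have "range int \<subseteq> snd ` cluster \<omega>" by auto
  then show "infinite (cluster \<omega>)"
    by (meson finite_imageI finite_subset infinite_UNIV_char_0 inj_of_nat range_inj_infinite)
qed

section \<open>The universal coupling\<close>

definition unif :: "real measure" where
  "unif = uniform_measure lborel {0..1}"

text \<open>All percolation processes live on one space of independent uniform labels: an edge is open
  when its label is at most the parameter of its level.\<close>

definition labels :: "(edge \<Rightarrow> real) measure" where
  "labels = PiM UNIV (\<lambda>_. unif)"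

definition env :: "(int \<Rightarrow> real) \<Rightarrow> (edge \<Rightarrow> real) \<Rightarrow> edge \<Rightarrow> bool" where
  "env P u e \<longleftrightarrow> u e \<le> P (snd (fst e))"

lemma prob_space_unif: "prob_space unif"
  unfolding unif_def by (rule prob_space_uniform_measure) auto

lemma sets_unif [simp, measurable_cong]: "sets unif = sets borel"
  by (simp add: unif_def)

lemma space_unif [simp]: "space unif = UNIV"
  by (simp add: unif_def)

lemma space_labels [simp]: "space labels = UNIV"
  by (simp add: labels_def space_PiM)

interpretation labels: prob_space labels
  unfolding labels_def by (rule prob_space_PiM) (rule prob_space_unif)

lemma label_measurable_unif: "(\<lambda>u. u e) \<in> labels \<rightarrow>\<^sub>M unif"
  unfolding labels_def by (rule measurable_component_singleton) simp

lemma label_measurable [measurable]: "(\<lambda>u. u e) \<in> borel_measurable labels"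
  using label_measurable_unif[of e] by (simp cong: measurable_cong_sets)

lemma env_measurable [measurable]: "Measurable.pred labels (\<lambda>u. env P u e)"
  unfolding env_def by measurable

lemma conn_measurable [measurable]: "Measurable.pred labels (\<lambda>u. conn (env P u) b n x y)"
proof (induction n arbitrary: b x)
  case (Suc n)
  note [measurable] = Suc
  show ?case unfolding conn_Suc by measurable
qed simp

lemma half_line_measurable [measurable]: "Measurable.pred labels (\<lambda>u. half_line (env P u) b n X y)"
  unfolding half_line_def by measurable

lemma distr_label: "distr labels unif (\<lambda>u. u e) = unif"
  unfolding labels_def using prob_space_unif by (intro distr_PiM_component) auto

lemma prob_label_in:
  assumes "A \<in> sets borel"
  shows "labels.prob {u. u e \<in> A} = measure unif A"
proof -
  have "measure unif A = measure (distr labels unif (\<lambda>u. u e)) A" by (simp add: distr_label)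
  also have "\<dots> = labels.prob ((\<lambda>u. u e) -` A \<inter> space labels)"
    using assms by (intro measure_distr label_measurable_unif) simp
  finally show ?thesis by (simp add: vimage_def)
qed

lemma prob_label_le:
  assumes "0 \<le> p" "p \<le> 1"
  shows "labels.prob {u. u e \<le> p} = p"
proof -
  have "{0..1} \<inter> {..p} = {0..p}" using assms by auto
  then have "measure unif {..p} = p" using assms by (simp add: unif_def)
  then show ?thesis using prob_label_in[of "{..p}" e] by simp
qed

lemma prob_label_gt:
  assumes "0 \<le> p" "p \<le> 1"
  shows "labels.prob {u. p < u e} = 1 - p"
proof -
  have "{0..1} \<inter> {p<..} = {p<..1}" using assms by auto
  then have "measure unif {p<..} = 1 - p" using assms by (simp add: unif_def)
  then show ?thesis using prob_label_in[of "{p<..}" e] by simp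
qed

lemma prob_label_between:
  assumes "0 \<le> p" "p \<le> q" "q \<le> 1"
  shows "labels.prob {u. p < u e \<and> u e \<le> q} = q - p"
proof -
  have "{0..1} \<inter> {p<..q} = {p<..q}" using assms by auto
  then have "measure unif {p<..q} = q - p" using assms by (simp add: unif_def)
  then show ?thesis using prob_label_in[of "{p<..q}" e] by simp
qed

section \<open>Independence and invariance of the labels\<close>

lemma indep_labels: "labels.indep_vars (\<lambda>_. unif) (\<lambda>e u. u e) UNIV"
proof -
  have "distr labels (\<Pi>\<^sub>M i\<in>UNIV. unif) (\<lambda>u. \<lambda>e\<in>UNIV. u e) = (\<Pi>\<^sub>M i\<in>UNIV. distr labels unif (\<lambda>u. u i))"
    unfolding distr_label by (simp add: restrict_UNIV labels_def[symmetric])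
  then show ?thesis
    by (subst labels.indep_vars_iff_distr_eq_PiM) (auto intro: label_measurable_unif)
qed

lemma prob_all_labels:
  assumes "finite S" "0 \<le> p" "p \<le> 1"
  shows "labels.prob {u. \<forall>e\<in>S. p < u e} = (1 - p) ^ card S"
proof (cases "S = {}")
  case False
  have "labels.prob (\<Inter>e\<in>S. (\<lambda>u. u e) -` {p<..} \<inter> space labels)
    = (\<Prod>e\<in>S. labels.prob ((\<lambda>u. u e) -` {p<..} \<inter> space labels))"
    by (rule labels.indep_varsD[OF indep_labels False]) (use assms in auto)
  also have "\<dots> = (1 - p) ^ card S" using prob_label_gt[OF assms(2,3)] by (simp add: vimage_def)
  finally show ?thesis by (simp add: vimage_def flip: INT_simps) (simp add: Collect_ball_eq)
qed (use labels.prob_space in simp)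

lemma nn_integral_labels_indep:
  fixes f g :: "(edge \<Rightarrow> real) \<Rightarrow> ennreal"
  assumes [measurable]: "f \<in> borel_measurable labels" "g \<in> borel_measurable labels"
    and f: "\<And>u v. (\<And>e. e \<in> I \<Longrightarrow> u e = v e) \<Longrightarrow> f u = f v"
    and g: "\<And>u v. (\<And>e. e \<in> J \<Longrightarrow> u e = v e) \<Longrightarrow> g u = g v"
    and "I \<inter> J = {}"
  shows "(\<integral>\<^sup>+u. f u * g u \<partial>labels) = (\<integral>\<^sup>+u. f u \<partial>labels) * (\<integral>\<^sup>+u. g u \<partial>labels)"
proof -
  \<comment> \<open>Padding with 0 makes a full family of labels out of a restricted one. Since
    \<open>f\<close> ignores labels outside \<open>I\<close>, it equals \<open>f (ext I v)\<close>
    at the restriction \<open>v\<close>, and so factors through the coordinates in \<open>I\<close>;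
    likewise \<open>g\<close> and \<open>J\<close>.\<close>
  define ext where "ext K v = (\<lambda>i. if i \<in> K then v i else 0)" for K and v :: "edge \<Rightarrow> real"
  have ext_meas [measurable]: "ext K \<in> PiM K (\<lambda>_. unif) \<rightarrow>\<^sub>M labels" for K
    unfolding labels_def
  proof (rule measurable_PiM_single')
    show "(\<lambda>v. ext K v i) \<in> PiM K (\<lambda>_. unif) \<rightarrow>\<^sub>M unif" for i
      by (cases "i \<in> K") (auto simp: ext_def)
  qed (auto simp: space_PiM)
  have "labels.indep_var (PiM I (\<lambda>_. unif)) (\<lambda>u. restrict (\<lambda>i. u i) I) (PiM J (\<lambda>_. unif)) (\<lambda>u. restrict (\<lambda>i. u i) J)"
    by (rule labels.indep_var_restrict[OF indep_labels]) (use assms in auto)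
  then have "labels.indep_var borel ((\<lambda>v. f (ext I v)) \<circ> (\<lambda>u. restrict (\<lambda>i. u i) I))
      borel ((\<lambda>v. g (ext J v)) \<circ> (\<lambda>u. restrict (\<lambda>i. u i) J))"
    by (rule labels.indep_var_compose) measurable
  moreover have "(\<lambda>v. f (ext I v)) \<circ> (\<lambda>u. restrict (\<lambda>i. u i) I) = f"
    by (rule ext) (auto simp: ext_def intro!: f)
  moreover have "(\<lambda>v. g (ext J v)) \<circ> (\<lambda>u. restrict (\<lambda>i. u i) J) = g"
    by (rule ext) (auto simp: ext_def intro!: g)
  ultimately have "labels.indep_var borel f borel g" by simp
  then have ind: "labels.indep_vars (\<lambda>_. borel) (case_bool f g) UNIV"
    unfolding labels.indep_var_def by (simp add: bool.case_eq_if cong: labels.indep_vars_cong)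
  show ?thesis
    using labels.indep_vars_nn_integral[OF _ ind] by (simp add: UNIV_bool mult.commute)
qed

lemma distr_labels_reindex:
  assumes "inj \<pi>"
  shows "distr labels labels (\<lambda>u. u \<circ> \<pi>) = labels"
  using distr_PiM_reindex[of UNIV "\<lambda>_. unif" \<pi> UNIV] assms prob_space_unif
  by (simp add: labels_def restrict_UNIV comp_def)

lemma reindex_measurable [measurable]: "(\<lambda>u. u \<circ> \<pi>) \<in> labels \<rightarrow>\<^sub>M labels"
proof -
  have "(\<lambda>u e. u (\<pi> e)) \<in> labels \<rightarrow>\<^sub>M PiM UNIV (\<lambda>_. unif)"
    by (rule measurable_PiM_single') (auto intro: label_measurable_unif simp: PiE_def)
  then show ?thesis by (simp add: labels_def comp_def)
qed

lemma nn_integral_labels_reindex: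
  fixes f :: "(edge \<Rightarrow> real) \<Rightarrow> ennreal"
  assumes "inj \<pi>" and [measurable]: "f \<in> borel_measurable labels"
  shows "(\<integral>\<^sup>+u. f (u \<circ> \<pi>) \<partial>labels) = (\<integral>\<^sup>+u. f u \<partial>labels)"
proof -
  have "(\<integral>\<^sup>+u. f u \<partial>labels) = (\<integral>\<^sup>+u. f u \<partial>distr labels labels (\<lambda>u. u \<circ> \<pi>))"
    by (simp add: distr_labels_reindex[OF assms(1)])
  also have "\<dots> = (\<integral>\<^sup>+u. f (u \<circ> \<pi>) \<partial>labels)" by (rule nn_integral_distr) auto
  finally show ?thesis by simp
qed

lemma prob_labels_reindex:
  assumes "inj \<pi>" "A \<in> sets labels"
  shows "labels.prob {u. u \<circ> \<pi> \<in> A} = labels.prob A"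
proof -
  have "labels.prob A = measure (distr labels labels (\<lambda>u. u \<circ> \<pi>)) A"
    by (simp add: distr_labels_reindex[OF assms(1)])
  also have "\<dots> = labels.prob ((\<lambda>u. u \<circ> \<pi>) -` A \<inter> space labels)"
    using assms(2) by (intro measure_distr) auto
  finally show ?thesis by (simp add: vimage_def)
qed

lemma reindex_sets:
  assumes "A \<in> sets labels"
  shows "{u. u \<circ> \<pi> \<in> A} \<in> sets labels"
  using measurable_sets[OF reindex_measurable assms, of \<pi>] by (simp add: vimage_def)

lemma inj_reflect: "inj reflect"
  by (rule injI) (auto simp: reflect_def split: prod.splits)

lemma inj_translate: "inj (translate a h)"
  by (rule injI) (auto simp: translate_def split: prod.splits)

lemma env_reflect: "env P (u \<circ> reflect) = env P u \<circ> reflect"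
  by (auto simp: env_def reflect_def fun_eq_iff)

lemma env_translate: "env P (u \<circ> translate a h) = env (\<lambda>k. P (k - h)) u \<circ> translate a h"
  by (auto simp: env_def translate_def fun_eq_iff)

lemma half_line_env_mono:
  assumes "half_line (env P u) b n X y" "X \<le> X'" "\<And>k. b \<le> k \<Longrightarrow> k < b + int n \<Longrightarrow> P k \<le> P' k"
  shows "half_line (env P' u) b n X' y"
  using assms(1,2) by (rule half_line_mono) (use assms(3) in \<open>fastforce simp: env_def\<close>)

lemma conn_env_mono:
  assumes "conn (env P u) b n x y" "\<And>k. b \<le> k \<Longrightarrow> k < b + int n \<Longrightarrow> P k \<le> P' k"
  shows "conn (env P' u) b n x y"
  using assms(1) by (rule conn_mono) (use assms(2) in \<open>fastforce simp: env_def\<close>)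

text \<open>Thresholding independent labels coordinatewise gives a product law, and each marginal is
  determined by its two point masses. This carries questions about both percolation models over to
  \<open>labels\<close>, where all parameters are coupled monotonically.\<close>

lemma distr_labels_bernoulli:
  assumes "I \<noteq> {}" "\<And>e. e \<in> I \<Longrightarrow> 0 \<le> r e \<and> r e \<le> 1"
  shows "distr labels (PiM I (\<lambda>e. measure_pmf (bernoulli_pmf (r e)))) (\<lambda>u. \<lambda>e\<in>I. u e \<le> r e)
    = PiM I (\<lambda>e. measure_pmf (bernoulli_pmf (r e)))"
proof -
  let ?B = "\<lambda>e. measure_pmf (bernoulli_pmf (r e))"
  have meas: "(\<lambda>u. u e \<le> r e) \<in> labels \<rightarrow>\<^sub>M ?B e" for e
    using pred_def by (simp cong: measurable_cong_sets)
  have meas': "(\<lambda>a. a \<le> r e) \<in> unif \<rightarrow>\<^sub>M ?B e" for e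
    by (simp cong: measurable_cong_sets)
  have "labels.indep_vars ?B (\<lambda>e u. u e \<le> r e) UNIV"
    by (rule labels.indep_vars_compose2[OF indep_labels]) (rule meas')
  then have "labels.indep_vars ?B (\<lambda>e u. u e \<le> r e) I"
    by (rule labels.indep_vars_subset) simp
  then have "distr labels (PiM I ?B) (\<lambda>u. \<lambda>e\<in>I. u e \<le> r e) = PiM I (\<lambda>e. distr labels (?B e) (\<lambda>u. u e \<le> r e))"
    using labels.indep_vars_iff_distr_eq_PiM[where M'="?B" and X="\<lambda>e u. u e \<le> r e", OF assms(1) meas] by blast
  also have "\<dots> = PiM I ?B"
  proof (rule PiM_cong)
    fix e assume e: "e \<in> I"
    have T: "emeasure (distr labels (?B e) (\<lambda>u. u e \<le> r e)) {b} = emeasure (?B e) {b}" for b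
    proof -
      have "emeasure (distr labels (?B e) (\<lambda>u. u e \<le> r e)) {b} = emeasure labels {u. (u e \<le> r e) = b}"
        by (subst emeasure_distr[OF meas]) (auto intro!: arg_cong[where f="emeasure labels"])
      also have "\<dots> = ennreal (labels.prob {u. (u e \<le> r e) = b})"
        by (simp add: labels.emeasure_eq_measure)
      also have "labels.prob {u. (u e \<le> r e) = b} = pmf (bernoulli_pmf (r e)) b"
        using assms(2)[OF e] prob_label_le[of "r e" e] prob_label_gt[of "r e" e]
        by (cases b) (simp_all add: not_le)
      also have "ennreal \<dots> = emeasure (?B e) {b}" by (simp add: emeasure_pmf_single)
      finally show ?thesis .
    qed
    show "distr labels (?B e) (\<lambda>u. u e \<le> r e) = ?B e"
      by (rule measure_eqI_finite[of _ UNIV]) (auto intro: T)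
  qed simp
  finally show ?thesis .
qed

lemma prob_ge_subset:
  assumes "A \<in> sets labels" "A \<subseteq> B" "B \<in> sets labels" "c \<le> labels.prob A"
  shows "c \<le> labels.prob B"
  using labels.finite_measure_mono[OF assms(2,3)] assms(4) by linarith

lemma config_measurable:
  "Measurable.pred (PiM I (\<lambda>e. measure_pmf (B e))) (\<lambda>\<omega>. \<omega> e)"
proof (cases "e \<in> I")
  case True
  have "(\<lambda>\<omega>. \<omega> e) \<in> PiM I (\<lambda>e. measure_pmf (B e)) \<rightarrow>\<^sub>M measure_pmf (B e)"
    using True by (rule measurable_component_singleton)
  then show ?thesis by (simp cong: measurable_cong_sets)
next
  case False
  \<comment> \<open>Outside \<open>I\<close> every configuration in the product space takes the
    value \<open>undefined\<close>, so evaluation there is constant.\<close>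
  have "Measurable.pred (PiM I (\<lambda>e. measure_pmf (B e))) (\<lambda>\<omega>. \<omega> e) \<longleftrightarrow>
    Measurable.pred (PiM I (\<lambda>e. measure_pmf (B e))) (\<lambda>\<omega>. undefined :: bool)"
    using False by (intro measurable_cong) (auto simp: space_PiM PiE_def extensional_def)
  then show ?thesis by simp
qed

lemma conn_config_measurable [measurable]:
  "Measurable.pred (PiM I (\<lambda>e. measure_pmf (B e))) (\<lambda>\<omega>. conn \<omega> b n x y)"
proof (induction n arbitrary: b x)
  case (Suc n)
  note [measurable] = Suc config_measurable
  show ?case unfolding conn_Suc by measurable
qed simp

lemma coupling_measurable:
  "(\<lambda>u. \<lambda>e\<in>I. u e \<le> r e) \<in> labels \<rightarrow>\<^sub>M PiM I (\<lambda>e. measure_pmf (bernoulli_pmf (r e)))"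
proof (rule measurable_PiM_single')
  show "(\<lambda>u. (\<lambda>e\<in>I. u e \<le> r e) e) \<in> labels \<rightarrow>\<^sub>M measure_pmf (bernoulli_pmf (r e))" if "e \<in> I" for e
    using that by (simp cong: measurable_cong_sets)
qed (auto simp: PiE_def extensional_def)

lemma edges_nonempty: "edges \<noteq> {}" "{e \<in> edges. mid_height e > 0} \<noteq> {}"
proof -
  have "((0, 0), (1, 1)) \<in> {e \<in> edges. mid_height e > 0}"
    by (auto simp: edges_def sites_def mid_height_def)
  then show "edges \<noteq> {}" "{e \<in> edges. mid_height e > 0} \<noteq> {}" by blast+
qed

lemma homogeneous_eq_distr:
  assumes "0 \<le> p" "p \<le> 1"
  shows "homogeneous p = distr labels (homogeneous p) (\<lambda>u. \<lambda>e\<in>edges. u e \<le> p)"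
  using distr_labels_bernoulli[OF edges_nonempty(1), of "\<lambda>_. p"] assms by (simp add: homogeneous_def)

lemma conn_restrict_edges: "conn (\<lambda>e\<in>edges. u e \<le> p) = conn (env (\<lambda>_. p) u)"
  by (intro ext conn_cong) (auto simp: env_def)

lemma half_line_restrict_edges:
  "half_line (\<lambda>e\<in>edges. u e \<le> p) = half_line (env (\<lambda>_. p) u)"
  by (intro ext) (simp add: half_line_def conn_restrict_edges)

lemma homogeneous_prob_infinite_cluster:
  assumes "0 \<le> p" "p \<le> 1"
  shows "measure (homogeneous p) {\<omega> \<in> space (homogeneous p). infinite (cluster \<omega>)}
    = labels.prob {u. \<forall>k. \<exists>y. conn (env (\<lambda>_. p) u) 0 k 0 y}"
proof -
  let ?S = "{\<omega> \<in> space (homogeneous p). \<forall>k. \<exists>y. conn \<omega> 0 k 0 y}"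
  have S: "?S \<in> sets (homogeneous p)" unfolding homogeneous_def by measurable
  have m: "(\<lambda>u. \<lambda>e\<in>edges. u e \<le> p) \<in> labels \<rightarrow>\<^sub>M homogeneous p"
    using coupling_measurable[where I=edges and r="\<lambda>_. p"] by (simp add: homogeneous_def)
  have "measure (homogeneous p) ?S = labels.prob ((\<lambda>u. \<lambda>e\<in>edges. u e \<le> p) -` ?S \<inter> space labels)"
    by (subst homogeneous_eq_distr[OF assms], rule measure_distr[OF m S])
  also have "(\<lambda>u. \<lambda>e\<in>edges. u e \<le> p) -` ?S \<inter> space labels = {u. \<forall>k. \<exists>y. conn (env (\<lambda>_. p) u) 0 k 0 y}"
    using measurable_space[OF m] by (auto simp: conn_restrict_edges)
  finally show ?thesis by (simp add: infinite_cluster_iff)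
qed

lemma prob_Int_ge:
  assumes "A \<in> sets labels" "B \<in> sets labels"
  shows "labels.prob A + labels.prob B - 1 \<le> labels.prob (A \<inter> B)"
proof -
  have "labels.prob (A \<union> B) = labels.prob A + labels.prob B - labels.prob (A \<inter> B)"
    using assms labels.finite_measure_Union'[of A B] labels.finite_measure_Diff'[of B A]
    by (simp add: Int_commute)
  with labels.prob_le_1[of "A \<union> B"] show ?thesis by linarith
qed

section \<open>Events of probability tending to one\<close>

text \<open>The event \<open>E x\<close> need not be measurable: it only has to contain a measurable
  set of probability close to 1. Quantified statements about paths can thus be combined freely, and
  measurability is checked only when a probability is finally computed.\<close>

definition whp :: "'x filter \<Rightarrow> ('x \<Rightarrow> (edge \<Rightarrow> real) \<Rightarrow> bool) \<Rightarrow> bool" where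
  "whp F E \<longleftrightarrow> (\<forall>e>0. \<forall>\<^sub>F x in F. \<exists>A\<in>sets labels. 1 - e \<le> labels.prob A \<and> (\<forall>u\<in>A. E x u))"

lemma whp_mono:
  assumes "whp F E" "\<forall>\<^sub>F x in F. \<forall>u. E x u \<longrightarrow> E' x u"
  shows "whp F E'"
  unfolding whp_def
proof (intro allI impI)
  fix e :: real assume "e > 0"
  with assms(1) have "\<forall>\<^sub>F x in F. \<exists>A\<in>sets labels. 1 - e \<le> labels.prob A \<and> (\<forall>u\<in>A. E x u)"
    by (simp add: whp_def)
  then show "\<forall>\<^sub>F x in F. \<exists>A\<in>sets labels. 1 - e \<le> labels.prob A \<and> (\<forall>u\<in>A. E' x u)"
    using assms(2) by eventually_elim blast
qed

lemma whp_always: "(\<And>x u. E x u) \<Longrightarrow> whp F E"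
  unfolding whp_def using labels.prob_space sets.top[of labels]
  by (intro allI impI always_eventually bexI[of _ "space labels"]) auto

lemma whp_conj:
  assumes "whp F E" "whp F E'"
  shows "whp F (\<lambda>x u. E x u \<and> E' x u)"
  unfolding whp_def
proof (intro allI impI)
  fix e :: real assume "e > 0"
  then have "\<forall>\<^sub>F x in F. \<exists>A\<in>sets labels. 1 - e / 2 \<le> labels.prob A \<and> (\<forall>u\<in>A. E x u)"
    "\<forall>\<^sub>F x in F. \<exists>A\<in>sets labels. 1 - e / 2 \<le> labels.prob A \<and> (\<forall>u\<in>A. E' x u)"
    using assms by (simp_all add: whp_def)
  then show "\<forall>\<^sub>F x in F. \<exists>A\<in>sets labels. 1 - e \<le> labels.prob A \<and> (\<forall>u\<in>A. E x u \<and> E' x u)"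
  proof eventually_elim
    case (elim x)
    then obtain A A' where A: "A \<in> sets labels" "1 - e / 2 \<le> labels.prob A" "\<forall>u\<in>A. E x u"
      and A': "A' \<in> sets labels" "1 - e / 2 \<le> labels.prob A'" "\<forall>u\<in>A'. E' x u" by blast
    have "1 - e \<le> labels.prob (A \<inter> A')" using prob_Int_ge[OF A(1) A'(1)] A(2) A'(2) by linarith
    with A A' show ?case by (intro bexI[of _ "A \<inter> A'"]) auto
  qed
qed

lemma whp_ball:
  assumes "finite I" "\<And>i. i \<in> I \<Longrightarrow> whp F (E i)"
  shows "whp F (\<lambda>x u. \<forall>i\<in>I. E i x u)"
  using assms
proof (induction I)
  case (insert i I)
  then have "whp F (\<lambda>x u. E i x u \<and> (\<forall>i\<in>I. E i x u))" by (intro whp_conj) auto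
  then show ?case by simp
qed (simp add: whp_always)

lemma whp_compose: "whp F E \<Longrightarrow> filterlim h F G \<Longrightarrow> whp G (\<lambda>x. E (h x))"
  unfolding whp_def filterlim_iff by blast

text \<open>The map may change with \<open>x\<close>, since only the law of the labels at each
  single \<open>x\<close> matters. This permits translations whose size grows with the
  scale.\<close>

lemma whp_reindex:
  assumes "whp F E" "\<And>x. inj (\<pi> x)"
  shows "whp F (\<lambda>x u. E x (u \<circ> \<pi> x))"
  unfolding whp_def
proof (intro allI impI)
  fix e :: real assume "e > 0"
  with assms(1) have "\<forall>\<^sub>F x in F. \<exists>A\<in>sets labels. 1 - e \<le> labels.prob A \<and> (\<forall>u\<in>A. E x u)"
    by (simp add: whp_def)
  then show "\<forall>\<^sub>F x in F. \<exists>A\<in>sets labels. 1 - e \<le> labels.prob A \<and> (\<forall>u\<in>A. E x (u \<circ> \<pi> x))"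
  proof eventually_elim
    case (elim x)
    then obtain A where A: "A \<in> sets labels" "1 - e \<le> labels.prob A" "\<forall>u\<in>A. E x u" by blast
    then show ?case using prob_labels_reindex[OF assms(2)[of x] A(1)] reindex_sets[OF A(1)]
      by (intro bexI[of _ "{u. u \<circ> \<pi> x \<in> A}"]) auto
  qed
qed

lemma whp_imp_tendsto:
  assumes "whp F E" "\<And>x. {u. E x u} \<in> sets labels"
  shows "((\<lambda>x. labels.prob {u. E x u}) \<longlongrightarrow> 1) F"
proof (rule tendstoI)
  fix e :: real assume "e > 0"
  then have "\<forall>\<^sub>F x in F. \<exists>A\<in>sets labels. 1 - e / 2 \<le> labels.prob A \<and> (\<forall>u\<in>A. E x u)"
    using assms(1) by (simp add: whp_def)
  then show "\<forall>\<^sub>F x in F. dist (labels.prob {u. E x u}) 1 < e"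
  proof eventually_elim
    case (elim x)
    then obtain A where A: "A \<in> sets labels" "1 - e / 2 \<le> labels.prob A" "A \<subseteq> {u. E x u}" by blast
    then have "1 - e / 2 \<le> labels.prob {u. E x u}" using prob_ge_subset assms(2) by blast
    then show ?case using labels.prob_le_1[of "{u. E x u}"] \<open>e > 0\<close> by (simp add: dist_real_def)
  qed
qed

text \<open>The sets \<open>A K\<close> increase to a set of full measure, so continuity from below
  replaces the random threshold by a deterministic one.\<close>

lemma whp_of_AE:
  assumes [measurable]: "\<And>k::nat. Measurable.pred labels (Q k)"
    and ae: "AE u in labels. \<forall>\<^sub>F k in sequentially. Q k u"
  shows "whp sequentially (\<lambda>K u. \<forall>k\<ge>K. Q k u)"
proof -
  define A where "A K = {u. \<forall>k\<ge>K. Q k u}" for K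
  have A [measurable]: "A K \<in> sets labels" for K
  proof -
    have "{u \<in> space labels. \<forall>k\<ge>K. Q k u} \<in> sets labels" by measurable
    then show ?thesis by (simp add: A_def)
  qed
  have "incseq A" by (auto simp: A_def incseq_def)
  then have "(\<lambda>K. labels.prob (A K)) \<longlonglongrightarrow> labels.prob (\<Union>K. A K)"
    using A by (intro labels.finite_Lim_measure_incseq) auto
  moreover have "labels.prob (\<Union>K. A K) = 1"
  proof -
    have "AE u in labels. u \<in> (\<Union>K. A K)"
      using ae by eventually_elim (auto simp: A_def eventually_sequentially)
    then show ?thesis using A by (subst labels.prob_eq_1) auto
  qed
  ultimately have lim: "(\<lambda>K. labels.prob (A K)) \<longlonglongrightarrow> 1" by simp
  show ?thesis unfolding whp_def
  proof (intro allI impI)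
    fix e :: real assume "e > 0"
    then have "\<forall>\<^sub>F K in sequentially. 1 - e < labels.prob (A K)"
      by (intro order_tendstoD(1)[OF lim]) simp
    then show "\<forall>\<^sub>F K in sequentially. \<exists>B\<in>sets labels. 1 - e \<le> labels.prob B \<and> (\<forall>u\<in>B. \<forall>k\<ge>K. Q k u)"
    proof eventually_elim
      case (elim K)
      then show ?case using A by (intro bexI[of _ "A K"]) (auto simp: A_def)
    qed
  qed
qed

section \<open>The law of large numbers for the right edge\<close>

lemma speed_AE:
  assumes "right_edge_speed \<alpha>" "p \<in> {p_crit..1}" "0 \<le> p"
  shows "AE u in labels. (\<lambda>k. half_line_right (env (\<lambda>_. p) u) k / ereal (real k)) \<longlonglongrightarrow> ereal (\<alpha> p)"
proof -
  have p: "0 \<le> p" "p \<le> 1" using assms by auto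
  have m: "(\<lambda>u. \<lambda>e\<in>edges. u e \<le> p) \<in> labels \<rightarrow>\<^sub>M homogeneous p"
    using coupling_measurable[where I=edges and r="\<lambda>_. p"] by (simp add: homogeneous_def)
  have "AE \<omega> in homogeneous p. (\<lambda>k. half_line_right \<omega> k / ereal (real k)) \<longlonglongrightarrow> ereal (\<alpha> p)"
    using assms(1,2) by (simp add: right_edge_speed_def)
  then have "AE \<omega> in distr labels (homogeneous p) (\<lambda>u. \<lambda>e\<in>edges. u e \<le> p).
      (\<lambda>k. half_line_right \<omega> k / ereal (real k)) \<longlonglongrightarrow> ereal (\<alpha> p)"
    by (subst homogeneous_eq_distr[OF p, symmetric])
  from AE_distrD[OF m this] show ?thesis
    by (simp add: half_line_right_eq half_line_restrict_edges)
qed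

text \<open>All heights beyond \<open>K\<close> are treated at once, as the levels near the origin
  will need: a union bound over a growing number of heights would require a rate of
  convergence.\<close>

lemma speed_lower:
  assumes "right_edge_speed \<alpha>" "p \<in> {p_crit..1}" "0 \<le> p" "c < \<alpha> p"
  shows "whp sequentially (\<lambda>K u. \<forall>k\<ge>K. \<exists>y. c * real k \<le> of_int y \<and> half_line (env (\<lambda>_. p) u) 0 k 0 y)"
proof (rule whp_of_AE)
  show "AE u in labels. \<forall>\<^sub>F k in sequentially. \<exists>y. c * real k \<le> of_int y \<and> half_line (env (\<lambda>_. p) u) 0 k 0 y"
    using speed_AE[OF assms(1,2,3)]
  proof eventually_elim
    case (elim u)
    have "\<forall>\<^sub>F k in sequentially. ereal c < half_line_right (env (\<lambda>_. p) u) k / ereal (real k)"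
      using assms(4) by (intro order_tendstoD(1)[OF elim]) simp
    with eventually_gt_at_top[of 0] show ?case
    proof eventually_elim
      case (elim k)
      show ?case
      proof (rule ccontr)
        assume *: "\<nexists>y. c * real k \<le> of_int y \<and> half_line (env (\<lambda>_. p) u) 0 k 0 y"
        have "half_line_right (env (\<lambda>_. p) u) k \<le> ereal (c * real k)"
          unfolding half_line_right_eq using * by (intro SUP_least) force
        then have "half_line_right (env (\<lambda>_. p) u) k / ereal (real k) \<le> ereal (c * real k) / ereal (real k)"
          using elim by (intro ereal_divide_right_mono) auto
        also have "\<dots> = ereal c" using elim by simp
        finally show False using elim by simp
      qed
    qed
  qed
qed measurable

lemma speed_upper:
  assumes "right_edge_speed \<alpha>" "p \<in> {p_crit..1}" "0 \<le> p" "\<alpha> p < c"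
  shows "whp sequentially (\<lambda>K u. \<forall>k\<ge>K. \<forall>y. half_line (env (\<lambda>_. p) u) 0 k 0 y \<longrightarrow> of_int y \<le> c * real k)"
proof (rule whp_of_AE)
  show "AE u in labels. \<forall>\<^sub>F k in sequentially. \<forall>y. half_line (env (\<lambda>_. p) u) 0 k 0 y \<longrightarrow> of_int y \<le> c * real k"
    using speed_AE[OF assms(1,2,3)]
  proof eventually_elim
    case (elim u)
    have "\<forall>\<^sub>F k in sequentially. half_line_right (env (\<lambda>_. p) u) k / ereal (real k) < ereal c"
      using assms(4) by (intro order_tendstoD(2)[OF elim]) simp
    with eventually_gt_at_top[of 0] show ?case
    proof eventually_elim
      case (elim k)
      show ?case
      proof (intro allI impI)
        fix y assume y: "half_line (env (\<lambda>_. p) u) 0 k 0 y"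
        have "ereal (of_int y) \<le> half_line_right (env (\<lambda>_. p) u) k"
          unfolding half_line_right_eq using y by (intro SUP_upper) auto
        then have "ereal (of_int y) / ereal (real k) \<le> half_line_right (env (\<lambda>_. p) u) k / ereal (real k)"
          using elim by (intro ereal_divide_right_mono) auto
        with elim have "ereal (of_int y) / ereal (real k) < ereal c" by (meson order.strict_trans1)
        then show "of_int y \<le> c * real k" using elim by (simp add: field_simps)
      qed
    qed
  qed
qed measurable

lemma speed_lower_shift:
  fixes X B :: "'x \<Rightarrow> int"
  assumes "right_edge_speed \<alpha>" "p \<in> {p_crit..1}" "0 \<le> p" "c < \<alpha> p"
    and n: "filterlim n at_top F" and par: "\<And>x. even (X x + B x)"
  shows "whp F (\<lambda>x u. \<exists>y. of_int (X x) + c * real (n x) \<le> of_int y \<and>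
    half_line (env (\<lambda>_. p) u) (B x) (n x) (X x) y)"
proof -
  have "whp F (\<lambda>x u. \<forall>k\<ge>n x. \<exists>y. c * real k \<le> of_int y \<and> half_line (env (\<lambda>_. p) u) 0 k 0 y)"
    by (rule whp_compose[OF speed_lower[OF assms(1-4)] n])
  then have "whp F (\<lambda>x u. \<forall>k\<ge>n x. \<exists>y. c * real k \<le> of_int y \<and>
      half_line (env (\<lambda>_. p) (u \<circ> translate (X x) (B x))) 0 k 0 y)"
    using inj_translate by (rule whp_reindex)
  then show ?thesis
  proof (rule whp_mono, intro always_eventually allI impI)
    fix x u assume "\<forall>k\<ge>n x. \<exists>y. c * real k \<le> of_int y \<and>
      half_line (env (\<lambda>_. p) (u \<circ> translate (X x) (B x))) 0 k 0 y"
    then obtain y where "c * real (n x) \<le> of_int y"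
      "half_line (env (\<lambda>_. p) (u \<circ> translate (X x) (B x))) 0 (n x) 0 y" by blast
    then show "\<exists>y. of_int (X x) + c * real (n x) \<le> of_int y \<and>
      half_line (env (\<lambda>_. p) u) (B x) (n x) (X x) y"
      unfolding env_translate half_line_translate[OF par]
      by (intro exI[of _ "y + X x"]) auto
  qed
qed

lemma speed_upper_shift:
  fixes X B :: "'x \<Rightarrow> int"
  assumes "right_edge_speed \<alpha>" "p \<in> {p_crit..1}" "0 \<le> p" "\<alpha> p < c"
    and n: "filterlim n at_top F" and par: "\<And>x. even (X x + B x)"
  shows "whp F (\<lambda>x u. \<forall>y. half_line (env (\<lambda>_. p) u) (B x) (n x) (X x) y \<longrightarrow>
    of_int y \<le> of_int (X x) + c * real (n x))"
proof -
  have "whp F (\<lambda>x u. \<forall>k\<ge>n x. \<forall>y. half_line (env (\<lambda>_. p) u) 0 k 0 y \<longrightarrow> of_int y \<le> c * real k)"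
    by (rule whp_compose[OF speed_upper[OF assms(1-4)] n])
  then have "whp F (\<lambda>x u. \<forall>k\<ge>n x. \<forall>y.
      half_line (env (\<lambda>_. p) (u \<circ> translate (X x) (B x))) 0 k 0 y \<longrightarrow> of_int y \<le> c * real k)"
    using inj_translate by (rule whp_reindex)
  then show ?thesis
  proof (rule whp_mono, intro always_eventually allI impI)
    fix x u y assume "\<forall>k\<ge>n x. \<forall>y.
      half_line (env (\<lambda>_. p) (u \<circ> translate (X x) (B x))) 0 k 0 y \<longrightarrow> of_int y \<le> c * real k"
      and "half_line (env (\<lambda>_. p) u) (B x) (n x) (X x) y"
    then show "of_int y \<le> of_int (X x) + c * real (n x)"
      unfolding env_translate half_line_translate[OF par]
      by (elim allE[of _ "n x"] impE[OF _ order_refl] allE[of _ "y - X x"]) (auto simp: algebra_simps)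
  qed
qed

section \<open>The critical parameter is less than one\<close>

text \<open>Walks on the dual lattice \<open>{(a, n). odd (a + n)}\<close>. A direction is a pair (west, up). A west
  step has to cross a closed edge, an east step is free: it crosses its edge from the
  far side.\<close>

definition move :: "bool \<times> bool \<Rightarrow> site \<Rightarrow> site" where
  "move d v = (if fst d then fst v - 1 else fst v + 1, if snd d then snd v + 1 else snd v - 1)"

text \<open>The edge that separates \<open>v\<close> from its western neighbour in the vertical
  direction of \<open>d\<close>. An upward step crosses an edge leaning east, a downward step one
  leaning west, so the edge alone determines the site \<open>v\<close>.\<close>

definition crossed :: "bool \<times> bool \<Rightarrow> site \<Rightarrow> edge" where
  "crossed d v = (if snd d then ((fst v - 1, snd v), (fst v, snd v + 1))
     else ((fst v, snd v - 1), (fst v - 1, snd v)))"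

definition dual_step :: "(edge \<Rightarrow> bool) \<Rightarrow> site rel" where
  "dual_step \<omega> = {(v, move d v) | v d. fst d \<longrightarrow> \<not> \<omega> (crossed d v)}"

fun walk_end :: "site \<Rightarrow> (bool \<times> bool) list \<Rightarrow> site" where
  "walk_end v [] = v"
| "walk_end v (d # ds) = walk_end (move d v) ds"

fun walk_trace :: "site \<Rightarrow> (bool \<times> bool) list \<Rightarrow> site list" where
  "walk_trace v [] = [v]"
| "walk_trace v (d # ds) = v # walk_trace (move d v) ds"

fun crossings :: "site \<Rightarrow> (bool \<times> bool) list \<Rightarrow> edge set" where
  "crossings v [] = {}"
| "crossings v (d # ds) = (if fst d then {crossed d v} else {}) \<union> crossings (move d v) ds"

text \<open>Loop erasure: dropping the part of the walk before its visit to \<open>v\<close> keeps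
  the end point and can only lose crossings.\<close>

lemma walk_restart:
  assumes "v \<in> set (walk_trace v' ds)" "distinct (walk_trace v' ds)"
  shows "\<exists>ds'. walk_end v ds' = walk_end v' ds \<and> distinct (walk_trace v ds') \<and>
    crossings v ds' \<subseteq> crossings v' ds"
  using assms
proof (induction ds arbitrary: v')
  case (Cons d ds)
  show ?case
  proof (cases "v = v'")
    case True
    then show ?thesis using Cons.prems by blast
  next
    case False
    then have "\<exists>ds'. walk_end v ds' = walk_end (move d v') ds \<and> distinct (walk_trace v ds') \<and>
      crossings v ds' \<subseteq> crossings (move d v') ds"
      using Cons by auto
    then show ?thesis by auto
  qed
qed (auto intro!: exI[of _ "[]"])

lemma simple_dual_walk:
  assumes "(v, w) \<in> (dual_step \<omega>)\<^sup>*"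
  shows "\<exists>ds. walk_end v ds = w \<and> distinct (walk_trace v ds) \<and> (\<forall>e\<in>crossings v ds. \<not> \<omega> e)"
  using assms
proof (induction rule: converse_rtrancl_induct)
  case base
  show ?case by (intro exI[of _ "[]"]) simp
next
  case (step v v')
  then obtain ds where ds: "walk_end v' ds = w" "distinct (walk_trace v' ds)"
    "\<forall>e\<in>crossings v' ds. \<not> \<omega> e" by blast
  obtain d where d: "v' = move d v" "fst d \<longrightarrow> \<not> \<omega> (crossed d v)"
    using step(1) by (auto simp: dual_step_def)
  show ?case
  proof (cases "v \<in> set (walk_trace v' ds)")
    case True
    with walk_restart[OF True ds(2)] ds show ?thesis by (metis subsetD)
  next
    case False
    with ds d show ?thesis by (intro exI[of _ "d # ds"]) auto
  qed
qed

lemma crossings_trace: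
  "e \<in> crossings v ds \<Longrightarrow> \<exists>w\<in>set (walk_trace v ds). \<exists>d. e = crossed d w"
proof (induction ds arbitrary: v)
  case (Cons d ds)
  then have "e = crossed d v \<or> e \<in> crossings (move d v) ds" by (auto split: if_splits)
  then show ?case
  proof
    assume "e = crossed d v"
    then show ?thesis by (intro bexI[of _ v] exI[of _ d]) auto
  next
    assume "e \<in> crossings (move d v) ds"
    from Cons.IH[OF this] obtain w d' where "w \<in> set (walk_trace (move d v) ds)" "e = crossed d' w"
      by blast
    then show ?thesis by (intro bexI[of _ w] exI[of _ d']) auto
  qed
qed simp

lemma crossed_inj: "crossed d v = crossed d' w \<Longrightarrow> v = w"
  by (auto simp: crossed_def prod_eq_iff split: if_splits)

lemma finite_crossings: "finite (crossings v ds)"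
  by (induction ds arbitrary: v) auto

text \<open>A crossed edge determines the site it is crossed from, so on a walk without repeated
  sites distinct west steps cross distinct edges. The labels of these edges are then independent,
  and this is why walks are made simple.\<close>

lemma card_crossings:
  "distinct (walk_trace v ds) \<Longrightarrow> card (crossings v ds) = length (filter fst ds)"
proof (induction ds arbitrary: v)
  case (Cons d ds)
  then have "v \<notin> set (walk_trace (move d v) ds)" by simp
  then have "crossed d v \<notin> crossings (move d v) ds"
    using crossings_trace[of "crossed d v" "move d v" ds] crossed_inj by blast
  with Cons show ?case by (auto simp: finite_crossings)
qed simp

lemma fst_walk_end:
  "fst (walk_end v ds) = fst v + int (length ds) - 2 * int (length (filter fst ds))"
  by (induction ds arbitrary: v) (auto simp: move_def)

text \<open>The left boundary of this set is the contour. A walk may dip below level 0;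
  \<open>labels\<close> has labels for the edges there too.\<close>

definition dual_set :: "(edge \<Rightarrow> bool) \<Rightarrow> site set" where
  "dual_set \<omega> = {v. ((1, 0), v) \<in> (dual_step \<omega>)\<^sup>*}"

lemma dual_set_move:
  assumes "v \<in> dual_set \<omega>" "fst d \<longrightarrow> \<not> \<omega> (crossed d v)"
  shows "move d v \<in> dual_set \<omega>"
proof -
  have "(v, move d v) \<in> dual_step \<omega>" using assms(2) unfolding dual_step_def by blast
  then show ?thesis using assms(1) by (auto simp: dual_set_def)
qed

lemma dual_set_steps:
  assumes "(a, n) \<in> dual_set \<omega>"
  shows "(a + 1, n + 1) \<in> dual_set \<omega>" "(a + 1, n - 1) \<in> dual_set \<omega>"
    "\<not> \<omega> ((a - 1, n), (a, n + 1)) \<Longrightarrow> (a - 1, n + 1) \<in> dual_set \<omega>"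
    "\<not> \<omega> ((a, n - 1), (a - 1, n)) \<Longrightarrow> (a - 1, n - 1) \<in> dual_set \<omega>"
  using dual_set_move[OF assms, of "(False, True)"] dual_set_move[OF assms, of "(False, False)"]
    dual_set_move[OF assms, of "(True, True)"] dual_set_move[OF assms, of "(True, False)"]
  by (auto simp: move_def crossed_def)

lemma dual_set_base: "(2 * int j + 1, 0) \<in> dual_set \<omega>"
proof (induction j)
  case (Suc j)
  from dual_set_steps(2)[OF dual_set_steps(1)[OF Suc]] show ?case by (simp add: algebra_simps)
qed (simp add: dual_set_def)

lemma dual_set_diagonal: "(int k + 1, int k) \<in> dual_set \<omega>"
proof (induction k)
  case (Suc k)
  from dual_set_steps(1)[OF Suc] show ?case by (simp add: algebra_simps)
qed (simp add: dual_set_def)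

text \<open>An open path can be followed downwards along the left boundary of the dual set.\<close>

lemma half_line_of_dual_boundary:
  assumes "even (m + int k)" "(m + 1, int k) \<in> dual_set \<omega>" "(m - 1, int k) \<notin> dual_set \<omega>"
  shows "half_line \<omega> 0 k 0 m"
  using assms
proof (induction k arbitrary: m)
  case 0
  have "m \<le> 0"
  proof (rule ccontr)
    assume "\<not> m \<le> 0"
    then have "m - 1 = 2 * int (nat (m div 2 - 1)) + 1" using 0(1) by auto
    then show False using 0(3) dual_set_base by (metis of_nat_0)
  qed
  then show ?case using 0(1) by (auto simp: half_line_def)
next
  case (Suc k)
  have one: "half_line \<omega> 0 (Suc k) 0 m" if "half_line \<omega> 0 k 0 x" "conn \<omega> (0 + int k) 1 x m" for x
    using that half_line_add[of \<omega> 0 k 1 0 m] by auto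
  \<comment> \<open>The dual site \<open>(m, int k)\<close> separates the two possible predecessors
    of \<open>m\<close>. If it is in the set, a closed edge from \<open>m - 1\<close> would put the
    excluded western neighbour of \<open>m\<close> into the set. If it is not, a closed edge from
    \<open>m + 1\<close> would make it reachable from the eastern neighbour. So the edge concerned
    is open in either case.\<close>
  show ?case
  proof (cases "(m, int k) \<in> dual_set \<omega>")
    case True
    have "\<omega> ((m - 1, int k), (m, int k + 1))"
      using dual_set_steps(3)[OF True] Suc.prems(3) by (auto simp: algebra_simps)
    then have "conn \<omega> (0 + int k) 1 (m - 1) m" using Suc.prems(1) by simp
    moreover have "(m - 1 - 1, int k) \<notin> dual_set \<omega>"
      using dual_set_steps(1)[of "m - 1 - 1" "int k" \<omega>] Suc.prems(3) by (auto simp: algebra_simps)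
    then have "half_line \<omega> 0 k 0 (m - 1)"
      using True Suc.prems(1) by (intro Suc.IH) auto
    ultimately show ?thesis using one by blast
  next
    case False
    have "\<omega> ((m + 1, int k), (m, int k + 1))"
      using dual_set_steps(4)[OF Suc.prems(2)] False by (auto simp: algebra_simps)
    then have "conn \<omega> (0 + int k) 1 (m + 1) m" using Suc.prems(1) by simp
    moreover have "(m + 1 + 1, int k) \<in> dual_set \<omega>"
      using dual_set_steps(2)[OF Suc.prems(2)] by (auto simp: algebra_simps)
    then have "half_line \<omega> 0 k 0 (m + 1)"
      using False Suc.prems(1) by (intro Suc.IH) auto
    ultimately show ?thesis using one by blast
  qed
qed

text \<open>Scan level \<open>k\<close> leftwards from the diagonal. A site \<open>m\<close> with
  its eastern dual neighbour in the set and its western one outside is the end of an open path from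
  the left half line. As no such \<open>m \<ge> 0\<close> exists, the dual set extends to a
  nonpositive abscissa.\<close>

lemma closed_walk_of_retreat:
  assumes "\<nexists>y. y \<ge> 0 \<and> half_line \<omega> 0 k 0 y"
  obtains ds where "distinct (walk_trace (1, 0) ds)" "fst (walk_end (1, 0) ds) \<le> 0"
    "\<forall>e\<in>crossings (1, 0) ds. \<not> \<omega> e"
proof -
  have "(int k + 1 - 2 * int j, int k) \<in> dual_set \<omega>" if "\<forall>i<j. 2 * i \<le> k" for j
    using that
  proof (induction j)
    case 0
    then show ?case using dual_set_diagonal by simp
  next
    case (Suc j)
    then have Q: "(int k - 2 * int j + 1, int k) \<in> dual_set \<omega>" by (simp add: algebra_simps)
    have "\<not> half_line \<omega> 0 k 0 (int k - 2 * int j)" using assms Suc.prems by force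
    then have "(int k - 2 * int j - 1, int k) \<in> dual_set \<omega>"
      using half_line_of_dual_boundary[OF _ Q] by auto
    then show ?case by (simp add: algebra_simps)
  qed
  \<comment> \<open>This many double steps lead from \<open>int k + 1\<close> to -1 if
    \<open>k\<close> is even and to 0 if \<open>k\<close> is odd; the ones before started from gaps
    \<open>m \<ge> 0\<close>.\<close>
  from this[of "k div 2 + 1"] have "(int k + 1 - 2 * int (k div 2 + 1), int k) \<in> dual_set \<omega>"
    by fastforce
  then obtain a where "a \<le> 0" "(a, int k) \<in> dual_set \<omega>"
    by (rule that[rotated]) presburger
  then show ?thesis using simple_dual_walk[of "(1, 0)" "(a, int k)" \<omega>] that
    by (auto simp: dual_set_def)
qed

text \<open>Peierls counting. A walk of length n from abscissa 1 to a nonpositive one makes at least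
  n/2 west steps, so its crossings are all closed with probability at most (1 - p)^(n/2) = 16^(-n).
  There are at most 4^n walks, and the sum of 4^(-n) over n \<ge> 1 is 1/3. The parameter is chosen
  to push this failure probability below 1/2, so that the event meets its mirror image with positive
  probability.\<close>

lemma prob_no_retreat:
  assumes "p = 255 / 256"
  shows "labels.prob {u. \<forall>k. \<exists>y\<ge>0. half_line (env (\<lambda>_. p) u) 0 k 0 y} \<ge> 2 / 3"
proof -
  define G where "G L = {ds. length ds = Suc L \<and> distinct (walk_trace (1, 0) ds) \<and>
    fst (walk_end (1, 0) ds) \<le> 0}" for L
  define E where "E ds = {u. \<forall>e\<in>crossings (1, 0) ds. p < u e}" for ds
  define A where "A L = (\<Union>ds\<in>G L. E ds)" for L
  have p: "0 \<le> p" "p \<le> 1" "1 - p = (1 / 16) ^ 2" using assms by (auto simp: power2_eq_square)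
  have GL: "G L \<subseteq> {ds. set ds \<subseteq> UNIV \<and> length ds = Suc L}" for L by (auto simp: G_def)
  have card_all: "card {ds :: (bool \<times> bool) list. set ds \<subseteq> UNIV \<and> length ds = Suc L} = 4 ^ Suc L" for L
    by (subst card_lists_length_eq) (simp_all add: card_prod)
  have fin_all: "finite {ds :: (bool \<times> bool) list. set ds \<subseteq> UNIV \<and> length ds = Suc L}" for L
    by (rule finite_lists_length_eq) simp
  have finG: "finite (G L)" for L using GL fin_all finite_subset by blast
  have cardG: "card (G L) \<le> 4 ^ Suc L" for L using card_mono[OF fin_all GL] card_all by metis
  have E_sets: "E ds \<in> sets labels" for ds
  proof -
    have "{u \<in> space labels. \<forall>e\<in>crossings (1, 0) ds. p < u e} \<in> sets labels"
      using finite_crossings by (intro sets.sets_Collect_finite_All) measurable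
    then show ?thesis by (simp add: E_def)
  qed
  have E_prob: "labels.prob (E ds) \<le> (1 / 16) ^ Suc L" if "ds \<in> G L" for ds L
  proof -
    have ds: "length ds = Suc L" "distinct (walk_trace (1, 0) ds)" "fst (walk_end (1, 0) ds) \<le> 0"
      using that by (auto simp: G_def)
    have "2 * card (crossings (1, 0) ds) \<ge> Suc L"
      using fst_walk_end[of "(1, 0)" ds] card_crossings[OF ds(2)] ds by simp
    then have "(1 / 16 :: real) ^ (2 * card (crossings (1, 0) ds)) \<le> (1 / 16) ^ Suc L"
      by (intro power_decreasing) auto
    then show ?thesis
      using prob_all_labels[OF finite_crossings p(1,2), of "(1, 0)" ds] p(3) by (simp add: E_def power_mult)
  qed
  have A_sets: "A L \<in> sets labels" for L
    using finG E_sets unfolding A_def by (intro sets.finite_UN) auto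
  have A_prob: "labels.prob (A L) \<le> (1 / 4) ^ Suc L" for L
  proof -
    have "labels.prob (A L) \<le> (\<Sum>ds\<in>G L. labels.prob (E ds))"
      unfolding A_def using finG E_sets by (intro labels.finite_measure_subadditive_finite) auto
    also have "\<dots> \<le> (\<Sum>ds\<in>G L. (1 / 16) ^ Suc L)" by (intro sum_mono E_prob)
    also have "\<dots> = real (card (G L)) * (1 / 16) ^ Suc L" by simp
    also have "\<dots> \<le> 4 ^ Suc L * (1 / 16) ^ Suc L"
      using cardG[of L] by (intro mult_right_mono) (auto simp flip: of_nat_le_iff[where 'a=real])
    also have "\<dots> = (1 / 4) ^ Suc L" unfolding power_mult_distrib[symmetric] by simp
    finally show ?thesis .
  qed
  have geo: "(\<lambda>L. (1 / 4 :: real) ^ Suc L) sums (1 / 3)"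
  proof -
    have "(\<lambda>L. 1 / 4 * (1 / 4 :: real) ^ L) sums (1 / 4 * (1 / (1 - 1 / 4)))"
      by (intro sums_mult geometric_sums) simp
    then show ?thesis by simp
  qed
  have sm: "summable (\<lambda>L. labels.prob (A L))"
  proof (rule summable_comparison_test'[OF sums_summable[OF geo], of 0])
    show "norm (labels.prob (A L)) \<le> (1 / 4) ^ Suc L" for L
      using A_prob[of L] by (simp del: power_Suc)
  qed
  have "labels.prob (\<Union>L. A L) \<le> (\<Sum>L. labels.prob (A L))"
    using A_sets sm by (intro labels.finite_measure_subadditive_countably) auto
  also have "\<dots> \<le> 1 / 3" using suminf_le[OF A_prob sm sums_summable[OF geo]] sums_unique[OF geo] by simp
  finally have U: "labels.prob (\<Union>L. A L) \<le> 1 / 3" .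
  let ?S = "{u. \<forall>k. \<exists>y\<ge>0. half_line (env (\<lambda>_. p) u) 0 k 0 y}"
  have "{u \<in> space labels. \<forall>k. \<exists>y\<ge>0. half_line (env (\<lambda>_. p) u) 0 k 0 y} \<in> sets labels" by measurable
  then have S: "?S \<in> sets labels" by simp
  have sub: "space labels - (\<Union>L. A L) \<subseteq> ?S"
  proof (intro subsetI, rule ccontr)
    fix u assume u: "u \<in> space labels - (\<Union>L. A L)" "u \<notin> ?S"
    then obtain k where "\<nexists>y. y \<ge> 0 \<and> half_line (env (\<lambda>_. p) u) 0 k 0 y" by blast
    then obtain ds where ds: "distinct (walk_trace (1, 0) ds)" "fst (walk_end (1, 0) ds) \<le> 0"
      "\<forall>e\<in>crossings (1, 0) ds. \<not> env (\<lambda>_. p) u e" by (rule closed_walk_of_retreat)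
    then have "ds \<noteq> []" by auto
    then have "ds \<in> G (length ds - 1)" using ds by (auto simp: G_def)
    moreover have "u \<in> E ds" using ds(3) by (auto simp: E_def env_def)
    ultimately show False using u(1) by (auto simp: A_def)
  qed
  have UA: "(\<Union>L. A L) \<in> sets labels" using A_sets by (intro sets.countable_UN) auto
  have "2 / 3 \<le> labels.prob (space labels - (\<Union>L. A L))"
    using U unfolding labels.prob_compl[OF UA] by linarith
  then show ?thesis by (rule prob_ge_subset[OF sets.compl_sets[OF UA] sub S])
qed

lemma p_crit_set_bdd: "bdd_below {p \<in> {0..1}. measure (homogeneous p)
    {\<omega> \<in> space (homogeneous p). infinite (cluster \<omega>)} > 0}"
  by (intro bdd_belowI[of _ 0]) auto

lemma supercritical_nonempty: "measure (homogeneous (255 / 256))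
    {\<omega> \<in> space (homogeneous (255 / 256)). infinite (cluster \<omega>)} > 0"
proof -
  define p :: real where "p = 255 / 256"
  let ?R = "{u. \<forall>k. \<exists>y\<ge>0. half_line (env (\<lambda>_. p) u) 0 k 0 y}"
  let ?L = "{u. u \<circ> reflect \<in> ?R}"
  let ?S = "{u. \<forall>k. \<exists>y. conn (env (\<lambda>_. p) u) 0 k 0 y}"
  have "{u \<in> space labels. \<forall>k. \<exists>y\<ge>0. half_line (env (\<lambda>_. p) u) 0 k 0 y} \<in> sets labels" by measurable
  then have R: "?R \<in> sets labels" by simp
  have L: "?L \<in> sets labels" using reindex_sets[OF R] .
  have "{u \<in> space labels. \<forall>k. \<exists>y. conn (env (\<lambda>_. p) u) 0 k 0 y} \<in> sets labels" by measurable
  then have S: "?S \<in> sets labels" by simp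
  have pr: "labels.prob ?R \<ge> 2 / 3" "labels.prob ?L \<ge> 2 / 3"
    using prob_no_retreat[of p] prob_labels_reindex[OF inj_reflect R] by (auto simp: p_def)
  have ge: "1 / 3 \<le> labels.prob (?R \<inter> ?L)" using prob_Int_ge[OF R L] pr by linarith
  have sub: "?R \<inter> ?L \<subseteq> ?S"
  proof
    fix u assume u: "u \<in> ?R \<inter> ?L"
    have "\<exists>z. conn (env (\<lambda>_. p) u) 0 k 0 z" for k
      using u by (intro origin_survives[of k]) (auto simp: env_reflect)
    then show "u \<in> ?S" by simp
  qed
  have "1 / 3 \<le> labels.prob ?S" by (rule prob_ge_subset[OF sets.Int[OF R L] sub S ge])
  moreover have "0 \<le> p" "p \<le> 1" by (auto simp: p_def)
  ultimately show ?thesis using homogeneous_prob_infinite_cluster[of p]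
    unfolding p_def[symmetric] by linarith
qed

lemma p_crit_less_1: "p_crit < 1"
proof -
  have "p_crit \<le> 255 / 256"
    unfolding p_crit_def
  proof (rule cInf_lower[OF _ p_crit_set_bdd], rule CollectI, rule conjI)
    show "(255 / 256 :: real) \<in> {0..1}" by simp
  qed (rule supercritical_nonempty)
  then show ?thesis by simp
qed

section \<open>Exponential moments of the right edge\<close>

text \<open>The exponential of \<theta> times the right edge. As a supremum over reached sites it is
  0 if no site is reached, and it is measurable as a countable supremum.\<close>

definition exp_edge :: "real \<Rightarrow> (edge \<Rightarrow> bool) \<Rightarrow> int \<Rightarrow> nat \<Rightarrow> int \<Rightarrow> ennreal" where
  "exp_edge \<theta> \<omega> b n X = (SUP y. if half_line \<omega> b n X y then ennreal (exp (\<theta> * of_int y)) else 0)"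

definition rightmost :: "(edge \<Rightarrow> bool) \<Rightarrow> nat \<Rightarrow> int \<Rightarrow> bool" where
  "rightmost \<omega> j x \<longleftrightarrow> half_line \<omega> 0 j 0 x \<and> (\<forall>y>x. \<not> half_line \<omega> 0 j 0 y)"

lemma exp_edge_measurable [measurable]:
  "(\<lambda>u. exp_edge \<theta> (env P u) b n X) \<in> borel_measurable labels"
  unfolding exp_edge_def by measurable

lemma rightmost_measurable [measurable]: "Measurable.pred labels (\<lambda>u. rightmost (env P u) j x)"
  unfolding rightmost_def by measurable

lemma exp_edge_upper:
  "half_line \<omega> b n X y \<Longrightarrow> ennreal (exp (\<theta> * of_int y)) \<le> exp_edge \<theta> \<omega> b n X"
  unfolding exp_edge_def by (rule SUP_upper2[of y]) auto

lemma exp_edge_least: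
  assumes "\<And>y. half_line \<omega> b n X y \<Longrightarrow> ennreal (exp (\<theta> * of_int y)) \<le> C"
  shows "exp_edge \<theta> \<omega> b n X \<le> C"
  unfolding exp_edge_def using assms by (intro SUP_least) auto

lemma exp_edge_cong:
  assumes "\<And>y. half_line \<omega> b n X y = half_line \<omega>' b n X y"
  shows "exp_edge \<theta> \<omega> b n X = exp_edge \<theta> \<omega>' b n X"
  by (simp add: exp_edge_def assms)

lemma exp_edge_bound:
  assumes "\<theta> > 0"
  shows "exp_edge \<theta> \<omega> b n X \<le> ennreal (exp (\<theta> * (of_int X + real n)))"
proof (rule exp_edge_least)
  fix y assume "half_line \<omega> b n X y"
  then have "y \<le> X + int n" by (rule half_line_bound)
  then have "real_of_int y \<le> of_int X + real n" by linarith
  then show "ennreal (exp (\<theta> * of_int y)) \<le> ennreal (exp (\<theta> * (of_int X + real n)))"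
    using assms by (intro ennreal_leI) simp
qed

lemma rightmost_exists:
  assumes "half_line \<omega> 0 j 0 y"
  shows "\<exists>i. rightmost \<omega> j (int j - int i)"
proof -
  have 1: "z \<le> int j" if "half_line \<omega> 0 j 0 z" for z using half_line_bound[OF that] by simp
  define i where "i = (LEAST i. half_line \<omega> 0 j 0 (int j - int i))"
  have "half_line \<omega> 0 j 0 (int j - int (nat (int j - y)))" using assms 1[OF assms] by simp
  then have i: "half_line \<omega> 0 j 0 (int j - int i)" unfolding i_def by (rule LeastI)
  have "\<not> half_line \<omega> 0 j 0 z" if "z > int j - int i" for z
  proof
    assume z: "half_line \<omega> 0 j 0 z"
    then have "half_line \<omega> 0 j 0 (int j - int (nat (int j - z)))" using 1[OF z] by simp
    then have "i \<le> nat (int j - z)" unfolding i_def by (rule Least_le)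
    then show False using that 1[OF z] by linarith
  qed
  with i show ?thesis by (auto simp: rightmost_def)
qed

lemma rightmost_unique: "rightmost \<omega> j x \<Longrightarrow> rightmost \<omega> j y \<Longrightarrow> x = y"
  unfolding rightmost_def by (metis linorder_neqE)

lemma suminf_rightmost:
  fixes h :: "nat \<Rightarrow> ennreal"
  assumes "rightmost \<omega> j (int j - int i)"
  shows "(\<Sum>i. of_bool (rightmost \<omega> j (int j - int i)) * h i) = h i"
proof -
  have "of_bool (rightmost \<omega> j (int j - int i')) * h i' = 0" if "i' \<notin> {i}" for i'
    using rightmost_unique[OF assms, of "int j - int i'"] that by auto
  then have "(\<Sum>i. of_bool (rightmost \<omega> j (int j - int i)) * h i)
      = (\<Sum>i\<in>{i}. of_bool (rightmost \<omega> j (int j - int i)) * h i)"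
    by (intro suminf_finite) auto
  then show ?thesis using assms by simp
qed

text \<open>The right edge at height \<open>j\<close> is at most \<open>int j\<close>, so a natural
  number \<open>i\<close> records its deficit, and at most one summand is nonzero. Summing over
  \<open>i\<close> amounts to conditioning on the position of the edge.\<close>

lemma exp_edge_eq_suminf:
  assumes "\<theta> > 0"
  shows "exp_edge \<theta> \<omega> 0 j 0 =
    (\<Sum>i. of_bool (rightmost \<omega> j (int j - int i)) * ennreal (exp (\<theta> * (real j - real i))))"
proof (cases "\<exists>y. half_line \<omega> 0 j 0 y")
  case True
  then obtain i where i: "rightmost \<omega> j (int j - int i)" using rightmost_exists by blast
  have "exp_edge \<theta> \<omega> 0 j 0 = ennreal (exp (\<theta> * (real j - real i)))"
  proof (rule antisym)
    show "exp_edge \<theta> \<omega> 0 j 0 \<le> ennreal (exp (\<theta> * (real j - real i)))"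
    proof (rule exp_edge_least)
      fix y assume "half_line \<omega> 0 j 0 y"
      then have "y \<le> int j - int i" using i unfolding rightmost_def by (meson not_le)
      then have "real_of_int y \<le> real j - real i" by linarith
      then show "ennreal (exp (\<theta> * of_int y)) \<le> ennreal (exp (\<theta> * (real j - real i)))"
        using assms by (intro ennreal_leI) simp
    qed
    show "ennreal (exp (\<theta> * (real j - real i))) \<le> exp_edge \<theta> \<omega> 0 j 0"
      using exp_edge_upper[of \<omega> 0 j 0 "int j - int i" \<theta>] i by (simp add: rightmost_def)
  qed
  then show ?thesis by (simp only: suminf_rightmost[OF i])
next
  case False
  then have "exp_edge \<theta> \<omega> 0 j 0 = 0" "\<And>x. \<not> rightmost \<omega> j x"
    by (auto simp: exp_edge_def rightmost_def)
  then show ?thesis by simp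
qed

text \<open>Every path continues from a site at or left of the right edge at level \<open>j\<close>,
  so restarting from the full half line there loses no path. This is the source of
  submultiplicativity.\<close>

lemma exp_edge_le_suminf:
  "exp_edge \<theta> \<omega> 0 (j + m) 0 \<le>
    (\<Sum>i. of_bool (rightmost \<omega> j (int j - int i)) * exp_edge \<theta> \<omega> (int j) m (int j - int i))"
proof (rule exp_edge_least)
  fix y assume "half_line \<omega> 0 (j + m) 0 y"
  then obtain z where z: "half_line \<omega> 0 j 0 z" "conn \<omega> (int j) m z y"
    unfolding half_line_add by auto
  then obtain i where i: "rightmost \<omega> j (int j - int i)" using rightmost_exists by blast
  then have "z \<le> int j - int i" using z(1) unfolding rightmost_def by (meson not_le)
  then have "half_line \<omega> (int j) m (int j - int i) y" using z(2) by (auto simp: half_line_def)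
  then show "ennreal (exp (\<theta> * of_int y)) \<le>
      (\<Sum>i. of_bool (rightmost \<omega> j (int j - int i)) * exp_edge \<theta> \<omega> (int j) m (int j - int i))"
    unfolding suminf_rightmost[OF i] by (rule exp_edge_upper)
qed

lemma exp_edge_translate:
  assumes "even (X + b)"
  shows "exp_edge \<theta> \<omega> b n X = ennreal (exp (\<theta> * of_int X)) * exp_edge \<theta> (\<omega> \<circ> translate X b) 0 n 0"
proof -
  define F where "F y = (if half_line \<omega> b n X y then ennreal (exp (\<theta> * of_int y)) else 0)" for y
  have "surj (\<lambda>y. y + X)" by (rule surjI[of _ "\<lambda>y. y - X"]) simp
  then have "range (\<lambda>y. F (y + X)) = range F" by (metis image_image)
  then have "exp_edge \<theta> \<omega> b n X = (SUP y. F (y + X))" by (simp add: exp_edge_def F_def)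
  also have "\<dots> = (SUP y. ennreal (exp (\<theta> * of_int X)) *
      (if half_line (\<omega> \<circ> translate X b) 0 n 0 y then ennreal (exp (\<theta> * of_int y)) else 0))"
    by (intro SUP_cong refl)
      (auto simp: F_def half_line_translate[OF assms] distrib_left exp_add mult.commute simp flip: ennreal_mult)
  also have "\<dots> = ennreal (exp (\<theta> * of_int X)) * exp_edge \<theta> (\<omega> \<circ> translate X b) 0 n 0"
    unfolding exp_edge_def by (rule SUP_mult_left_ennreal[symmetric])
  finally show ?thesis .
qed

definition exp_moment :: "real \<Rightarrow> real \<Rightarrow> nat \<Rightarrow> ennreal" where
  "exp_moment \<theta> p n = (\<integral>\<^sup>+u. exp_edge \<theta> (env (\<lambda>_. p) u) 0 n 0 \<partial>labels)"

lemma exp_moment_shift: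
  assumes "even (X + b)" "\<And>k. b \<le> k \<Longrightarrow> k < b + int n \<Longrightarrow> P k = p"
  shows "(\<integral>\<^sup>+u. exp_edge \<theta> (env P u) b n X \<partial>labels) = ennreal (exp (\<theta> * of_int X)) * exp_moment \<theta> p n"
proof -
  have "exp_edge \<theta> (env P u) b n X = exp_edge \<theta> (env (\<lambda>_. p) u) b n X" for u
    by (intro exp_edge_cong half_line_cong) (auto simp: env_def assms(2))
  then have "(\<integral>\<^sup>+u. exp_edge \<theta> (env P u) b n X \<partial>labels)
      = (\<integral>\<^sup>+u. ennreal (exp (\<theta> * of_int X)) * exp_edge \<theta> (env (\<lambda>_. p) (u \<circ> translate X b)) 0 n 0 \<partial>labels)"
    by (simp add: exp_edge_translate[OF assms(1)] env_translate)
  also have "\<dots> = ennreal (exp (\<theta> * of_int X)) *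
      (\<integral>\<^sup>+u. exp_edge \<theta> (env (\<lambda>_. p) (u \<circ> translate X b)) 0 n 0 \<partial>labels)"
    using measurable_compose[OF reindex_measurable exp_edge_measurable] by (intro nn_integral_cmult) simp
  also have "(\<integral>\<^sup>+u. exp_edge \<theta> (env (\<lambda>_. p) (u \<circ> translate X b)) 0 n 0 \<partial>labels) = exp_moment \<theta> p n"
    unfolding exp_moment_def
    by (rule nn_integral_labels_reindex[OF inj_translate]) measurable
  finally show ?thesis .
qed

lemma exp_moment_bound:
  assumes "\<theta> > 0"
  shows "exp_moment \<theta> p n \<le> ennreal (exp (\<theta> * real n))"
proof -
  have "exp_moment \<theta> p n \<le> (\<integral>\<^sup>+u. ennreal (exp (\<theta> * real n)) \<partial>labels)"
    unfolding exp_moment_def using exp_edge_bound[OF assms, of _ 0 n 0] by (intro nn_integral_mono) simp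
  also have "\<dots> = ennreal (exp (\<theta> * real n))" by (simp add: labels.emeasure_space_1[simplified])
  finally show ?thesis .
qed

lemma exp_moment_finite: "\<theta> > 0 \<Longrightarrow> exp_moment \<theta> p n < top"
  using exp_moment_bound ennreal_less_top le_less_trans by blast

lemma rightmost_env_cong:
  assumes "\<And>k. 0 \<le> k \<Longrightarrow> k < int j \<Longrightarrow> P k = P' k"
    and "\<And>e. 0 \<le> snd (fst e) \<Longrightarrow> snd (fst e) < int j \<Longrightarrow> u e = v e"
  shows "rightmost (env P u) j x = rightmost (env P' v) j x"
proof -
  have "half_line (env P u) 0 j 0 y = half_line (env P' v) 0 j 0 y" for y
    by (intro half_line_cong) (use assms in \<open>auto simp: env_def\<close>)
  then show ?thesis by (simp add: rightmost_def)
qed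

lemma exp_edge_env_cong:
  assumes "\<And>e. b \<le> snd (fst e) \<Longrightarrow> snd (fst e) < b + int m \<Longrightarrow> u e = v e"
  shows "exp_edge \<theta> (env P u) b m X = exp_edge \<theta> (env P v) b m X"
  by (intro exp_edge_cong half_line_cong) (use assms in \<open>auto simp: env_def\<close>)

section \<open>Raising the parameter one level at a time\<close>

definition hybrid :: "real \<Rightarrow> real \<Rightarrow> nat \<Rightarrow> int \<Rightarrow> real" where
  "hybrid p q j k = (if k < int j then q else p)"

definition hybrid_moment :: "real \<Rightarrow> real \<Rightarrow> real \<Rightarrow> nat \<Rightarrow> nat \<Rightarrow> ennreal" where
  "hybrid_moment \<theta> p q n j = (\<integral>\<^sup>+u. exp_edge \<theta> (env (hybrid p q j) u) 0 n 0 \<partial>labels)"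

lemma rightmost_even: "rightmost \<omega> j x \<Longrightarrow> even (x + int j)"
  unfolding rightmost_def half_line_def using conn_even_end by fastforce

definition rightmost_prob :: "real \<Rightarrow> nat \<Rightarrow> nat \<Rightarrow> ennreal" where
  "rightmost_prob q j i = (\<integral>\<^sup>+u. of_bool (rightmost (env (\<lambda>_. q) u) j (int j - int i)) \<partial>labels)"

lemma exp_moment_eq_suminf:
  assumes "\<theta> > 0"
  shows "exp_moment \<theta> q j = (\<Sum>i. rightmost_prob q j i * ennreal (exp (\<theta> * (real j - real i))))"
  unfolding exp_moment_def exp_edge_eq_suminf[OF assms] rightmost_prob_def
  by (subst nn_integral_suminf) (auto simp: nn_integral_multc)

text \<open>The right edge at level \<open>j\<close> depends on labels below that level, the
  restarted process on labels from that level on. The expectations therefore factor, and translation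
  extracts the exponential of the starting position.\<close>

lemma hybrid_moment_le:
  assumes "\<theta> > 0"
  shows "hybrid_moment \<theta> p q (j + m) j \<le> exp_moment \<theta> q j * exp_moment \<theta> p m"
proof -
  let ?\<omega> = "\<lambda>u. env (hybrid p q j) u"
  have summand: "(\<integral>\<^sup>+u. of_bool (rightmost (?\<omega> u) j (int j - int i)) * exp_edge \<theta> (?\<omega> u) (int j) m (int j - int i) \<partial>labels)
    = rightmost_prob q j i * ennreal (exp (\<theta> * (real j - real i))) * exp_moment \<theta> p m" for i
  \<comment> \<open>For odd \<open>i\<close> the position violates parity and both sides vanish; the
    translation to the origin is available only for even \<open>i\<close>.\<close>
  proof (cases "even i")
    case True
    have "(\<integral>\<^sup>+u. of_bool (rightmost (?\<omega> u) j (int j - int i)) * exp_edge \<theta> (?\<omega> u) (int j) m (int j - int i) \<partial>labels)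
      = (\<integral>\<^sup>+u. of_bool (rightmost (?\<omega> u) j (int j - int i)) \<partial>labels) *
        (\<integral>\<^sup>+u. exp_edge \<theta> (?\<omega> u) (int j) m (int j - int i) \<partial>labels)"
    proof (rule nn_integral_labels_indep[of _ _ "{e. snd (fst e) < int j}" "{e. int j \<le> snd (fst e)}"])
      show "of_bool (rightmost (?\<omega> u) j (int j - int i)) = (of_bool (rightmost (?\<omega> v) j (int j - int i)) :: ennreal)"
        if "\<And>e. e \<in> {e. snd (fst e) < int j} \<Longrightarrow> u e = v e" for u v
        by (intro arg_cong[where f=of_bool] rightmost_env_cong refl) (use that in simp)
      show "exp_edge \<theta> (?\<omega> u) (int j) m (int j - int i) = exp_edge \<theta> (?\<omega> v) (int j) m (int j - int i)"
        if "\<And>e. e \<in> {e. int j \<le> snd (fst e)} \<Longrightarrow> u e = v e" for u v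
        by (intro exp_edge_env_cong) (use that in simp)
    qed auto
    also have "(\<integral>\<^sup>+u. of_bool (rightmost (?\<omega> u) j (int j - int i)) \<partial>labels) = rightmost_prob q j i"
      unfolding rightmost_prob_def
      by (intro nn_integral_cong arg_cong[where f=of_bool] rightmost_env_cong) (auto simp: hybrid_def)
    also have "(\<integral>\<^sup>+u. exp_edge \<theta> (?\<omega> u) (int j) m (int j - int i) \<partial>labels)
      = ennreal (exp (\<theta> * of_int (int j - int i))) * exp_moment \<theta> p m"
      using True by (intro exp_moment_shift) (auto simp: hybrid_def)
    finally show ?thesis by (simp add: mult.assoc)
  next
    case False
    then have "\<not> rightmost \<omega> j (int j - int i)" for \<omega> using rightmost_even[of \<omega> j "int j - int i"] by auto
    then show ?thesis by (simp add: rightmost_prob_def)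
  qed
  have "hybrid_moment \<theta> p q (j + m) j \<le> (\<integral>\<^sup>+u. (\<Sum>i. of_bool (rightmost (?\<omega> u) j (int j - int i)) *
      exp_edge \<theta> (?\<omega> u) (int j) m (int j - int i)) \<partial>labels)"
    unfolding hybrid_moment_def by (intro nn_integral_mono exp_edge_le_suminf)
  also have "\<dots> = (\<Sum>i. rightmost_prob q j i * ennreal (exp (\<theta> * (real j - real i))) * exp_moment \<theta> p m)"
    by (subst nn_integral_suminf) (auto simp: summand)
  also have "\<dots> = exp_moment \<theta> q j * exp_moment \<theta> p m"
    unfolding exp_moment_eq_suminf[OF assms] by simp
  finally show ?thesis .
qed

lemma hybrid_same: "hybrid_moment \<theta> p p n j = exp_moment \<theta> p n"
  by (simp add: hybrid_moment_def exp_moment_def hybrid_def[abs_def])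

lemma exp_moment_submult:
  assumes "\<theta> > 0"
  shows "exp_moment \<theta> p (j + m) \<le> exp_moment \<theta> p j * exp_moment \<theta> p m"
  using hybrid_moment_le[OF assms, of p p j m] by (simp add: hybrid_same)

text \<open>Adding the site \<open>x + 1\<close> to the right of all other sites moves the right edge more if there are
  fewer other sites, hence at least as much as if all sites up to \<open>x - 1\<close> were present.\<close>

lemma exp_edge_gain:
  assumes "rightmost \<omega> j x"
    and closed: "\<not> \<omega> ((x, int j), (x + 1, int j + 1))"
    and opened: "\<omega>' ((x, int j), (x + 1, int j + 1))"
    and le: "\<And>e. \<omega> e \<Longrightarrow> \<omega>' e"
  shows "exp_edge \<theta> \<omega> 0 (j + 1 + m) 0 + exp_edge \<theta> \<omega> (int j + 1) m (x + 1) \<le>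
    exp_edge \<theta> \<omega>' 0 (j + 1 + m) 0 + exp_edge \<theta> \<omega> (int j + 1) m (x - 1)"
proof -
  let ?W = "exp_edge \<theta> \<omega> 0 (j + 1 + m) 0" and ?W' = "exp_edge \<theta> \<omega>' 0 (j + 1 + m) 0"
  let ?c = "exp_edge \<theta> \<omega> (int j + 1) m (x - 1)"
  have x: "half_line \<omega> 0 j 0 x" and max: "\<And>y. half_line \<omega> 0 j 0 y \<Longrightarrow> y \<le> x"
    using assms(1) unfolding rightmost_def by (auto simp: not_less[symmetric])
  have even: "even (x + int j)" using rightmost_even[OF assms(1)] .
  have mono: "?W \<le> ?W'"
    by (intro exp_edge_least exp_edge_upper) (erule half_line_mono, auto simp: le)
  \<comment> \<open>With the edge leading right from \<open>x\<close> closed, parity leaves no site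
    beyond \<open>x - 1\<close> at the next level.\<close>
  have Wc: "?W \<le> ?c"
  proof (rule exp_edge_least)
    fix y assume "half_line \<omega> 0 (j + 1 + m) 0 y"
    then obtain z where z: "half_line \<omega> 0 (j + 1) 0 z" "conn \<omega> (0 + int (j + 1)) m z y"
      unfolding half_line_add[of \<omega> 0 "j + 1"] by blast
    then obtain w where w: "half_line \<omega> 0 j 0 w" "conn \<omega> (0 + int j) 1 w z"
      unfolding half_line_add by blast
    have "z \<noteq> x + 1"
    proof
      assume "z = x + 1"
      with w(2) max[OF w(1)] have "w = x" by auto
      with w(2) \<open>z = x + 1\<close> closed show False by auto
    qed
    moreover have "z \<le> x + 1" using conn_bound[OF w(2)] max[OF w(1)] by simp
    moreover have "even (z + int j + 1)" using conn_even_end[OF w(2)] by (simp add: add.assoc)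
    ultimately have "z \<le> x - 1" using even by presburger
    then have "half_line \<omega> (int j + 1) m (x - 1) y"
      using z(2) by (auto simp: half_line_def add.commute)
    then show "ennreal (exp (\<theta> * of_int y)) \<le> ?c" by (rule exp_edge_upper)
  qed
  have "exp_edge \<theta> \<omega> (int j + 1) m (x + 1) \<le> max ?c ?W'"
  proof (rule exp_edge_least)
    fix y assume "half_line \<omega> (int j + 1) m (x + 1) y"
    then obtain z where z: "z \<le> x + 1" "conn \<omega> (int j + 1) m z y" by (auto simp: half_line_def)
    have "even (z + (int j + 1))" using conn_even[OF z(2)] .
    with z(1) even have "z = x + 1 \<or> z \<le> x - 1" by presburger
    then show "ennreal (exp (\<theta> * of_int y)) \<le> max ?c ?W'"
    proof
      assume zx: "z = x + 1"
      have "half_line \<omega>' 0 j 0 x" using x by (rule half_line_mono) (auto simp: le)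
      moreover have "conn \<omega>' (0 + int j) 1 x (x + 1)" using opened even by simp
      ultimately have "half_line \<omega>' 0 (j + 1) 0 (x + 1)" unfolding half_line_add by blast
      moreover have "conn \<omega>' (0 + int (j + 1)) m (x + 1) y"
        using conn_mono[OF z(2), of \<omega>'] le zx by (simp add: add.commute)
      ultimately have "half_line \<omega>' 0 (j + 1 + m) 0 y" unfolding half_line_add[of \<omega>' 0 "j + 1"] by blast
      then show ?thesis using exp_edge_upper le_max_iff_disj by blast
    next
      assume "z \<le> x - 1"
      then have "half_line \<omega> (int j + 1) m (x - 1) y" using z(2) by (auto simp: half_line_def)
      then show ?thesis using exp_edge_upper le_max_iff_disj by blast
    qed
  qed
  \<comment> \<open>If the restart at \<open>x + 1\<close> is bounded by the restart at
    \<open>x - 1\<close>, add \<open>?W \<le> ?W'\<close>; if it is bounded by \<open>?W'\<close>,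
    add \<open>?W \<le> ?c\<close>. No subtraction of extended reals is involved.\<close>
  then consider "exp_edge \<theta> \<omega> (int j + 1) m (x + 1) \<le> ?c" | "exp_edge \<theta> \<omega> (int j + 1) m (x + 1) \<le> ?W'"
    by (auto simp: le_max_iff_disj)
  then show ?thesis
  proof cases
    case 1
    then show ?thesis using mono by (intro add_mono)
  next
    case 2
    then show ?thesis using Wc by (subst add.commute) (intro add_mono)
  qed
qed

definition gap :: "real \<Rightarrow> real \<Rightarrow> (edge \<Rightarrow> real) \<Rightarrow> nat \<Rightarrow> int \<Rightarrow> bool" where
  "gap p q u j x \<longleftrightarrow> p < u ((x, int j), (x + 1, int j + 1)) \<and> u ((x, int j), (x + 1, int j + 1)) \<le> q"

lemma gap_measurable [measurable]: "Measurable.pred labels (\<lambda>u. gap p q u j x)"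
  unfolding gap_def by measurable

lemma nn_integral_gap:
  assumes "0 \<le> p" "p \<le> q" "q \<le> 1"
  shows "(\<integral>\<^sup>+u. of_bool (gap p q u j x) \<partial>labels) = ennreal (q - p)"
proof -
  have "{u \<in> space labels. gap p q u j x} \<in> sets labels" by measurable
  then have S: "{u. gap p q u j x} \<in> sets labels" by simp
  have "(\<integral>\<^sup>+u. of_bool (gap p q u j x) \<partial>labels) = (\<integral>\<^sup>+u. indicator {u. gap p q u j x} u \<partial>labels)"
    by (intro nn_integral_cong) (simp add: indicator_def)
  also have "\<dots> = ennreal (labels.prob {u. gap p q u j x})"
    using S by (simp add: labels.emeasure_eq_measure)
  finally show ?thesis using prob_label_between[OF assms] by (simp add: gap_def)
qed

lemma nn_integral_gain_summand:
  assumes "0 \<le> p" "p \<le> q" "q \<le> 1" "odd s"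
  shows "(\<integral>\<^sup>+u. of_bool (rightmost (env (hybrid p q j) u) j (int j - int i)) *
      (of_bool (gap p q u j (int j - int i)) *
       exp_edge \<theta> (env (hybrid p q j) u) (int j + 1) m (int j - int i + s)) \<partial>labels)
    = rightmost_prob q j i * ennreal (exp (\<theta> * (real j - real i))) *
      (ennreal (q - p) * ennreal (exp (\<theta> * of_int s)) * exp_moment \<theta> p m)"
proof (cases "even i")
  case True
  let ?\<omega> = "\<lambda>u. env (hybrid p q j) u" and ?x = "int j - int i"
  have "(\<integral>\<^sup>+u. of_bool (rightmost (?\<omega> u) j ?x) *
      (of_bool (gap p q u j ?x) * exp_edge \<theta> (?\<omega> u) (int j + 1) m (?x + s)) \<partial>labels)
    = (\<integral>\<^sup>+u. of_bool (rightmost (?\<omega> u) j ?x) \<partial>labels) *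
      (\<integral>\<^sup>+u. of_bool (gap p q u j ?x) * exp_edge \<theta> (?\<omega> u) (int j + 1) m (?x + s) \<partial>labels)"
  proof (rule nn_integral_labels_indep[of _ _ "{e. snd (fst e) < int j}" "{e. int j \<le> snd (fst e)}"])
    show "of_bool (rightmost (?\<omega> u) j ?x) = (of_bool (rightmost (?\<omega> v) j ?x) :: ennreal)"
      if "\<And>e. e \<in> {e. snd (fst e) < int j} \<Longrightarrow> u e = v e" for u v
      by (intro arg_cong[where f=of_bool] rightmost_env_cong refl) (use that in simp)
    show "of_bool (gap p q u j ?x) * exp_edge \<theta> (?\<omega> u) (int j + 1) m (?x + s)
      = of_bool (gap p q v j ?x) * exp_edge \<theta> (?\<omega> v) (int j + 1) m (?x + s)"
      if "\<And>e. e \<in> {e. int j \<le> snd (fst e)} \<Longrightarrow> u e = v e" for u v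
      by (intro arg_cong2[where f="(*)"] arg_cong[where f=of_bool] exp_edge_env_cong)
        (use that in \<open>auto simp: gap_def\<close>)
  qed auto
  also have "(\<integral>\<^sup>+u. of_bool (rightmost (?\<omega> u) j ?x) \<partial>labels) = rightmost_prob q j i"
    unfolding rightmost_prob_def
    by (intro nn_integral_cong arg_cong[where f=of_bool] rightmost_env_cong) (auto simp: hybrid_def)
  also have "(\<integral>\<^sup>+u. of_bool (gap p q u j ?x) * exp_edge \<theta> (?\<omega> u) (int j + 1) m (?x + s) \<partial>labels)
    = (\<integral>\<^sup>+u. of_bool (gap p q u j ?x) \<partial>labels) *
      (\<integral>\<^sup>+u. exp_edge \<theta> (?\<omega> u) (int j + 1) m (?x + s) \<partial>labels)"
  proof (rule nn_integral_labels_indep[of _ _ "{e. snd (fst e) = int j}" "{e. int j + 1 \<le> snd (fst e)}"])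
    show "of_bool (gap p q u j ?x) = (of_bool (gap p q v j ?x) :: ennreal)"
      if "\<And>e. e \<in> {e. snd (fst e) = int j} \<Longrightarrow> u e = v e" for u v
      by (intro arg_cong[where f=of_bool]) (use that in \<open>auto simp: gap_def\<close>)
    show "exp_edge \<theta> (?\<omega> u) (int j + 1) m (?x + s) = exp_edge \<theta> (?\<omega> v) (int j + 1) m (?x + s)"
      if "\<And>e. e \<in> {e. int j + 1 \<le> snd (fst e)} \<Longrightarrow> u e = v e" for u v
      by (intro exp_edge_env_cong) (use that in simp)
  qed auto
  also have "(\<integral>\<^sup>+u. exp_edge \<theta> (?\<omega> u) (int j + 1) m (?x + s) \<partial>labels)
      = ennreal (exp (\<theta> * of_int (?x + s))) * exp_moment \<theta> p m"
    using True assms(4) by (intro exp_moment_shift) (auto simp: hybrid_def)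
  also have "ennreal (exp (\<theta> * of_int (?x + s))) = ennreal (exp (\<theta> * (real j - real i))) * ennreal (exp (\<theta> * of_int s))"
    by (simp add: distrib_left exp_add flip: ennreal_mult)
  finally show ?thesis using nn_integral_gap[OF assms(1-3)] by (simp add: mult_ac)
next
  case False
  then have "\<not> rightmost \<omega> j (int j - int i)" for \<omega> using rightmost_even[of \<omega> j "int j - int i"] by auto
  then show ?thesis by (simp add: rightmost_prob_def)
qed

lemma nn_integral_gain:
  assumes "0 \<le> p" "p \<le> q" "q \<le> 1" "odd s" "\<theta> > 0"
  shows "(\<integral>\<^sup>+u. (\<Sum>i. of_bool (rightmost (env (hybrid p q j) u) j (int j - int i)) *
      (of_bool (gap p q u j (int j - int i)) *
       exp_edge \<theta> (env (hybrid p q j) u) (int j + 1) m (int j - int i + s))) \<partial>labels)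
    = exp_moment \<theta> q j * (ennreal (q - p) * ennreal (exp (\<theta> * of_int s)) * exp_moment \<theta> p m)"
  using assms by (subst nn_integral_suminf)
    (auto simp: nn_integral_gain_summand exp_moment_eq_suminf)

text \<open>This integrates \<open>exp_edge_gain\<close> over the event that the edge leading right
  from the right edge at level \<open>j\<close> has its label between \<open>p\<close> and
  \<open>q\<close>. Labels below, at and above that level are independent, whence the products;
  \<open>exp \<theta>\<close> and \<open>exp (- \<theta>)\<close> come from the restarts at
  \<open>x + 1\<close> and \<open>x - 1\<close>. The loss is added on the right to avoid
  subtraction.\<close>

lemma hybrid_gain:
  assumes "0 \<le> p" "p \<le> q" "q \<le> 1" "\<theta> > 0"
  shows "hybrid_moment \<theta> p q (j + 1 + m) j +
      exp_moment \<theta> q j * (ennreal (q - p) * ennreal (exp \<theta>) * exp_moment \<theta> p m) \<le>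
    hybrid_moment \<theta> p q (j + 1 + m) (j + 1) +
      exp_moment \<theta> q j * (ennreal (q - p) * ennreal (exp (- \<theta>)) * exp_moment \<theta> p m)"
proof -
  define S where "S s u = (\<Sum>i. of_bool (rightmost (env (hybrid p q j) u) j (int j - int i)) *
      (of_bool (gap p q u j (int j - int i)) *
       exp_edge \<theta> (env (hybrid p q j) u) (int j + 1) m (int j - int i + s)))" for s u
  have S [measurable]: "S s \<in> borel_measurable labels" for s unfolding S_def by measurable
  have pointwise: "exp_edge \<theta> (env (hybrid p q j) u) 0 (j + 1 + m) 0 + S 1 u \<le>
      exp_edge \<theta> (env (hybrid p q (j + 1)) u) 0 (j + 1 + m) 0 + S (- 1) u" for u
  proof -
    have le: "env (hybrid p q j) u e \<Longrightarrow> env (hybrid p q (j + 1)) u e" for e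
      using assms(2) by (auto simp: env_def hybrid_def split: if_splits)
    have mono: "exp_edge \<theta> (env (hybrid p q j) u) 0 (j + 1 + m) 0 \<le>
        exp_edge \<theta> (env (hybrid p q (j + 1)) u) 0 (j + 1 + m) 0"
      by (intro exp_edge_least exp_edge_upper) (erule half_line_mono, simp, rule le)
    show ?thesis
    proof (cases "\<exists>i. rightmost (env (hybrid p q j) u) j (int j - int i)")
      case False
      then show ?thesis using mono by (simp add: S_def)
    next
      case True
      then obtain i where i: "rightmost (env (hybrid p q j) u) j (int j - int i)" by blast
      show ?thesis
      proof (cases "gap p q u j (int j - int i)")
        case False
        then show ?thesis using mono unfolding S_def suminf_rightmost[OF i] by simp
      next
        case True
        then have e: "\<not> env (hybrid p q j) u ((int j - int i, int j), (int j - int i + 1, int j + 1))"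
          "env (hybrid p q (j + 1)) u ((int j - int i, int j), (int j - int i + 1, int j + 1))"
          by (auto simp: env_def hybrid_def gap_def)
        have "exp_edge \<theta> (env (hybrid p q j) u) 0 (j + 1 + m) 0 +
            exp_edge \<theta> (env (hybrid p q j) u) (int j + 1) m (int j - int i + 1) \<le>
          exp_edge \<theta> (env (hybrid p q (j + 1)) u) 0 (j + 1 + m) 0 +
            exp_edge \<theta> (env (hybrid p q j) u) (int j + 1) m (int j - int i - 1)"
          using i e by (rule exp_edge_gain) (rule le)
        then show ?thesis using True unfolding S_def suminf_rightmost[OF i]
          by simp
      qed
    qed
  qed
  have "(\<integral>\<^sup>+u. exp_edge \<theta> (env (hybrid p q j) u) 0 (j + 1 + m) 0 + S 1 u \<partial>labels) \<le>
    (\<integral>\<^sup>+u. exp_edge \<theta> (env (hybrid p q (j + 1)) u) 0 (j + 1 + m) 0 + S (- 1) u \<partial>labels)"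
    using pointwise by (rule nn_integral_mono)
  also have "(\<integral>\<^sup>+u. exp_edge \<theta> (env (hybrid p q (j + 1)) u) 0 (j + 1 + m) 0 + S (- 1) u \<partial>labels)
      = hybrid_moment \<theta> p q (j + 1 + m) (j + 1) + (\<integral>\<^sup>+u. S (- 1) u \<partial>labels)"
    unfolding hybrid_moment_def by (rule nn_integral_add) measurable
  also have "(\<integral>\<^sup>+u. S (- 1) u \<partial>labels) =
      exp_moment \<theta> q j * (ennreal (q - p) * ennreal (exp (- \<theta>)) * exp_moment \<theta> p m)"
    unfolding S_def using nn_integral_gain[OF assms(1-3) _ assms(4), of "- 1" j m] by simp
  also have "(\<integral>\<^sup>+u. exp_edge \<theta> (env (hybrid p q j) u) 0 (j + 1 + m) 0 + S 1 u \<partial>labels)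
      = hybrid_moment \<theta> p q (j + 1 + m) j + (\<integral>\<^sup>+u. S 1 u \<partial>labels)"
    unfolding hybrid_moment_def by (rule nn_integral_add) measurable
  also have "(\<integral>\<^sup>+u. S 1 u \<partial>labels) =
      exp_moment \<theta> q j * (ennreal (q - p) * ennreal (exp \<theta>) * exp_moment \<theta> p m)"
    unfolding S_def using nn_integral_gain[OF assms(1-3) _ assms(4), of 1 j m] by simp
  finally show ?thesis .
qed

definition moment :: "real \<Rightarrow> real \<Rightarrow> nat \<Rightarrow> real" where
  "moment \<theta> p n = enn2real (exp_moment \<theta> p n)"

lemma exp_moment_eq: "\<theta> > 0 \<Longrightarrow> exp_moment \<theta> p n = ennreal (moment \<theta> p n)"
  using exp_moment_finite by (simp add: moment_def)

lemma moment_nonneg: "0 \<le> moment \<theta> p n"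
  by (simp add: moment_def)

lemma moment_submult:
  assumes "\<theta> > 0"
  shows "moment \<theta> p (j + m) \<le> moment \<theta> p j * moment \<theta> p m"
  using exp_moment_submult[OF assms, of p j m] moment_nonneg
  by (simp add: exp_moment_eq[OF assms] flip: ennreal_mult)

lemma moment_bound:
  assumes "\<theta> > 0"
  shows "moment \<theta> p n \<le> exp (\<theta> * real n)"
  using exp_moment_bound[OF assms, of p n] by (simp add: exp_moment_eq[OF assms])

lemma moment_mult_le:
  assumes "\<theta> > 0"
  shows "moment \<theta> p (k * m) \<le> moment \<theta> p m ^ k"
proof (induction k)
  case 0
  then show ?case using moment_bound[OF assms, of p 0] by simp
next
  case (Suc k)
  have "moment \<theta> p (Suc k * m) \<le> moment \<theta> p m * moment \<theta> p (k * m)"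
    using moment_submult[OF assms, of p m "k * m"] by simp
  also have "\<dots> \<le> moment \<theta> p m * moment \<theta> p m ^ k"
    using Suc moment_nonneg by (intro mult_left_mono)
  finally show ?case by simp
qed

text \<open>Raising level \<open>j\<close> adds at least (q - p)(exp \<theta> - exp (-\<theta>))
  times \<open>?A * ?B\<close>. Conversely \<open>hybrid_moment_le\<close>, with one level split off
  and bounded by \<open>exp \<theta>\<close>, gives \<open>H j \<le> ?A * exp \<theta> * ?B\<close>.
  So the additive gain is at least a fixed proportion of \<open>H j\<close>, and it compounds over
  the \<open>n\<close> levels.\<close>

lemma moment_gain:
  assumes pq: "0 \<le> p" "p \<le> q" "q \<le> 1" and \<theta>: "\<theta> > 0"
  shows "(1 + (q - p) * (1 - exp (- 2 * \<theta>))) ^ n * moment \<theta> p n \<le> moment \<theta> q n"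
proof -
  define r where "r = 1 + (q - p) * (1 - exp (- 2 * \<theta>))"
  define H where "H j = enn2real (hybrid_moment \<theta> p q n j)" for j
  have H: "hybrid_moment \<theta> p q n j = ennreal (H j)" if "j \<le> n" for j
  proof -
    have "hybrid_moment \<theta> p q (j + (n - j)) j \<le> exp_moment \<theta> q j * exp_moment \<theta> p (n - j)"
      by (rule hybrid_moment_le[OF \<theta>])
    also have "\<dots> < top" by (simp add: exp_moment_eq[OF \<theta>] ennreal_mult_less_top)
    finally show ?thesis using that by (simp add: H_def)
  qed
  have r: "r \<ge> 1" using pq \<theta> by (simp add: r_def)
  have step: "r * H j \<le> H (j + 1)" if "j < n" for j
  proof -
    define m where "m = n - j - 1"
    have n: "n = j + 1 + m" using that by (simp add: m_def)
    have le: "j \<le> n" "j + 1 \<le> n" using that by auto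
    let ?A = "moment \<theta> q j" and ?B = "moment \<theta> p m"
    have nn: "0 \<le> ?A" "0 \<le> ?B" "0 \<le> H j" "0 \<le> H (j + 1)" by (simp_all add: moment_nonneg H_def)
    have "ennreal (H j) + ennreal ?A * (ennreal (q - p) * ennreal (exp \<theta>) * ennreal ?B) \<le>
      ennreal (H (j + 1)) + ennreal ?A * (ennreal (q - p) * ennreal (exp (- \<theta>)) * ennreal ?B)"
      using hybrid_gain[OF pq \<theta>, of j m]
      unfolding n[symmetric] exp_moment_eq[OF \<theta>] H[OF le(1)] H[OF le(2)] .
    then have "H j + ?A * ((q - p) * exp \<theta> * ?B) \<le> H (j + 1) + ?A * ((q - p) * exp (- \<theta>) * ?B)"
      using nn pq by (simp flip: ennreal_mult ennreal_plus)
    then have gain: "H j + (q - p) * (exp \<theta> - exp (- \<theta>)) * (?A * ?B) \<le> H (j + 1)"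
      by (simp add: algebra_simps)
    have "ennreal (H j) \<le> ennreal ?A * ennreal (moment \<theta> p (1 + m))"
      using hybrid_moment_le[OF \<theta>, of p q j "1 + m"]
      unfolding add.assoc[symmetric] n[symmetric] exp_moment_eq[OF \<theta>] H[OF le(1)] .
    then have "H j \<le> ?A * moment \<theta> p (1 + m)"
      using nn moment_nonneg by (simp flip: ennreal_mult)
    also have "\<dots> \<le> ?A * (moment \<theta> p 1 * ?B)"
      using nn by (intro mult_left_mono moment_submult \<theta>)
    also have "\<dots> \<le> ?A * (exp \<theta> * ?B)"
      using nn moment_bound[OF \<theta>, of p 1] by (intro mult_left_mono mult_right_mono) auto
    finally have "exp (- \<theta>) * H j \<le> exp (- \<theta>) * (?A * (exp \<theta> * ?B))" by (intro mult_left_mono) auto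
    then have AB: "exp (- \<theta>) * H j \<le> ?A * ?B" by (simp add: exp_minus field_simps)
    have "(q - p) * (exp \<theta> - exp (- \<theta>)) * (exp (- \<theta>) * H j) \<le> (q - p) * (exp \<theta> - exp (- \<theta>)) * (?A * ?B)"
      using pq \<theta> by (intro mult_left_mono[OF AB]) auto
    moreover have "(exp \<theta> - exp (- \<theta>)) * exp (- \<theta>) = 1 - exp (- 2 * \<theta>)"
      by (simp add: left_diff_distrib flip: exp_add)
    then have "(q - p) * (exp \<theta> - exp (- \<theta>)) * (exp (- \<theta>) * H j) = (r - 1) * H j"
      by (simp add: r_def mult.assoc[symmetric])
    ultimately show ?thesis using gain by (simp add: algebra_simps)
  qed
  have "r ^ j * H 0 \<le> H j" if "j \<le> n" for j
    using that
  proof (induction j)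
    case (Suc j)
    then have "r * (r ^ j * H 0) \<le> r * H j" using r by (intro mult_left_mono) auto
    also have "\<dots> \<le> H (Suc j)" using step[of j] Suc.prems by simp
    finally show ?case by (simp add: mult.assoc)
  qed simp
  from this[of n] have "r ^ n * H 0 \<le> H n" by simp
  moreover have "H 0 = moment \<theta> p n" unfolding H_def moment_def hybrid_moment_def exp_moment_def
    by (intro arg_cong[where f=enn2real] nn_integral_cong exp_edge_cong half_line_cong)
      (auto simp: env_def hybrid_def)
  moreover have "H n = moment \<theta> q n" unfolding H_def moment_def hybrid_moment_def exp_moment_def
    by (intro arg_cong[where f=enn2real] nn_integral_cong exp_edge_cong half_line_cong)
      (auto simp: env_def hybrid_def)
  ultimately show ?thesis by (simp add: r_def)
qed

section \<open>The speed of the right edge\<close>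

lemma half_line_sets [simp, intro]:
  "{u. \<exists>y. c \<le> real_of_int y \<and> half_line (env P u) b n X y} \<in> sets labels"
  "{u. \<exists>y\<ge>z. half_line (env P u) b n X y} \<in> sets labels"
  "{u. \<exists>y. conn (env P u) b n x y} \<in> sets labels"
  "{u. \<forall>k. \<exists>y. conn (env P u) b k x y} \<in> sets labels"
proof -
  have "{u \<in> space labels. \<exists>y. c \<le> real_of_int y \<and> half_line (env P u) b n X y} \<in> sets labels"
    "{u \<in> space labels. \<exists>y\<ge>z. half_line (env P u) b n X y} \<in> sets labels"
    "{u \<in> space labels. \<exists>y. conn (env P u) b n x y} \<in> sets labels"
    "{u \<in> space labels. \<forall>k. \<exists>y. conn (env P u) b k x y} \<in> sets labels" by measurable
  then show "{u. \<exists>y. c \<le> real_of_int y \<and> half_line (env P u) b n X y} \<in> sets labels"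
    "{u. \<exists>y\<ge>z. half_line (env P u) b n X y} \<in> sets labels"
    "{u. \<exists>y. conn (env P u) b n x y} \<in> sets labels"
    "{u. \<forall>k. \<exists>y. conn (env P u) b k x y} \<in> sets labels" by simp_all
qed

lemma moment_ge:
  assumes "\<theta> > 0"
  shows "exp (\<theta> * c) * labels.prob {u. \<exists>y. c \<le> real_of_int y \<and> half_line (env (\<lambda>_. p) u) 0 n 0 y}
    \<le> moment \<theta> p n"
proof -
  let ?E = "{u. \<exists>y. c \<le> real_of_int y \<and> half_line (env (\<lambda>_. p) u) 0 n 0 y}"
  have "ennreal (exp (\<theta> * c) * labels.prob ?E) = (\<integral>\<^sup>+u. ennreal (exp (\<theta> * c)) * indicator ?E u \<partial>labels)"
    by (simp add: nn_integral_cmult_indicator labels.emeasure_eq_measure ennreal_mult)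
  also have "\<dots> \<le> exp_moment \<theta> p n"
    unfolding exp_moment_def
  proof (rule nn_integral_mono)
    fix u
    show "ennreal (exp (\<theta> * c)) * indicator ?E u \<le> exp_edge \<theta> (env (\<lambda>_. p) u) 0 n 0"
    proof (cases "u \<in> ?E")
      case True
      then obtain y where y: "c \<le> real_of_int y" "half_line (env (\<lambda>_. p) u) 0 n 0 y" by blast
      have "ennreal (exp (\<theta> * c)) \<le> ennreal (exp (\<theta> * of_int y))"
        using y(1) assms by (intro ennreal_leI) simp
      also have "\<dots> \<le> exp_edge \<theta> (env (\<lambda>_. p) u) 0 n 0" by (rule exp_edge_upper[OF y(2)])
      finally show ?thesis using True by simp
    qed simp
  qed
  finally show ?thesis using moment_nonneg by (simp add: exp_moment_eq[OF assms])
qed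

text \<open>Off the event the edge stays below \<open>c\<close>; on the event the trivial bound
  \<open>real n\<close> is used. The converse estimate \<open>moment_ge\<close> is Markov's
  inequality.\<close>

lemma moment_le:
  assumes "\<theta> > 0"
  shows "moment \<theta> p n \<le> exp (\<theta> * c) +
    exp (\<theta> * real n) * labels.prob {u. \<exists>y. c \<le> real_of_int y \<and> half_line (env (\<lambda>_. p) u) 0 n 0 y}"
proof -
  let ?E = "{u. \<exists>y. c \<le> real_of_int y \<and> half_line (env (\<lambda>_. p) u) 0 n 0 y}"
  have "exp_moment \<theta> p n \<le> (\<integral>\<^sup>+u. ennreal (exp (\<theta> * c)) + ennreal (exp (\<theta> * real n)) * indicator ?E u \<partial>labels)"
    unfolding exp_moment_def
  proof (rule nn_integral_mono)
    fix u
    show "exp_edge \<theta> (env (\<lambda>_. p) u) 0 n 0 \<le> ennreal (exp (\<theta> * c)) + ennreal (exp (\<theta> * real n)) * indicator ?E u"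
    proof (cases "u \<in> ?E")
      case True
      have "exp_edge \<theta> (env (\<lambda>_. p) u) 0 n 0 \<le> ennreal (exp (\<theta> * real n))"
        using exp_edge_bound[OF assms, of _ 0 n 0] by simp
      also have "\<dots> \<le> ennreal (exp (\<theta> * c)) + ennreal (exp (\<theta> * real n))" by simp
      finally show ?thesis using True by simp
    next
      case False
      have "exp_edge \<theta> (env (\<lambda>_. p) u) 0 n 0 \<le> ennreal (exp (\<theta> * c))"
        using False assms by (intro exp_edge_least ennreal_leI) force
      then show ?thesis using False by simp
    qed
  qed
  also have "\<dots> = ennreal (exp (\<theta> * c)) + ennreal (exp (\<theta> * real n)) * emeasure labels ?E"
    by (subst nn_integral_add) (simp_all add: nn_integral_cmult_indicator labels.emeasure_space_1[simplified])
  also have "\<dots> = ennreal (exp (\<theta> * c) + exp (\<theta> * real n) * labels.prob ?E)"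
    by (simp add: labels.emeasure_eq_measure ennreal_mult)
  finally show ?thesis unfolding exp_moment_eq[OF assms] by (subst (asm) ennreal_le_iff) auto
qed

lemma prob_half_line_ge_tendsto_1:
  assumes "right_edge_speed \<alpha>" "p \<in> {p_crit..1}" "0 \<le> p" "c < \<alpha> p"
  shows "(\<lambda>n. labels.prob {u. \<exists>y. c * real n \<le> of_int y \<and> half_line (env (\<lambda>_. p) u) 0 n 0 y}) \<longlonglongrightarrow> 1"
proof (rule whp_imp_tendsto)
  show "whp sequentially (\<lambda>n u. \<exists>y. c * real n \<le> of_int y \<and> half_line (env (\<lambda>_. p) u) 0 n 0 y)"
    using speed_lower[OF assms] by (rule whp_mono) auto
qed simp

lemma prob_half_line_ge_tendsto_0:
  assumes "right_edge_speed \<alpha>" "p \<in> {p_crit..1}" "0 \<le> p" "\<alpha> p < c"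
  shows "(\<lambda>n. labels.prob {u. \<exists>y. c * real n \<le> of_int y \<and> half_line (env (\<lambda>_. p) u) 0 n 0 y}) \<longlonglongrightarrow> 0"
proof -
  define c' where "c' = (\<alpha> p + c) / 2"
  have c': "\<alpha> p < c'" "c' < c" using assms(4) by (auto simp: c'_def)
  let ?E = "\<lambda>n. {u. \<exists>y. c * real n \<le> of_int y \<and> half_line (env (\<lambda>_. p) u) 0 n 0 y}"
  have "whp sequentially (\<lambda>n u. u \<notin> ?E n)"
    using speed_upper[OF assms(1-3) c'(1)]
  proof (rule whp_mono)
    show "\<forall>\<^sub>F n in sequentially. \<forall>u. (\<forall>k\<ge>n. \<forall>y. half_line (env (\<lambda>_. p) u) 0 k 0 y \<longrightarrow> real_of_int y \<le> c' * real k)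
        \<longrightarrow> u \<notin> ?E n"
      using eventually_gt_at_top[of 0]
    proof eventually_elim
      case (elim n)
      then have "c' * real n < c * real n" using c' by simp
      then show ?case by (force simp: not_le)
    qed
  qed
  then have "(\<lambda>n. labels.prob {u. u \<notin> ?E n}) \<longlonglongrightarrow> 1"
  proof (rule whp_imp_tendsto)
    show "{u. u \<notin> ?E n} \<in> sets labels" for n
      using sets.compl_sets[OF half_line_sets(1)[of "c * real n" "\<lambda>_. p" 0 n 0]]
      by (simp add: Compl_eq_Diff_UNIV[symmetric] Collect_neg_eq[symmetric])
  qed
  moreover have "labels.prob {u. u \<notin> ?E n} = 1 - labels.prob (?E n)" for n
    using labels.prob_compl[OF half_line_sets(1)[of "c * real n" "\<lambda>_. p" 0 n 0]]
    by (simp add: Compl_eq_Diff_UNIV[symmetric] Collect_neg_eq[symmetric])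
  ultimately have "(\<lambda>n. 1 - (1 - labels.prob (?E n))) \<longlonglongrightarrow> 1 - 1" by (intro tendsto_intros) simp
  then show ?thesis by simp
qed

lemma one_minus_exp_ge:
  assumes "0 \<le> x" "x \<le> (1 :: real)"
  shows "x / 2 \<le> 1 - exp (- x)"
proof -
  have "(1 + x) * (1 - x / 2) \<ge> 1"
    using assms mult_right_mono[of x 1 x] by (simp add: algebra_simps)
  have "exp (- x) \<le> 1 / (1 + x)"
    using exp_ge_add_one_self[of x] assms by (simp add: exp_minus field_simps)
  also have "\<dots> \<le> 1 - x / 2"
    using \<open>(1 + x) * (1 - x / 2) \<ge> 1\<close> assms by (simp add: divide_le_eq mult.commute)
  finally show ?thesis by simp
qed

text \<open>The law of large numbers at \<open>p\<close> and \<open>moment_gain\<close> give only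
  \<open>r ^ n / 2\<close> as a lower bound, for large \<open>n\<close>. Submultiplicativity removes
  the factor 1/2 and the restriction on \<open>n\<close>: if the claim failed at \<open>m\<close>,
  the powers \<open>s ^ k\<close> along the multiples of \<open>m\<close> would stay above 1/2
  although \<open>s < 1\<close>.\<close>

lemma moment_ge_power:
  assumes "right_edge_speed \<alpha>" "p \<in> {p_crit..1}" "0 \<le> p" "c < \<alpha> p"
    and "p \<le> q" "q \<le> 1" "\<theta> > 0" "m > 0"
  shows "(exp (\<theta> * c) * (1 + (q - p) * (1 - exp (- 2 * \<theta>)))) ^ m \<le> moment \<theta> q m"
proof (rule ccontr)
  define r where "r = exp (\<theta> * c) * (1 + (q - p) * (1 - exp (- 2 * \<theta>)))"
  assume "\<not> ?thesis"
  then have less: "moment \<theta> q m < r ^ m" by (simp add: r_def)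
  have d: "1 + (q - p) * (1 - exp (- 2 * \<theta>)) \<ge> 1" using assms by simp
  then have r: "r > 0" by (simp add: r_def)
  define s where "s = moment \<theta> q m / r ^ m"
  have s: "0 \<le> s" "s < 1" using less r moment_nonneg by (auto simp: s_def divide_less_eq)
  have "\<forall>\<^sub>F n in sequentially. 1 / 2 < labels.prob {u. \<exists>y. c * real n \<le> of_int y \<and> half_line (env (\<lambda>_. p) u) 0 n 0 y}"
    by (intro order_tendstoD(1)[OF prob_half_line_ge_tendsto_1[OF assms(1-4)]]) simp
  then have "\<forall>\<^sub>F n in sequentially. r ^ n / 2 \<le> moment \<theta> q n"
  proof eventually_elim
    case (elim n)
    have "exp (\<theta> * c * real n) / 2 \<le> exp (\<theta> * (c * real n)) *
        labels.prob {u. \<exists>y. c * real n \<le> of_int y \<and> half_line (env (\<lambda>_. p) u) 0 n 0 y}"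
      using elim by (simp add: mult.assoc)
    also have "\<dots> \<le> moment \<theta> p n" by (rule moment_ge[OF assms(7)])
    finally have "(1 + (q - p) * (1 - exp (- 2 * \<theta>))) ^ n * (exp (\<theta> * c * real n) / 2) \<le>
        (1 + (q - p) * (1 - exp (- 2 * \<theta>))) ^ n * moment \<theta> p n"
      using d by (intro mult_left_mono) auto
    also have "\<dots> \<le> moment \<theta> q n" by (rule moment_gain[OF assms(3,5,6,7)])
    finally show ?case by (simp add: r_def power_mult_distrib mult.commute flip: exp_of_nat_mult)
  qed
  then have "\<forall>\<^sub>F k in sequentially. r ^ (k * m) / 2 \<le> moment \<theta> q (k * m)"
    using mult_nat_right_at_top[OF \<open>m > 0\<close>] unfolding filterlim_iff by blast
  then have "\<forall>\<^sub>F k in sequentially. 1 / 2 \<le> s ^ k"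
  proof eventually_elim
    case (elim k)
    have "r ^ (k * m) / 2 \<le> moment \<theta> q m ^ k" using elim moment_mult_le[OF assms(7), of q k m] by linarith
    then show ?case using r by (simp add: s_def power_divide field_simps power_mult flip: power_mult)
  qed
  moreover have "\<forall>\<^sub>F k in sequentially. s ^ k < 1 / 2"
    by (intro order_tendstoD(2)[OF LIMSEQ_realpow_zero[OF s]]) simp
  ultimately have "\<forall>\<^sub>F k in sequentially. False" by eventually_elim linarith
  then show False by simp
qed

lemma speed_gap:
  assumes sp: "right_edge_speed \<alpha>" and p: "p \<in> {p_crit..1}" "0 \<le> p" and q: "p \<le> q" "q \<le> 1"
    and c: "c < \<alpha> p" and c': "\<alpha> q < c'"
  shows "exp c * (1 + (q - p)) \<le> exp c'"
proof -
  define \<pi> where "\<pi> n = labels.prob {u. \<exists>y. c' * real n \<le> of_int y \<and> half_line (env (\<lambda>_. q) u) 0 n 0 y}" for n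
  have q': "q \<in> {p_crit..1}" "0 \<le> q" using p q by auto
  have "\<pi> \<longlonglongrightarrow> 0" unfolding \<pi>_def by (rule prob_half_line_ge_tendsto_0[OF sp q' c'])
  then have lim: "(\<lambda>n. exp c' + exp 1 * \<pi> n) \<longlonglongrightarrow> exp c' + exp 1 * 0" by (intro tendsto_intros)
  have "\<forall>\<^sub>F n in sequentially. exp c * (1 + (q - p)) \<le> exp c' + exp 1 * \<pi> n"
    using eventually_ge_at_top[of 2]
  proof eventually_elim
    case (elim n)
    \<comment> \<open>With this tilt \<open>exp (\<theta> * real n)\<close> is the constant e, so
      the tail term vanishes although no rate is known for \<open>\<pi>\<close>. The tilt is still
      large enough: the gain per level is at least (q - p)/n, and over n levels Bernoulli's
      inequality collects 1 + (q - p).\<close>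
    define \<theta> where "\<theta> = 1 / real n"
    have \<theta>: "\<theta> > 0" "\<theta> * real n = 1" "2 * \<theta> \<le> 1" using elim by (auto simp: \<theta>_def)
    have "\<theta> \<le> 1 - exp (- 2 * \<theta>)" using one_minus_exp_ge[of "2 * \<theta>"] \<theta> by simp
    then have "1 + real n * ((q - p) * \<theta>) \<le> 1 + real n * ((q - p) * (1 - exp (- 2 * \<theta>)))"
      using q by (intro add_mono mult_left_mono) auto
    also have "\<dots> \<le> (1 + (q - p) * (1 - exp (- 2 * \<theta>))) ^ n"
      using q \<theta> by (intro Bernoulli_inequality) (simp add: order_trans[of "- 1" 0])
    finally have F: "1 + real n * ((q - p) * \<theta>) \<le> (1 + (q - p) * (1 - exp (- 2 * \<theta>))) ^ n" .
    have "real n * ((q - p) * \<theta>) = (q - p) * (\<theta> * real n)" by (rule mult.commute[THEN trans]) (rule mult.assoc)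
    then have E: "real n * ((q - p) * \<theta>) = q - p" unfolding \<theta>(2) by (simp only: mult_1_right)
    have *: "1 + (q - p) \<le> (1 + (q - p) * (1 - exp (- 2 * \<theta>))) ^ n" using F unfolding E .
    have "exp c * (1 + (q - p)) \<le> exp (\<theta> * c) ^ n * (1 + (q - p) * (1 - exp (- 2 * \<theta>))) ^ n"
    proof (rule mult_mono[OF _ *])
      have eq: "real n * (\<theta> * c) = c" using \<theta>(1) by (simp add: \<theta>_def)
      show "exp c \<le> exp (\<theta> * c) ^ n" unfolding exp_of_nat_mult[symmetric] eq by (rule order_refl)
    qed (use q in auto)
    also have "\<dots> \<le> moment \<theta> q n"
      using moment_ge_power[OF sp p c q \<theta>(1), of n] elim by (simp add: power_mult_distrib)
    also have "\<dots> \<le> exp (\<theta> * (c' * real n)) + exp (\<theta> * real n) * \<pi> n"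
      unfolding \<pi>_def by (rule moment_le[OF \<theta>(1)])
    also have "\<theta> * (c' * real n) = c'" using \<theta>(1) by (simp add: \<theta>_def)
    finally show ?case using \<theta>(2) by simp
  qed
  from tendsto_lowerbound[OF lim this] show ?thesis by simp
qed

lemma speed_strict_mono:
  assumes sp: "right_edge_speed \<alpha>" and p: "p \<in> {p_crit..1}" "0 \<le> p" and q: "p < q" "q \<le> 1"
  shows "\<alpha> p < \<alpha> q"
proof (rule ccontr)
  assume "\<not> \<alpha> p < \<alpha> q"
  \<comment> \<open>The gain \<open>4 * e\<close> exceeds the slack \<open>2 * e\<close> that the
    two strict inequalities in \<open>speed_gap\<close> cost.\<close>
  define e where "e = ln (1 + (q - p)) / 4"
  have e: "e > 0" "exp (4 * e) = 1 + (q - p)" using q by (auto simp: e_def)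
  have "exp (\<alpha> p - e) * (1 + (q - p)) \<le> exp (\<alpha> p + e)"
    using \<open>\<not> \<alpha> p < \<alpha> q\<close> e q by (intro speed_gap[OF sp p]) auto
  then have "exp (\<alpha> p - e + 4 * e) \<le> exp (\<alpha> p + e)" unfolding exp_add[of "\<alpha> p - e"] e(2) .
  then show False using e(1) by simp
qed

section \<open>Survival, and the range of the speed\<close>

lemma prob_survive_le:
  "labels.prob {u. \<forall>k. \<exists>y. conn (env (\<lambda>_. p) u) 0 k 0 y} \<le>
    2 * labels.prob {u. \<exists>y\<ge>0. half_line (env (\<lambda>_. p) u) 0 k 0 y}"
proof -
  let ?R = "{u. \<exists>y\<ge>0. half_line (env (\<lambda>_. p) u) 0 k 0 y}"
  let ?L = "{u. u \<circ> reflect \<in> ?R}"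
  have R: "?R \<in> sets labels" by simp
  have L: "?L \<in> sets labels" using reindex_sets[OF R] .
  have "{u. \<forall>k. \<exists>y. conn (env (\<lambda>_. p) u) 0 k 0 y} \<subseteq> ?R \<union> ?L"
  proof
    fix u assume "u \<in> {u. \<forall>k. \<exists>y. conn (env (\<lambda>_. p) u) 0 k 0 y}"
    then obtain y where y: "conn (env (\<lambda>_. p) u) 0 k 0 y" by blast
    show "u \<in> ?R \<union> ?L"
    proof (cases "y \<ge> 0")
      case True
      then show ?thesis using conn_imp_half_line[OF y] by auto
    next
      case False
      have "conn (env (\<lambda>_. p) u \<circ> reflect) 0 k 0 (- y)" using y by (simp add: conn_reflect)
      from conn_imp_half_line[OF this] have "half_line (env (\<lambda>_. p) u \<circ> reflect) 0 k 0 (- y)"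
        by (rule half_line_mono) (use False in auto)
      then show ?thesis using False by (auto simp: env_reflect intro!: exI[of _ "- y"])
    qed
  qed
  then have "labels.prob {u. \<forall>k. \<exists>y. conn (env (\<lambda>_. p) u) 0 k 0 y} \<le> labels.prob (?R \<union> ?L)"
    using R L by (intro labels.finite_measure_mono) auto
  also have "\<dots> \<le> labels.prob ?R + labels.prob ?L"
    using R L by (rule measure_Un_le)
  also have "labels.prob ?L = labels.prob ?R" by (rule prob_labels_reindex[OF inj_reflect R])
  finally show ?thesis by simp
qed

lemma not_survive:
  assumes "(\<lambda>k. labels.prob {u. \<exists>y\<ge>0. half_line (env (\<lambda>_. p) u) 0 k 0 y}) \<longlonglongrightarrow> 0"
  shows "labels.prob {u. \<forall>k. \<exists>y. conn (env (\<lambda>_. p) u) 0 k 0 y} = 0"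
proof -
  have "(\<lambda>k. 2 * labels.prob {u. \<exists>y\<ge>0. half_line (env (\<lambda>_. p) u) 0 k 0 y}) \<longlonglongrightarrow> 2 * 0"
    by (intro tendsto_intros assms)
  then have "labels.prob {u. \<forall>k. \<exists>y. conn (env (\<lambda>_. p) u) 0 k 0 y} \<le> 2 * 0"
    by (rule tendsto_lowerbound) (auto intro!: always_eventually prob_survive_le)
  then show ?thesis by (simp add: measure_le_0_iff)
qed

text \<open>Sites at height 1 have odd abscissa, so the right edge can be 1 only if the edge from
  the origin to (1, 1) is open, and is otherwise at most -1.\<close>

lemma moment_one_step:
  assumes "0 \<le> p" "p \<le> 1"
  shows "moment 1 p 1 \<le> exp (- 1) + exp 1 * p"
proof -
  let ?E = "{u. u ((0, 0), (1, 1)) \<le> p}"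
  have "{u \<in> space labels. u ((0, 0), (1, 1)) \<le> p} \<in> sets labels" by measurable
  then have E: "?E \<in> sets labels" by simp
  have sub: "{u. \<exists>y. 0 \<le> real_of_int y \<and> half_line (env (\<lambda>_. p) u) 0 1 0 y} \<subseteq> ?E"
  proof
    fix u assume "u \<in> {u. \<exists>y. 0 \<le> real_of_int y \<and> half_line (env (\<lambda>_. p) u) 0 1 0 y}"
    then obtain x y where xy: "y \<ge> 0" "x \<le> 0" "conn (env (\<lambda>_. p) u) 0 (Suc 0) x y"
      by (auto simp: half_line_def)
    then have "even x" "y = x + 1 \<or> y = x - 1" by auto
    with xy(1,2) have "x = 0 \<and> y = 1 \<or> x = -1 \<and> y = 0" by linarith
    with \<open>even x\<close> have "x = 0" "y = 1" by auto
    with xy(3) show "u \<in> ?E" by (auto simp: env_def)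
  qed
  have "exp_edge 1 (env (\<lambda>_. p) u) 0 1 0 \<le> ennreal (exp (- 1)) + ennreal (exp 1) * indicator ?E u" for u
  proof (rule exp_edge_least)
    fix y assume y: "half_line (env (\<lambda>_. p) u) 0 1 0 y"
    show "ennreal (exp (1 * real_of_int y)) \<le> ennreal (exp (- 1)) + ennreal (exp 1) * indicator ?E u"
    proof (cases "y \<ge> 0")
      case True
      then have "u \<in> ?E" using sub y by auto
      have "y \<le> 1" using half_line_bound[OF y] by simp
      then have "ennreal (exp (1 * real_of_int y)) \<le> ennreal (exp 1)" by (intro ennreal_leI) simp
      with \<open>u \<in> ?E\<close> show ?thesis by (simp add: add_increasing)
    next
      case False
      then have "ennreal (exp (1 * real_of_int y)) \<le> ennreal (exp (- 1))" by (intro ennreal_leI) simp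
      then show ?thesis by (rule order_trans) simp
    qed
  qed
  then have "exp_moment 1 p 1 \<le> (\<integral>\<^sup>+u. ennreal (exp (- 1)) + ennreal (exp 1) * indicator ?E u \<partial>labels)"
    unfolding exp_moment_def by (intro nn_integral_mono)
  also have "\<dots> = ennreal (exp (- 1)) + ennreal (exp 1) * emeasure labels ?E"
    using E by (subst nn_integral_add) (simp_all add: nn_integral_cmult_indicator labels.emeasure_space_1[simplified])
  also have "\<dots> = ennreal (exp (- 1) + exp 1 * p)"
    using prob_label_le[OF assms, of "((0, 0), (1, 1))"] assms
    by (simp add: labels.emeasure_eq_measure ennreal_mult)
  finally show ?thesis unfolding exp_moment_eq[OF zero_less_one]
    by (subst (asm) ennreal_le_iff) (use assms in auto)
qed

text \<open>For p \<le> 1/10 the one-step moment at \<theta> = 1 is at most 1/2 + 3/10 < 1. By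
  submultiplicativity a right edge at or beyond 0 is then exponentially unlikely.\<close>

lemma not_survive_small:
  assumes "0 \<le> p" "p \<le> 1 / 10"
  shows "labels.prob {u. \<forall>k. \<exists>y. conn (env (\<lambda>_. p) u) 0 k 0 y} = 0"
proof (rule not_survive)
  define m where "m = moment 1 p 1"
  have "exp (- 1) \<le> (1 / 2 :: real)" using exp_ge_add_one_self[of 1] by (simp add: exp_minus field_simps)
  moreover have "exp 1 * p \<le> 3 * (1 / 10)" using exp_le assms by (intro mult_mono) auto
  ultimately have m: "0 \<le> m" "m < 1" using moment_one_step[of p] assms moment_nonneg by (auto simp: m_def)
  have "labels.prob {u. \<exists>y\<ge>0. half_line (env (\<lambda>_. p) u) 0 k 0 y} \<le> m ^ k" for k
    using moment_ge[of 1 0 p k] moment_mult_le[of 1 p k 1] by (simp add: m_def)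
  then show "(\<lambda>k. labels.prob {u. \<exists>y\<ge>0. half_line (env (\<lambda>_. p) u) 0 k 0 y}) \<longlonglongrightarrow> 0"
    by (intro tendsto_sandwich[OF _ _ tendsto_const LIMSEQ_realpow_zero[OF m]]) auto
qed

text \<open>Ensures that parameters from \<open>p_crit\<close> on are nonnegative, and that the
  profile reaches \<open>p_crit\<close> at a finite height.\<close>

lemma p_crit_pos: "p_crit > 0"
proof -
  have "1 / 10 \<le> p_crit"
    unfolding p_crit_def
  proof (rule cInf_greatest)
    show "{p \<in> {0..1}. measure (homogeneous p)
        {\<omega> \<in> space (homogeneous p). infinite (cluster \<omega>)} > 0} \<noteq> {}"
      using supercritical_nonempty by (intro ex_in_conv[THEN iffD1] exI[of _ "255 / 256"] CollectI conjI) simp_all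
    fix p assume "p \<in> {p \<in> {0..1}. measure (homogeneous p)
        {\<omega> \<in> space (homogeneous p). infinite (cluster \<omega>)} > 0}"
    then have p: "0 \<le> p" "p \<le> 1" and
      pos: "measure (homogeneous p) {\<omega> \<in> space (homogeneous p). infinite (cluster \<omega>)} > 0" by auto
    show "1 / 10 \<le> p"
    proof (rule ccontr)
      assume "\<not> 1 / 10 \<le> p"
      with not_survive_small[of p] p pos homogeneous_prob_infinite_cluster[OF p] show False by simp
    qed
  qed
  then show ?thesis by simp
qed

text \<open>Between \<open>p_crit\<close> and \<open>q\<close> there is a parameter \<open>p\<close>
  at which the cluster survives with positive probability. Its speed cannot be negative, as both
  edges would then retreat past each other and kill the cluster; strict monotonicity does the
  rest.\<close>

lemma speed_pos:
  assumes sp: "right_edge_speed \<alpha>" and q: "p_crit < q" "q \<le> 1"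
  shows "0 < \<alpha> q"
proof -
  let ?S = "{p \<in> {0..1}. measure (homogeneous p)
    {\<omega> \<in> space (homogeneous p). infinite (cluster \<omega>)} > 0}"
  have "?S \<noteq> {}"
    using supercritical_nonempty by (intro ex_in_conv[THEN iffD1] exI[of _ "255 / 256"] CollectI conjI) simp_all
  then obtain p where p: "p \<in> ?S" "p < q" using cInf_lessD[of ?S q] q unfolding p_crit_def by blast
  have ge: "p_crit \<le> p" unfolding p_crit_def using p(1) p_crit_set_bdd by (rule cInf_lower)
  have p01: "0 \<le> p" "p \<le> 1"
    and pos: "measure (homogeneous p) {\<omega> \<in> space (homogeneous p). infinite (cluster \<omega>)} > 0"
    using p(1) by auto
  have "0 \<le> \<alpha> p"
  proof (rule ccontr)
    assume "\<not> 0 \<le> \<alpha> p"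
    then have "(\<lambda>n. labels.prob {u. \<exists>y. 0 * real n \<le> of_int y \<and> half_line (env (\<lambda>_. p) u) 0 n 0 y}) \<longlonglongrightarrow> 0"
      using ge p01 by (intro prob_half_line_ge_tendsto_0[OF sp]) auto
    then have "labels.prob {u. \<forall>k. \<exists>y. conn (env (\<lambda>_. p) u) 0 k 0 y} = 0"
      by (intro not_survive) simp
    with pos homogeneous_prob_infinite_cluster[OF p01] show False by simp
  qed
  also have "\<alpha> p < \<alpha> q" using ge p01 p(2) q by (intro speed_strict_mono[OF sp]) auto
  finally show ?thesis .
qed

lemma speed_le_1:
  assumes sp: "right_edge_speed \<alpha>" and q: "p_crit \<le> q" "q \<le> 1"
  shows "\<alpha> q \<le> 1"
proof (rule ccontr)
  assume "\<not> \<alpha> q \<le> 1"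
  then obtain c where c: "1 < c" "c < \<alpha> q" using dense[of 1 "\<alpha> q"] by auto
  have lim: "(\<lambda>n. labels.prob {u. \<exists>y. c * real n \<le> of_int y \<and> half_line (env (\<lambda>_. q) u) 0 n 0 y}) \<longlonglongrightarrow> 1"
    using q p_crit_pos c by (intro prob_half_line_ge_tendsto_1[OF sp]) auto
  have "\<forall>\<^sub>F n in sequentially. labels.prob {u. \<exists>y. c * real n \<le> of_int y \<and> half_line (env (\<lambda>_. q) u) 0 n 0 y} = 0"
    using eventually_gt_at_top[of 0]
  proof eventually_elim
    case (elim n)
    then have "1 * real n < c * real n" using c by (intro mult_strict_right_mono) auto
    then have "{u. \<exists>y. c * real n \<le> of_int y \<and> half_line (env (\<lambda>_. q) u) 0 n 0 y} = {}"
      using half_line_bound by fastforce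
    then show ?case by (simp only: measure_empty)
  qed
  then have "(\<lambda>n. labels.prob {u. \<exists>y. c * real n \<le> of_int y \<and> half_line (env (\<lambda>_. q) u) 0 n 0 y}) \<longlonglongrightarrow> 0"
    by (rule tendsto_eventually)
  with lim show False using LIMSEQ_unique by fastforce
qed

section \<open>Piecewise homogeneous environments\<close>

text \<open>The shift by one gives parameter \<open>p i\<close> to the block that ends at level
  \<open>i * D\<close>. In the application this is the profile at the top of the slab, its minimum
  there.\<close>

definition blocks :: "(nat \<Rightarrow> real) \<Rightarrow> nat \<Rightarrow> int \<Rightarrow> real" where
  "blocks p D k = p (nat k div D + 1)"

lemma blocks_eq:
  assumes "int (i * D) \<le> k" "k < int (i * D) + int D"
  shows "blocks p D k = p (Suc i)"
proof -
  obtain n where n: "k = int n" using assms(1) by (metis nonneg_int_cases of_nat_0_le_iff order_trans)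
  have "i * D \<le> n" "n < i * D + D" using assms unfolding n by (simp_all only: of_nat_le_iff of_nat_less_iff flip: of_nat_add)
  then have "nat k div D = i" unfolding n by (intro div_nat_eqI) (auto simp: mult.commute)
  then show ?thesis by (simp add: blocks_def)
qed

text \<open>Rounds a real position down to a lattice site at level \<open>b\<close>, so that
  translated processes can start there.\<close>

definition parity_floor :: "int \<Rightarrow> real \<Rightarrow> int" where
  "parity_floor b x = 2 * \<lfloor>(x - of_int b) / 2\<rfloor> + b"

lemma parity_floor_even: "even (parity_floor b x + b)"
  by (simp add: parity_floor_def)

lemma parity_floor_le: "of_int (parity_floor b x) \<le> x" "x < of_int (parity_floor b x) + 2"
proof -
  define f where "f = \<lfloor>(x - of_int b) / 2\<rfloor>"
  have f: "of_int f \<le> (x - of_int b) / 2" "(x - of_int b) / 2 < of_int f + 1"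
    unfolding f_def by (rule of_int_floor_le, rule floor_correct[THEN conjunct2, unfolded of_int_add of_int_1])
  have r: "real_of_int (parity_floor b x) = 2 * of_int f + of_int b"
    by (simp add: parity_floor_def f_def)
  show "of_int (parity_floor b x) \<le> x" "x < of_int (parity_floor b x) + 2"
    using f unfolding r by (simp_all add: field_simps)
qed

locale decreasing_blocks =
  fixes \<alpha> :: "real \<Rightarrow> real" and p :: "nat \<Rightarrow> real" and m :: nat
  assumes sp: "right_edge_speed \<alpha>"
    and p_gt: "\<And>i. 1 \<le> i \<Longrightarrow> i \<le> m \<Longrightarrow> p_crit < p i"
    and p_le: "\<And>i. 1 \<le> i \<Longrightarrow> i \<le> m \<Longrightarrow> p i \<le> 1"
    and p_less: "\<And>i. 1 \<le> i \<Longrightarrow> Suc i \<le> m \<Longrightarrow> p (Suc i) < p i"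
begin

definition height :: "nat \<Rightarrow> real" where
  "height i = (\<Sum>j = 1..i. \<alpha> (p j))"

lemma height_Suc: "height (Suc i) = height i + \<alpha> (p (Suc i))"
  by (simp add: height_def)

lemma p_range: "1 \<le> i \<Longrightarrow> i \<le> m \<Longrightarrow> p i \<in> {p_crit..1}" "1 \<le> i \<Longrightarrow> i \<le> m \<Longrightarrow> 0 \<le> p i"
  using p_gt[of i] p_le[of i] p_crit_pos by auto

text \<open>For an upper bound the restart from a full half line is legitimate, as it only adds
  paths; the errors of the blocks add up.\<close>

lemma upper_edge:
  assumes "i \<le> m" "e > 0"
  shows "whp sequentially (\<lambda>D u. \<forall>y. half_line (env (blocks p D) u) 0 (i * D) 0 y \<longrightarrow>
    of_int y \<le> (height i + e) * real D)"
  using assms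
proof (induction i arbitrary: e)
  case 0
  have "real_of_int y \<le> e * real D" if "y \<le> 0" for y :: int and D :: nat
    using that mult_nonneg_nonneg[of e "real D"] 0 by linarith
  then show ?case by (intro whp_always) (auto simp: half_line_def height_def)
next
  case (Suc i)
  let ?a = "\<alpha> (p (Suc i))" and ?B = "\<lambda>D. int (i * D)"
  \<comment> \<open>The \<open>+ 2\<close> makes up for rounding: the new half line covers every
    site up to the bound of the previous block.\<close>
  define X where "X D = parity_floor (?B D) ((height i + e / 3) * real D) + 2" for D
  have IH: "whp sequentially (\<lambda>D u. \<forall>y. half_line (env (blocks p D) u) 0 (i * D) 0 y \<longrightarrow>
      of_int y \<le> (height i + e / 3) * real D)"
    using Suc.prems by (intro Suc.IH) auto
  have par: "even (X D + ?B D)" for D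
    using parity_floor_even[of "?B D" "(height i + e / 3) * real D"] by (simp add: X_def)
  have "whp sequentially (\<lambda>D u. \<forall>y. half_line (env (\<lambda>_. p (Suc i)) u) (?B D) D (X D) y \<longrightarrow>
      of_int y \<le> of_int (X D) + (?a + e / 3) * real D)"
    using Suc.prems par by (intro speed_upper_shift[OF sp] p_range) (auto intro: filterlim_ident)
  with IH have "whp sequentially (\<lambda>D u. (\<forall>y. half_line (env (blocks p D) u) 0 (i * D) 0 y \<longrightarrow>
      of_int y \<le> (height i + e / 3) * real D) \<and>
    (\<forall>y. half_line (env (\<lambda>_. p (Suc i)) u) (?B D) D (X D) y \<longrightarrow>
      of_int y \<le> of_int (X D) + (?a + e / 3) * real D))"
    by (rule whp_conj)
  then show ?case
  proof (rule whp_mono)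
    have "\<forall>\<^sub>F D in sequentially. 2 \<le> e / 3 * real D"
      using Suc.prems(2) by real_asymp
    then show "\<forall>\<^sub>F D in sequentially. \<forall>u. (\<forall>y. half_line (env (blocks p D) u) 0 (i * D) 0 y \<longrightarrow>
        of_int y \<le> (height i + e / 3) * real D) \<and>
      (\<forall>y. half_line (env (\<lambda>_. p (Suc i)) u) (?B D) D (X D) y \<longrightarrow>
        of_int y \<le> of_int (X D) + (?a + e / 3) * real D) \<longrightarrow>
      (\<forall>y. half_line (env (blocks p D) u) 0 (Suc i * D) 0 y \<longrightarrow> of_int y \<le> (height (Suc i) + e) * real D)"
    proof eventually_elim
      case (elim D)
      show ?case
      proof (intro allI impI, elim conjE)
        fix u y
        assume U: "\<forall>y. half_line (env (blocks p D) u) 0 (i * D) 0 y \<longrightarrow>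
            of_int y \<le> (height i + e / 3) * real D"
          and V: "\<forall>y. half_line (env (\<lambda>_. p (Suc i)) u) (?B D) D (X D) y \<longrightarrow>
            of_int y \<le> of_int (X D) + (?a + e / 3) * real D"
          and "half_line (env (blocks p D) u) 0 (Suc i * D) 0 y"
        then have "half_line (env (blocks p D) u) 0 (i * D + D) 0 y" by (simp add: add.commute)
        then obtain z where z: "half_line (env (blocks p D) u) 0 (i * D) 0 z"
          "conn (env (blocks p D) u) (0 + ?B D) D z y" unfolding half_line_add by blast
        have "real_of_int z \<le> of_int (X D)"
          using U z(1) parity_floor_le(2)[of "(height i + e / 3) * real D" "?B D"] by (force simp: X_def)
        then have "half_line (env (blocks p D) u) (?B D) D (X D) y"
          using z(2) by (auto simp: half_line_def)
        then have "half_line (env (\<lambda>_. p (Suc i)) u) (?B D) D (X D) y"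
          by (rule half_line_env_mono) (auto simp: blocks_eq)
        then have "of_int y \<le> of_int (X D) + (?a + e / 3) * real D" using V by blast
        also have "of_int (X D) \<le> (height i + e / 3) * real D + 2"
          using parity_floor_le(1)[of "?B D" "(height i + e / 3) * real D"] by (simp add: X_def)
        finally show "of_int y \<le> (height (Suc i) + e) * real D"
          using elim by (simp add: height_Suc algebra_simps)
      qed
    qed
  qed
qed

text \<open>A path of the next, slower, environment is started one block below the top, slightly to the
  right of the present path. It falls behind within this block and so has to cross that path.\<close>

lemma lower_edge_step:
  assumes m: "Suc (Suc h) \<le> m" and "e > 0"
    and IH: "\<And>e. e > 0 \<Longrightarrow> whp sequentially (\<lambda>D u. \<exists>y. (height (Suc h) - e) * real D \<le> of_int y \<and>
      half_line (env (blocks p D) u) 0 (Suc h * D) 0 y)"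
  shows "whp sequentially (\<lambda>D u. \<exists>y. (height (Suc (Suc h)) - e) * real D \<le> of_int y \<and>
    half_line (env (blocks p D) u) 0 (Suc (Suc h) * D) 0 y)"
proof -
  let ?q = "p (Suc (Suc h))"
  define a where "a = \<alpha> ?q"
  define a' where "a' = \<alpha> (p (Suc h))"
  have "a < a'" unfolding a_def a'_def
    using m by (intro speed_strict_mono[OF sp] p_range p_less p_le) auto
  \<comment> \<open>All slacks are multiples of \<open>s\<close>. Separating the starting points
    needs \<open>9 * s \<le> a' - a\<close>, and the final estimate loses \<open>5 * s\<close>;
    dividing by 20 is enough for both.\<close>
  define s where "s = min e (a' - a) / 20"
  have s: "s > 0" "20 * s \<le> e" "20 * s \<le> a' - a" using \<open>a < a'\<close> \<open>e > 0\<close> by (auto simp: s_def)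
  let ?B = "\<lambda>D. int (h * D)"
  \<comment> \<open>From \<open>c\<close> a path of speed \<open>a\<close> arrives one block later
    at \<open>height (Suc h) - 2 * s\<close>. Even with the fluctuation \<open>s\<close> allowed by
    \<open>E5\<close> it is then not to the right of the bound in \<open>E1\<close>.\<close>
  define c where "c = height (Suc h) - a - 2 * s"
  define X where "X D = parity_floor (?B D) (c * real D)" for D
  \<comment> \<open>\<open>E3\<close> supplies a path from some unknown site at or left of
    \<open>X D\<close>. By \<open>E4\<close> paths from \<open>X' D\<close> or further left end
    short of its end point, so it starts between the two and hence right of \<open>z1\<close>. Over
    two blocks the two speed bounds differ by \<open>4 * s\<close>; the fifth \<open>s\<close>
    absorbs rounding.\<close>
  define X' where "X' D = parity_floor (?B D) ((c - 5 * s) * real D)" for D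
  have par: "even (X D + ?B D)" "even (X' D + ?B D)" for D
    using parity_floor_even by (auto simp: X_def X'_def)
  have q: "?q \<in> {p_crit..1}" "0 \<le> ?q" using p_range[of "Suc (Suc h)"] m by auto
  have lim: "filterlim (\<lambda>D::nat. D + D) at_top sequentially"
    by (rule filterlim_at_top_mono[OF filterlim_ident]) (simp add: always_eventually)
  note E1 = IH[OF s(1)]
  have E2: "whp sequentially (\<lambda>D u. \<forall>y. half_line (env (blocks p D) u) 0 (h * D) 0 y \<longrightarrow>
      of_int y \<le> (height h + s) * real D)"
    using m s by (intro upper_edge) auto
  have E3: "whp sequentially (\<lambda>D u. \<exists>y. of_int (X D) + (a - s) * real (D + D) \<le> of_int y \<and>
      half_line (env (\<lambda>_. ?q) u) (?B D) (D + D) (X D) y)"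
    using s par lim by (intro speed_lower_shift[OF sp q]) (auto simp: a_def)
  have E4: "whp sequentially (\<lambda>D u. \<forall>y. half_line (env (\<lambda>_. ?q) u) (?B D) (D + D) (X' D) y \<longrightarrow>
      of_int y \<le> of_int (X' D) + (a + s) * real (D + D))"
    using s par lim by (intro speed_upper_shift[OF sp q]) (auto simp: a_def)
  have E5: "whp sequentially (\<lambda>D u. \<forall>y. half_line (env (\<lambda>_. ?q) u) (?B D) D (X D) y \<longrightarrow>
      of_int y \<le> of_int (X D) + (a + s) * real D)"
    using s par by (intro speed_upper_shift[OF sp q] filterlim_ident) (auto simp: a_def)
  show ?thesis
  proof (rule whp_mono[OF whp_conj[OF E1 whp_conj[OF E2 whp_conj[OF E3 whp_conj[OF E4 E5]]]]])
    have "\<forall>\<^sub>F D in sequentially. 2 < s * real D" using s(1) by real_asymp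
    then show "\<forall>\<^sub>F D in sequentially. \<forall>u.
      (\<exists>y. (height (Suc h) - s) * real D \<le> of_int y \<and> half_line (env (blocks p D) u) 0 (Suc h * D) 0 y) \<and>
      (\<forall>y. half_line (env (blocks p D) u) 0 (h * D) 0 y \<longrightarrow> of_int y \<le> (height h + s) * real D) \<and>
      (\<exists>y. of_int (X D) + (a - s) * real (D + D) \<le> of_int y \<and>
        half_line (env (\<lambda>_. ?q) u) (?B D) (D + D) (X D) y) \<and>
      (\<forall>y. half_line (env (\<lambda>_. ?q) u) (?B D) (D + D) (X' D) y \<longrightarrow>
        of_int y \<le> of_int (X' D) + (a + s) * real (D + D)) \<and>
      (\<forall>y. half_line (env (\<lambda>_. ?q) u) (?B D) D (X D) y \<longrightarrow> of_int y \<le> of_int (X D) + (a + s) * real D) \<longrightarrow>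
      (\<exists>y. (height (Suc (Suc h)) - e) * real D \<le> of_int y \<and>
        half_line (env (blocks p D) u) 0 (Suc (Suc h) * D) 0 y)"
    proof eventually_elim
      case (elim D)
      let ?d = "real D"
      have X: "of_int (X D) \<le> c * ?d" "c * ?d < of_int (X D) + 2"
        "of_int (X' D) \<le> (c - 5 * s) * ?d" "(c - 5 * s) * ?d < of_int (X' D) + 2"
        unfolding X_def X'_def by (rule parity_floor_le)+
      show ?case
      proof (intro allI impI, elim conjE exE)
        fix u y1 y2
        assume y1: "(height (Suc h) - s) * ?d \<le> of_int y1" "half_line (env (blocks p D) u) 0 (Suc h * D) 0 y1"
          and U: "\<forall>y. half_line (env (blocks p D) u) 0 (h * D) 0 y \<longrightarrow> of_int y \<le> (height h + s) * ?d"
          and y2: "of_int (X D) + (a - s) * real (D + D) \<le> of_int y2"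
            "half_line (env (\<lambda>_. ?q) u) (?B D) (D + D) (X D) y2"
          and V: "\<forall>y. half_line (env (\<lambda>_. ?q) u) (?B D) (D + D) (X' D) y \<longrightarrow>
            of_int y \<le> of_int (X' D) + (a + s) * real (D + D)"
          and W: "\<forall>y. half_line (env (\<lambda>_. ?q) u) (?B D) D (X D) y \<longrightarrow>
            of_int y \<le> of_int (X D) + (a + s) * ?d"
        have "half_line (env (blocks p D) u) 0 (h * D + D) 0 y1" using y1(2) by (simp add: add.commute)
        then obtain z1 where z1: "half_line (env (blocks p D) u) 0 (h * D) 0 z1"
          "conn (env (blocks p D) u) (?B D) D z1 y1" unfolding half_line_add by auto
        obtain x2 where x2: "x2 \<le> X D" "conn (env (\<lambda>_. ?q) u) (?B D) (D + D) x2 y2"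
          using y2(2) by (auto simp: half_line_def)
        then obtain z2 where z2: "conn (env (\<lambda>_. ?q) u) (?B D) D x2 z2"
          "conn (env (\<lambda>_. ?q) u) (?B D + int D) D z2 y2" unfolding conn_add by blast
        have pos: "0 \<le> ?d" by simp
        have "X' D < x2"
        proof (rule ccontr)
          assume "\<not> X' D < x2"
          then have "of_int y2 \<le> of_int (X' D) + (a + s) * real (D + D)"
            using V x2(2) by (auto simp: half_line_def not_less)
          with y2(1) X elim show False by (simp add: algebra_simps)
        qed
        moreover have "real_of_int z1 \<le> of_int (X' D)"
        proof -
          have "height h + s \<le> c - 6 * s" using s by (simp add: c_def height_Suc flip: a'_def)
          from mult_right_mono[OF this pos] U z1(1) X(4) elim show ?thesis
            by (fastforce simp: algebra_simps)
        qed
        ultimately have "z1 \<le> x2" by linarith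
        have "of_int z2 \<le> of_int (X D) + (a + s) * ?d"
          using W z2(1) x2(1) by (auto simp: half_line_def)
        then have "real_of_int z2 \<le> (height (Suc h) - s) * ?d"
          using X(1) by (simp add: c_def algebra_simps)
        then have "z2 \<le> y1" using y1(1) by linarith
        have le: "?q \<le> blocks p D k" if "?B D \<le> k" "k < ?B D + 2 * int D" for k
        proof (cases "k < ?B D + int D")
          case True
          then show ?thesis using that p_less[of "Suc h"] m by (simp add: blocks_eq[of h])
        next
          case False
          then show ?thesis using that by (simp add: blocks_eq[of "Suc h"] algebra_simps)
        qed
        have c1: "conn (env (blocks p D) u) (?B D) D x2 z2"
          using z2(1) by (rule conn_env_mono) (auto intro!: le)
        have c2: "conn (env (blocks p D) u) (?B D + int D) D z2 y2"
          using z2(2) by (rule conn_env_mono) (auto intro!: le)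
        from conn_cross[OF z1(2) c1 \<open>z1 \<le> x2\<close> \<open>z2 \<le> y1\<close>] obtain n w where
          n: "n \<le> D" "conn (env (blocks p D) u) (?B D) n z1 w"
          "conn (env (blocks p D) u) (?B D + int n) (D - n) w z2" by metis
        have "conn (env (blocks p D) u) (?B D) D z1 z2" using conn_join[OF n(2,3)] n(1) by simp
        then have "conn (env (blocks p D) u) (?B D) (D + D) z1 y2" using c2 by (rule conn_join)
        then have "half_line (env (blocks p D) u) 0 (h * D + (D + D)) 0 y2"
          using z1(1) unfolding half_line_add[of _ 0 "h * D"] by auto
        moreover have "h * D + (D + D) = Suc (Suc h) * D" by simp
        moreover have "(height (Suc (Suc h)) - e) * ?d \<le> of_int y2"
        proof -
          have "height (Suc (Suc h)) - e \<le> c + 2 * a - 3 * s"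
            using s unfolding c_def height_Suc[of "Suc h"] a_def[symmetric] by simp
          from mult_right_mono[OF this pos] y2(1) X(2) elim show ?thesis by (simp add: algebra_simps)
        qed
        ultimately show "\<exists>y. (height (Suc (Suc h)) - e) * ?d \<le> of_int y \<and>
            half_line (env (blocks p D) u) 0 (Suc (Suc h) * D) 0 y" by metis
      qed
    qed
  qed
qed

lemma lower_edge:
  assumes "i \<le> m" "e > 0"
  shows "whp sequentially (\<lambda>D u. \<exists>y. (height i - e) * real D \<le> of_int y \<and>
    half_line (env (blocks p D) u) 0 (i * D) 0 y)"
  using assms
proof (induction i arbitrary: e)
  case 0
  then show ?case by (intro whp_always exI[of _ 0]) (auto simp: half_line_def height_def)
next
  case (Suc i)
  \<comment> \<open>The crossing needs a block below the new one, so the first block is the plain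
    law of large numbers.\<close>
  show ?case
  proof (cases i)
    case 0
    have "whp sequentially (\<lambda>D u. \<exists>y. of_int 0 + (\<alpha> (p (Suc 0)) - e) * real D \<le> of_int y \<and>
        half_line (env (\<lambda>_. p (Suc 0)) u) 0 D 0 y)"
      using Suc.prems by (intro speed_lower_shift[OF sp] p_range filterlim_ident) auto
    then show ?thesis
    proof (rule whp_mono, intro always_eventually allI impI, elim exE conjE)
      fix D u y
      assume y: "of_int 0 + (\<alpha> (p (Suc 0)) - e) * real D \<le> of_int y"
        "half_line (env (\<lambda>_. p (Suc 0)) u) 0 D 0 y"
      have "half_line (env (blocks p D) u) 0 D 0 y"
        using y(2) by (rule half_line_env_mono) (auto simp: blocks_eq[of 0])
      with y(1) 0 show "\<exists>y. (height (Suc i) - e) * real D \<le> of_int y \<and>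
          half_line (env (blocks p D) u) 0 (Suc i * D) 0 y"
        by (intro exI[of _ y]) (simp add: height_def)
    qed
  next
    case (Suc h)
    have "Suc (Suc h) \<le> m" using Suc.prems(1) Suc by simp
    then show ?thesis unfolding Suc using Suc.prems(2)
      by (rule lower_edge_step) (use Suc.IH Suc.prems(1) Suc in simp)
  qed
qed

end

section \<open>Profile and shape\<close>

lemma profile_bounds: "0 \<le> profile \<beta> y" "profile \<beta> y \<le> 1"
  by (simp_all add: profile_def)

lemma profile_less:
  assumes "\<beta> > 0" "0 \<le> y" "y < z"
  shows "profile \<beta> z < profile \<beta> y"
proof (cases "y = 0")
  case True
  then show ?thesis using assms by (simp add: profile_def)
next
  case False
  then have "z powr (- \<beta>) < y powr (- \<beta>)" using assms by (intro powr_less_mono2_neg) auto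
  then show ?thesis using assms False by (simp add: profile_def)
qed

lemma profile_le: "\<beta> > 0 \<Longrightarrow> 0 \<le> y \<Longrightarrow> y \<le> z \<Longrightarrow> profile \<beta> z \<le> profile \<beta> y"
  using profile_less[of \<beta> y z] by (cases "y = z") auto

lemma y_crit:
  assumes "\<beta> > 0"
  shows "y_crit \<beta> > 0" "profile \<beta> (y_crit \<beta>) = p_crit"
proof -
  define y where "y = (- ln (1 - p_crit)) powr (- 1 / \<beta>)"
  have "ln (1 - p_crit) < 0" using p_crit_pos p_crit_less_1 by simp
  then have pos: "y > 0" by (simp add: y_def)
  have "y powr (- \<beta>) = - ln (1 - p_crit)"
    using \<open>ln (1 - p_crit) < 0\<close> assms by (simp add: y_def powr_powr)
  then have eq: "profile \<beta> y = p_crit" using pos p_crit_less_1 by (simp add: profile_def)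
  have "y_crit \<beta> = y"
    unfolding y_crit_def
  proof (rule the_equality)
    show "0 \<le> y \<and> profile \<beta> y = p_crit" using pos eq by simp
    fix z assume "0 \<le> z \<and> profile \<beta> z = p_crit"
    then show "z = y" using profile_less[OF assms, of z y] profile_less[OF assms, of y z] pos eq
      by (metis less_eq_real_def linorder_neqE_linordered_idom order_less_irrefl)
  qed
  then show "y_crit \<beta> > 0" "profile \<beta> (y_crit \<beta>) = p_crit" using pos eq by auto
qed

lemma rho_eq_profile:
  assumes "\<beta> > 0" "t > 0" "h > 0"
  shows "rho \<beta> h t = profile \<beta> (h / t powr (1 / \<beta>))"
proof -
  have "(h / t powr (1 / \<beta>)) powr (- \<beta>) = h powr (- \<beta>) / (t powr (1 / \<beta>)) powr (- \<beta>)"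
    by (rule powr_divide)
  also have "(t powr (1 / \<beta>)) powr (- \<beta>) = 1 / t" using assms by (simp add: powr_powr powr_minus_divide)
  finally show ?thesis using assms by (simp add: rho_def profile_def mult.commute)
qed

lemma crit_height_eq:
  assumes "\<beta> > 0" "t > 0"
  shows "crit_height \<beta> t = y_crit \<beta> * t powr (1 / \<beta>)"
  unfolding crit_height_def height_at_def
proof (rule Greatest_equality)
  let ?T = "t powr (1 / \<beta>)"
  have T: "?T > 0" using assms by simp
  show "0 < y_crit \<beta> * ?T \<and> p_crit \<le> rho \<beta> (y_crit \<beta> * ?T) t"
    using y_crit[OF assms(1)] T rho_eq_profile[OF assms, of "y_crit \<beta> * ?T"] by simp
  fix y assume y: "0 < y \<and> p_crit \<le> rho \<beta> y t"
  show "y \<le> y_crit \<beta> * ?T"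
  proof (rule ccontr)
    assume "\<not> y \<le> y_crit \<beta> * ?T"
    then have "y_crit \<beta> < y / ?T" using T by (simp add: less_divide_eq)
    then have "profile \<beta> (y / ?T) < p_crit"
      using profile_less[OF assms(1), of "y_crit \<beta>" "y / ?T"] y_crit[OF assms(1)] by simp
    then show False using y rho_eq_profile[OF assms, of y] by simp
  qed
qed

text \<open>Allows a threshold that depends on the error: a set \<open>A\<close> is fixed first,
  together with such a threshold, and only then does \<open>x\<close> vary along the filter.\<close>

lemma whp_approx:
  assumes "\<And>e. e > 0 \<Longrightarrow> \<exists>A\<in>sets labels. 1 - e \<le> labels.prob A \<and> whp F (\<lambda>x u. u \<in> A \<longrightarrow> E x u)"
  shows "whp F E"
  unfolding whp_def
proof (intro allI impI)
  fix e :: real assume "e > 0"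
  then obtain A where A: "A \<in> sets labels" "1 - e / 2 \<le> labels.prob A" "whp F (\<lambda>x u. u \<in> A \<longrightarrow> E x u)"
    using assms[of "e / 2"] by auto
  have "\<forall>\<^sub>F x in F. \<exists>B\<in>sets labels. 1 - e / 2 \<le> labels.prob B \<and> (\<forall>u\<in>B. u \<in> A \<longrightarrow> E x u)"
    using A(3) \<open>e > 0\<close> unfolding whp_def by (elim allE[of _ "e / 2"]) simp
  then show "\<forall>\<^sub>F x in F. \<exists>A\<in>sets labels. 1 - e \<le> labels.prob A \<and> (\<forall>u\<in>A. E x u)"
  proof eventually_elim
    case (elim x)
    then obtain B where B: "B \<in> sets labels" "1 - e / 2 \<le> labels.prob B" "\<forall>u\<in>B. u \<in> A \<longrightarrow> E x u" by blast
    have "1 - e \<le> labels.prob (A \<inter> B)" using prob_Int_ge[OF A(1) B(1)] A(2) B(2) by linarith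
    with A B show ?case by (intro bexI[of _ "A \<inter> B"]) auto
  qed
qed

lemma conn_diagonal:
  assumes "\<And>j. b \<le> j \<Longrightarrow> j < b + int k \<Longrightarrow> \<omega> ((j, j), (j + 1, j + 1))"
  shows "conn \<omega> b k b (b + int k)"
  using assms
proof (induction k arbitrary: b)
  case (Suc k)
  have "conn \<omega> (b + 1) k (b + 1) (b + 1 + int k)" using Suc.prems by (intro Suc.IH) auto
  moreover have "\<omega> ((b, b), (b + 1, b + 1))" using Suc.prems by simp
  moreover have "b + 1 + int k = b + int (Suc k)" by simp
  ultimately show ?case unfolding conn_Suc by simp
qed simp

section \<open>The speed profile and the shape\<close>

locale shape =
  fixes \<beta> \<eta> :: real and \<alpha> g :: "real \<Rightarrow> real"
  assumes \<beta>: "\<beta> > 0"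
    and sp: "right_edge_speed \<alpha>"
    and g: "shape_function \<beta> \<alpha> g"
    and \<eta>: "0 < \<eta>" "\<eta> < 1"
begin

abbreviation yc :: real where "yc \<equiv> y_crit \<beta>"

abbreviation a :: "real \<Rightarrow> real" where "a y \<equiv> \<alpha> (profile \<beta> y)"

abbreviation scale :: "real \<Rightarrow> real" where "scale t \<equiv> t powr (1 / \<beta>)"

text \<open>The edges leaving level \<open>k\<close> have their midpoints at height
  \<open>k + 1/2\<close>.\<close>

definition param :: "real \<Rightarrow> int \<Rightarrow> real" where
  "param t k = rho \<beta> (of_int k + 1 / 2) t"

lemma yc: "yc > 0" by (rule y_crit(1)[OF \<beta>])

lemma profile_gt: "0 \<le> y \<Longrightarrow> y < yc \<Longrightarrow> p_crit < profile \<beta> y"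
  using profile_less[OF \<beta>, of y yc] y_crit(2)[OF \<beta>] by simp

lemma a_less:
  assumes "0 \<le> y" "y < z" "z \<le> yc"
  shows "a z < a y"
proof (rule speed_strict_mono[OF sp])
  show "profile \<beta> z \<in> {p_crit..1}"
    using profile_le[OF \<beta>, of z yc] assms y_crit(2)[OF \<beta>] profile_bounds by auto
qed (use assms profile_less[OF \<beta>] profile_bounds in auto)

lemma a_pos: "0 \<le> y \<Longrightarrow> y < yc \<Longrightarrow> 0 < a y"
  using speed_pos[OF sp profile_gt profile_bounds(2)] .

lemma a_le_1: "0 \<le> y \<Longrightarrow> y < yc \<Longrightarrow> a y \<le> 1"
  using speed_le_1[OF sp less_imp_le[OF profile_gt] profile_bounds(2)] .

lemma a_0: "a 0 = \<alpha> 1"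
  by (simp add: profile_def)

lemma g_mvt:
  assumes "0 \<le> y" "y < z" "z \<le> yc"
  obtains \<xi> where "y < \<xi>" "\<xi> < z" "g z - g y = a \<xi> * (z - y)"
proof -
  have D: "(g has_real_derivative a x) (at x within {0..yc})" if "x \<in> {0..yc}" for x
    using g that unfolding shape_function_def by blast
  have "(g has_derivative (*) (a x)) (at x within {y..z})" if "x \<in> {y..z}" for x
  proof -
    have "x \<in> {0..yc}" "{y..z} \<subseteq> {0..yc}" using that assms by auto
    from DERIV_subset[OF D[OF this(1)] this(2)] show ?thesis by (simp add: has_field_derivative_def)
  qed
  then obtain x where "x \<in> {y<..<z}" "g z - g y = a x * (z - y)"
    using mvt_simple[of y z g "\<lambda>x. (*) (a x)"] assms by auto
  then show ?thesis using that by auto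
qed

lemma g_0: "g 0 = 0"
  using g by (simp add: shape_function_def)

lemma g_less:
  assumes "0 \<le> y" "y < z" "z \<le> yc"
  shows "g y < g z"
proof -
  obtain \<xi> where \<xi>: "y < \<xi>" "\<xi> < z" "g z - g y = a \<xi> * (z - y)" by (rule g_mvt[OF assms])
  have "0 < a \<xi> * (z - y)" using \<xi> assms by (intro mult_pos_pos a_pos) auto
  then show ?thesis using \<xi>(3) by simp
qed

lemma g_mono: "0 \<le> y \<Longrightarrow> y \<le> z \<Longrightarrow> z \<le> yc \<Longrightarrow> g y \<le> g z"
  using g_less[of y z] by (cases "y = z") (simp_all add: less_imp_le)

lemma g_increment:
  assumes "0 \<le> y" "y \<le> z" "z \<le> yc"
  shows "g z - g y \<le> a y * (z - y)"
proof (cases "y = z")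
  case False
  then obtain \<xi> where \<xi>: "y < \<xi>" "\<xi> < z" "g z - g y = a \<xi> * (z - y)"
    using g_mvt[of y z] assms by (metis less_eq_real_def)
  have "a \<xi> \<le> a y" using \<xi> assms a_less[of y \<xi>] by simp
  then show ?thesis using \<xi>(3) assms by (simp add: mult_right_mono)
qed simp

text \<open>This stands in for continuity of \<alpha> at 1. The difference quotients of
  \<open>g\<close> at 0 tend to \<alpha>(1), and by the mean value theorem each of them is a value
  of the speed at some small positive height.\<close>

lemma almost_full_speed:
  obtains \<xi> where "0 < \<xi>" "\<xi> < yc" "(1 - \<eta>) * \<alpha> 1 < a \<xi>"
proof -
  have "(g has_real_derivative a 0) (at 0 within {0..yc})"
    using g yc by (simp add: shape_function_def)
  then have "((\<lambda>y. (g y - g 0) / (y - 0)) \<longlongrightarrow> \<alpha> 1) (at 0 within {0..yc})"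
    unfolding has_field_derivative_iff a_0 .
  moreover have "(1 - \<eta>) * \<alpha> 1 < \<alpha> 1" using a_pos[of 0] yc \<eta> by (simp add: a_0)
  ultimately have "\<forall>\<^sub>F y in at 0 within {0..yc}. (1 - \<eta>) * \<alpha> 1 < (g y - g 0) / (y - 0)"
    by (rule order_tendstoD(1))
  moreover have "\<forall>\<^sub>F y in at 0 within {0..yc}. y \<in> {0..yc} \<and> y \<noteq> 0"
    unfolding eventually_at by (intro exI[of _ 1]) auto
  ultimately have "\<forall>\<^sub>F y in at 0 within {0..yc}. (1 - \<eta>) * \<alpha> 1 < (g y - g 0) / (y - 0) \<and>
      y \<in> {0..yc} \<and> y \<noteq> 0"
    by eventually_elim auto
  moreover have "at 0 within {0..yc} \<noteq> bot"
    using yc by (simp add: trivial_limit_within islimpt_Icc)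
  ultimately obtain y where y: "(1 - \<eta>) * \<alpha> 1 < g y / y" "0 < y" "y \<le> yc"
    using eventually_happens' by (force simp: g_0)
  obtain \<xi> where \<xi>: "0 < \<xi>" "\<xi> < y" "g y - g 0 = a \<xi> * (y - 0)"
    using g_mvt[of 0 y] y by auto
  then have "g y / y = a \<xi>" using y by (simp add: g_0)
  with y \<xi> show ?thesis by (intro that[of \<xi>]) auto
qed

lemma param_ge:
  assumes "t > 0" "0 \<le> k" "of_int k + 1 \<le> y * scale t"
  shows "profile \<beta> y \<le> param t k"
proof -
  have T: "scale t > 0" using assms(1) by simp
  have "(of_int k + 1 / 2) / scale t \<le> y" using assms T by (simp add: divide_le_eq)
  then have "profile \<beta> y \<le> profile \<beta> ((of_int k + 1 / 2) / scale t)"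
    using assms(2) T by (intro profile_le[OF \<beta>]) auto
  then show ?thesis using rho_eq_profile[OF \<beta> assms(1), of "of_int k + 1 / 2"] assms(2)
    by (simp add: param_def)
qed

lemma param_tendsto_1: "((\<lambda>t. param t k) \<longlongrightarrow> 1) at_top" if "0 \<le> k"
proof -
  have "(of_int k + 1 / 2) powr (- \<beta>) > (0 :: real)" using that by simp
  then show ?thesis unfolding param_def rho_def by real_asymp
qed

lemma param_bounds: "t > 0 \<Longrightarrow> 0 \<le> param t k" "param t k \<le> 1"
  by (simp_all add: param_def rho_def)

lemma scale_at_top: "filterlim scale at_top at_top"
  using \<beta> by real_asymp

section \<open>Lower bounds for the right edge in the inhomogeneous environment\<close>

lemma early_levels:
  assumes \<xi>: "0 < \<xi>" "\<xi> < yc" "(1 - \<eta>) * \<alpha> 1 < a \<xi>"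
  shows "whp at_top (\<lambda>t u. \<forall>k. real k \<le> \<xi> * scale t \<longrightarrow>
    (\<exists>y. (1 - \<eta>) * \<alpha> 1 * real k \<le> of_int y \<and> half_line (env (param t) u) 0 k 0 y))"
proof (rule whp_approx)
  fix e :: real assume "e > 0"
  let ?p = "profile \<beta> \<xi>" and ?c = "(1 - \<eta>) * \<alpha> 1"
  have p: "?p \<in> {p_crit..1}" "0 \<le> ?p" using profile_gt[of \<xi>] \<xi> profile_bounds by auto
  from speed_lower[OF sp p \<xi>(3)] \<open>e > 0\<close> obtain K A where A: "A \<in> sets labels" "1 - e \<le> labels.prob A"
    "\<forall>u\<in>A. \<forall>k\<ge>K. \<exists>y. ?c * real k \<le> of_int y \<and> half_line (env (\<lambda>_. ?p) u) 0 k 0 y"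
    unfolding whp_def eventually_sequentially by (meson order_refl)
  have c: "?c \<le> 1" "0 \<le> ?c" using a_le_1[of 0] a_pos[of 0] yc \<eta> mult_le_one[of "1 - \<eta>" "\<alpha> 1"]
    by (auto simp: a_0)
  \<comment> \<open>Below level \<open>K\<close> the law of large numbers says nothing. But these
    are finitely many fixed levels, whose parameters tend to 1 with \<open>t\<close>, so the
    diagonal is open and carries a path of speed 1, at least \<open>?c\<close>.\<close>
  have "whp at_top (\<lambda>t u. \<forall>j\<in>{0..<int K}. u ((j, j), (j + 1, j + 1)) \<le> param t j)"
  proof (rule whp_ball)
    fix j assume j: "j \<in> {0..<int K}"
    show "whp at_top (\<lambda>t u. u ((j, j), (j + 1, j + 1)) \<le> param t j)"
      unfolding whp_def
    proof (intro allI impI)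
      fix e :: real assume "e > 0"
      have "\<forall>\<^sub>F t in at_top. 1 - e < param t j"
        using j \<open>e > 0\<close> by (intro order_tendstoD(1)[OF param_tendsto_1]) auto
      then show "\<forall>\<^sub>F t in at_top. \<exists>A\<in>sets labels. 1 - e \<le> labels.prob A \<and>
          (\<forall>u\<in>A. u ((j, j), (j + 1, j + 1)) \<le> param t j)"
        using eventually_gt_at_top[of 0]
      proof eventually_elim
        case (elim t)
        let ?A = "{u. u ((j, j), (j + 1, j + 1)) \<le> param t j}"
        have "{u \<in> space labels. u ((j, j), (j + 1, j + 1)) \<le> param t j} \<in> sets labels" by measurable
        then show ?case using prob_label_le[OF param_bounds[of t j], of "((j, j), (j + 1, j + 1))"] elim
          by (intro bexI[of _ ?A]) auto
      qed
    qed
  qed simp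
  then have "whp at_top (\<lambda>t u. u \<in> A \<longrightarrow> (\<forall>k. real k \<le> \<xi> * scale t \<longrightarrow>
    (\<exists>y. ?c * real k \<le> of_int y \<and> half_line (env (param t) u) 0 k 0 y)))"
  proof (rule whp_mono)
    show "\<forall>\<^sub>F t in at_top. \<forall>u. (\<forall>j\<in>{0..<int K}. u ((j, j), (j + 1, j + 1)) \<le> param t j) \<longrightarrow>
      u \<in> A \<longrightarrow> (\<forall>k. real k \<le> \<xi> * scale t \<longrightarrow>
        (\<exists>y. ?c * real k \<le> of_int y \<and> half_line (env (param t) u) 0 k 0 y))"
      using eventually_gt_at_top[of 0]
    proof (eventually_elim, intro allI impI)
      fix t :: real and u k
      assume t: "t > 0" and early: "\<forall>j\<in>{0..<int K}. u ((j, j), (j + 1, j + 1)) \<le> param t j"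
        and u: "u \<in> A" and k: "real k \<le> \<xi> * scale t"
      show "\<exists>y. ?c * real k \<le> of_int y \<and> half_line (env (param t) u) 0 k 0 y"
      proof (cases "k < K")
        case True
        then have "conn (env (param t) u) 0 k 0 (0 + int k)"
          using early by (intro conn_diagonal) (auto simp: env_def)
        moreover have "?c * real k \<le> real k" using c by (intro mult_left_le_one_le) auto
        ultimately show ?thesis using conn_imp_half_line by (intro exI[of _ "int k"]) auto
      next
        case False
        then obtain y where y: "?c * real k \<le> of_int y" "half_line (env (\<lambda>_. ?p) u) 0 k 0 y"
          using A(3) u by (meson not_less)
        have "half_line (env (param t) u) 0 k 0 y"
          using y(2)
        proof (rule half_line_env_mono)
          fix n assume n: "0 \<le> n" "n < 0 + int k"
          then have "real_of_int n + 1 \<le> real k" by linarith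
          then show "?p \<le> param t n" using k n by (intro param_ge[OF t]) auto
        qed simp
        with y(1) show ?thesis by blast
      qed
    qed
  qed
  with A(1,2) show "\<exists>A\<in>sets labels. 1 - e \<le> labels.prob A \<and> whp at_top (\<lambda>t u. u \<in> A \<longrightarrow>
    (\<forall>k. real k \<le> \<xi> * scale t \<longrightarrow> (\<exists>y. ?c * real k \<le> of_int y \<and> half_line (env (param t) u) 0 k 0 y)))"
    by blast
qed

end

context shape
begin

text \<open>Beyond \<xi> the shape is at least \<open>g \<xi> > 0\<close>. With fine enough slabs a
  bounded error, counted in block lengths, is therefore a small fraction of the shape; this is not
  so near 0, which is why the early levels are split off.\<close>

lemma late_levels:
  assumes \<xi>: "0 < \<xi>" "\<xi> < yc"
  shows "whp at_top (\<lambda>t u. \<forall>k. \<xi> * scale t < real k \<and> real k \<le> (1 - \<eta>) * (yc * scale t) \<longrightarrow>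
    (\<exists>y. (1 - \<eta>) * scaled_shape \<beta> g t (real k) \<le> of_int y \<and> half_line (env (param t) u) 0 k 0 y))"
proof -
  have g\<xi>: "g \<xi> > 0" using g_less[of 0 \<xi>] \<xi> by (simp add: g_0)
  \<comment> \<open>Rounding the block length to an integer costs at most one level per block. The
    slabs aim at 1 - \<eta>/2, so this loss of at most \<open>m\<close> levels still leaves
    everything up to 1 - \<eta> covered for large \<open>t\<close>. As \<open>L < yc\<close>, all
    parameters exceed \<open>p_crit\<close>.\<close>
  define L where "L = (1 - \<eta> / 2) * yc"
  have L: "0 < L" "L < yc" using yc \<eta> by (auto simp: L_def)
  \<comment> \<open>Three block lengths are lost: one to the Riemann sum, one to
    \<open>lower_edge\<close>, one to levels between block boundaries. The factor 1 - \<eta>/2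
    absorbs them if \<open>H i\<close> is at least 6/\<eta>; the extra 1 is the Riemann error in
    bounding \<open>g \<xi> / \<delta>\<close> by \<open>H i + 1\<close>.\<close>
  define m where "m = nat \<lceil>(6 / \<eta> + 1) * L / g \<xi>\<rceil>"
  have m_ge: "(6 / \<eta> + 1) * L / g \<xi> \<le> real m" unfolding m_def by linarith
  have "0 < (6 / \<eta> + 1) * L / g \<xi>" using L g\<xi> \<eta> by (auto intro!: divide_pos_pos mult_pos_pos add_pos_pos)
  with m_ge have m: "0 < m" by (cases m) auto
  define \<delta> where "\<delta> = L / real m"
  have \<delta>: "\<delta> > 0" "real m * \<delta> = L" using L m by (auto simp: \<delta>_def)
  have fine: "6 / \<eta> + 1 \<le> g \<xi> / \<delta>" using m_ge L g\<xi> m by (simp add: \<delta>_def field_simps)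
  define p where "p i = profile \<beta> (real i * \<delta>)" for i
  have i\<delta>: "real i * \<delta> < yc" if "i \<le> m" for i
  proof -
    have "real i * \<delta> \<le> real m * \<delta>" using that \<delta>(1) by (intro mult_right_mono) auto
    then show ?thesis using \<delta>(2) L by simp
  qed
  interpret decreasing_blocks \<alpha> p m
  proof
    show "p_crit < p i" if "i \<le> m" for i
      unfolding p_def using i\<delta>[OF that] \<delta> by (intro profile_gt) auto
    show "p (Suc i) < p i" for i unfolding p_def using \<delta> by (intro profile_less[OF \<beta>]) auto
  qed (auto simp: sp p_def profile_bounds)
  define H where "H = height"
  have H_Suc: "H (Suc i) = H i + a (real (Suc i) * \<delta>)" for i by (simp add: H_def height_Suc p_def)
  text \<open>The left Riemann sum exceeds the right one by at most one term, by telescoping.\<close>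
  have g_sum: "g (real i * \<delta>) \<le> \<delta> * (H i + \<alpha> 1 - a (real i * \<delta>))" if "i \<le> m" for i
    using that
  proof (induction i)
    case 0
    then show ?case by (simp add: g_0 H_def height_def a_0)
  next
    case (Suc i)
    have "g (real (Suc i) * \<delta>) - g (real i * \<delta>) \<le> a (real i * \<delta>) * (real (Suc i) * \<delta> - real i * \<delta>)"
      using i\<delta>[OF Suc.prems] \<delta> by (intro g_increment) auto
    also have "real (Suc i) * \<delta> - real i * \<delta> = \<delta>" by (simp add: algebra_simps)
    finally show ?case using Suc unfolding H_Suc by (simp add: algebra_simps)
  qed
  have g_le: "g (real i * \<delta>) \<le> \<delta> * (H i + 1)" if "i \<le> m" for i
  proof -
    have "\<alpha> 1 \<le> 1" "0 < a (real i * \<delta>)"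
      using a_le_1[of 0] yc a_pos[of "real i * \<delta>"] i\<delta>[OF that] \<delta> by (auto simp: a_0)
    then have "\<delta> * (H i + \<alpha> 1 - a (real i * \<delta>)) \<le> \<delta> * (H i + 1)" using \<delta> by (intro mult_left_mono) auto
    then show ?thesis using g_sum[OF that] by linarith
  qed
  define D where "D t = nat \<lfloor>\<delta> * scale t\<rfloor>" for t
  have D_top: "filterlim D at_top at_top"
    unfolding D_def using scale_at_top \<delta>(1)
    by (intro filterlim_compose[OF filterlim_nat_sequentially] filterlim_compose[OF filterlim_floor_sequentially]
        filterlim_tendsto_pos_mult_at_top[OF tendsto_const]) auto
  have "whp at_top (\<lambda>t u. \<forall>i\<in>{..m}. \<exists>y. (H i - 1) * real (D t) \<le> of_int y \<and>
      half_line (env (blocks p (D t)) u) 0 (i * D t) 0 y)"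
    by (intro whp_ball whp_compose[OF lower_edge D_top]) (auto simp: H_def intro: whp_compose[OF lower_edge D_top])
  then show ?thesis
  proof (rule whp_mono)
    have "\<forall>\<^sub>F t in at_top. real m \<le> (\<eta> / 2 * yc) * scale t"
      using scale_at_top \<eta> yc unfolding filterlim_at_top
      by (elim allE[of _ "real m / (\<eta> / 2 * yc)"]) (auto elim!: eventually_mono simp: field_simps)
    moreover have "\<forall>\<^sub>F t in at_top. 2 / \<eta> \<le> real (D t)"
      using filterlim_compose[OF filterlim_real_sequentially D_top] by (simp add: filterlim_at_top)
    ultimately show "\<forall>\<^sub>F t in at_top. \<forall>u. (\<forall>i\<in>{..m}. \<exists>y. (H i - 1) * real (D t) \<le> of_int y \<and>
        half_line (env (blocks p (D t)) u) 0 (i * D t) 0 y) \<longrightarrow>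
      (\<forall>k. \<xi> * scale t < real k \<and> real k \<le> (1 - \<eta>) * (yc * scale t) \<longrightarrow>
        (\<exists>y. (1 - \<eta>) * scaled_shape \<beta> g t (real k) \<le> of_int y \<and> half_line (env (param t) u) 0 k 0 y))"
      using eventually_gt_at_top[of 0]
    proof (eventually_elim, intro allI impI, elim conjE)
      fix t :: real and u k
      assume t1: "real m \<le> (\<eta> / 2 * yc) * scale t" and D1: "2 / \<eta> \<le> real (D t)" and t: "0 < t"
        and all: "\<forall>i\<in>{..m}. \<exists>y. (H i - 1) * real (D t) \<le> of_int y \<and>
          half_line (env (blocks p (D t)) u) 0 (i * D t) 0 y"
        and k: "\<xi> * scale t < real k" "real k \<le> (1 - \<eta>) * (yc * scale t)"
      let ?D = "D t" and ?T = "scale t"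
      have T: "?T > 0" using t by simp
      have D0: "real ?D > 0" using D1 \<eta> by (meson divide_pos_pos less_le_trans zero_less_numeral)
      have D: "real ?D \<le> \<delta> * ?T" "\<delta> * ?T < real ?D + 1"
        using \<delta>(1) T by (simp_all add: D_def)
      \<comment> \<open>The first block boundary at or above level \<open>k\<close>. A path to that
        boundary is at level \<open>k\<close> at most one block length further left, since it moves
        by 1 per step.\<close>
      define i where "i = (k + ?D - 1) div ?D"
      have Dpos: "0 < ?D" using D0 by simp
      have kpos: "0 < k" using k(1) \<xi> T by (metis gr0I less_irrefl mult_pos_pos not_less_iff_gr_or_eq of_nat_0 order_less_trans)
      have i1: "k \<le> i * ?D" "i * ?D < k + ?D"
        using div_mult_mod_eq[of "k + ?D - 1" ?D] mod_less_divisor[OF Dpos, of "k + ?D - 1"] Dpos kpos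
        unfolding i_def by linarith+
      have "i \<le> m"
      proof (rule ccontr)
        assume "\<not> i \<le> m"
        then have "Suc m * ?D \<le> i * ?D" by (intro mult_right_mono) auto
        then have "m * ?D < k" using i1(2) by simp
        then have "real m * real ?D < real k" by (metis of_nat_less_iff of_nat_mult)
        moreover have "real m * (\<delta> * ?T - 1) \<le> real m * real ?D" using D(2) by (intro mult_left_mono) auto
        moreover have "real m * (\<delta> * ?T - 1) = (1 - \<eta> / 2) * yc * ?T - real m"
          using \<delta>(2) by (simp add: right_diff_distrib L_def flip: mult.assoc)
        moreover have "(1 - \<eta> / 2) * yc * ?T - \<eta> / 2 * yc * ?T = (1 - \<eta>) * (yc * ?T)"
          by (simp add: algebra_simps)
        ultimately show False using k(2) t1 by linarith
      qed
      then obtain y where y: "(H i - 1) * real ?D \<le> of_int y"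
        "half_line (env (blocks p ?D) u) 0 (i * ?D) 0 y" using all by auto
      have "half_line (env (blocks p ?D) u) 0 (k + (i * ?D - k)) 0 y" using y(2) i1(1) by simp
      then obtain z where z: "half_line (env (blocks p ?D) u) 0 k 0 z"
        "conn (env (blocks p ?D) u) (0 + int k) (i * ?D - k) z y" unfolding half_line_add by blast
      have "y - z \<le> int (i * ?D - k)" using conn_bound[OF z(2)] by linarith
      then have "y - z \<le> int ?D" using i1 by linarith
      then have "real_of_int y - real ?D \<le> real_of_int z" by linarith
      with y(1) have z_ge: "(H i - 2) * real ?D \<le> of_int z" by (simp add: algebra_simps)
      have z': "half_line (env (param t) u) 0 k 0 z"
        using z(1)
      proof (rule half_line_env_mono)
        fix n assume n: "0 \<le> n" "n < 0 + int k"
        let ?j = "nat n div ?D + 1"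
        have "nat n < ?j * ?D" using Dpos by (simp add: dividend_less_div_times add.commute)
        then have "real_of_int n + 1 \<le> real ?j * real ?D"
          using n(1) by (metis Suc_leI add.commute int_nat_eq of_int_of_nat_eq of_nat_Suc of_nat_le_iff of_nat_mult)
        also have "\<dots> \<le> real ?j * (\<delta> * ?T)" using D(1) by (intro mult_left_mono) auto
        finally have "real_of_int n + 1 \<le> real ?j * \<delta> * ?T" by (simp add: mult.assoc)
        then show "blocks p ?D n \<le> param t n"
          unfolding blocks_def p_def by (rule param_ge[OF t n(1)])
      qed simp
      have "real k \<le> real i * real ?D" using i1(1) by (metis of_nat_le_iff of_nat_mult)
      also have "\<dots> \<le> real i * (\<delta> * ?T)" using D(1) by (intro mult_left_mono) auto
      finally have kT: "real k / ?T \<le> real i * \<delta>" using T by (simp add: divide_le_eq mult.assoc)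
      have \<xi>k: "\<xi> \<le> real k / ?T" using k(1) T by (simp add: le_divide_eq)
      have g1: "g \<xi> \<le> g (real k / ?T)" using \<xi> \<xi>k kT i\<delta>[OF \<open>i \<le> m\<close>] by (intro g_mono) auto
      have g2: "g (real k / ?T) \<le> \<delta> * (H i + 1)"
        using g_mono[of "real k / ?T" "real i * \<delta>"] g_le[OF \<open>i \<le> m\<close>] kT i\<delta>[OF \<open>i \<le> m\<close>] T by fastforce
      have "g \<xi> / \<delta> \<le> H i + 1" using g1 g2 \<delta>(1) by (simp add: divide_le_eq mult.commute)
      with fine have Hi: "6 / \<eta> \<le> H i" by linarith
      then have "6 \<le> H i * \<eta>" using \<eta> by (simp add: divide_le_eq)
      have "6 / \<eta> > 0" using \<eta> by simp
      then have Hpos: "H i + 1 \<ge> 0" using Hi by linarith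
      have "(1 - \<eta>) * scaled_shape \<beta> g t (real k) = (1 - \<eta>) * (?T * g (real k / ?T))"
        by (simp add: scaled_shape_def)
      also have "\<dots> \<le> (1 - \<eta>) * (?T * (\<delta> * (H i + 1)))" using g2 T \<eta> by (intro mult_left_mono) auto
      also have "\<dots> = (1 - \<eta>) * (\<delta> * ?T) * (H i + 1)" by (simp add: mult_ac)
      also have "\<dots> \<le> (1 - \<eta>) * (real ?D + 1) * (H i + 1)"
        using D(2) Hpos \<eta> by (intro mult_right_mono mult_left_mono) auto
      also have "\<dots> \<le> (1 - \<eta> / 2) * real ?D * (H i + 1)"
      proof (intro mult_right_mono Hpos)
        have "2 \<le> real ?D * \<eta>" using D1 \<eta> by (simp add: divide_le_eq)
        then show "(1 - \<eta>) * (real ?D + 1) \<le> (1 - \<eta> / 2) * real ?D" using \<eta> by (simp add: algebra_simps)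
      qed
      also have "\<dots> = (1 - \<eta> / 2) * (H i + 1) * real ?D" by (simp add: mult_ac)
      also have "\<dots> \<le> (H i - 2) * real ?D"
        using \<open>6 \<le> H i * \<eta>\<close> \<eta> by (intro mult_right_mono) (auto simp: algebra_simps)
      finally show "\<exists>y. (1 - \<eta>) * scaled_shape \<beta> g t (real k) \<le> of_int y \<and> half_line (env (param t) u) 0 k 0 y"
        using z_ge z' by (intro exI[of _ z]) auto
    qed
  qed
qed

lemma right_edge_lower:
  "whp at_top (\<lambda>t u. \<forall>k. real k \<le> (1 - \<eta>) * (yc * scale t) \<longrightarrow>
    (\<exists>y. (1 - \<eta>) * scaled_shape \<beta> g t (real k) \<le> of_int y \<and> half_line (env (param t) u) 0 k 0 y))"
proof -
  obtain \<xi> where \<xi>: "0 < \<xi>" "\<xi> < yc" "(1 - \<eta>) * \<alpha> 1 < a \<xi>" by (rule almost_full_speed)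
  show ?thesis
  proof (rule whp_mono[OF whp_conj[OF early_levels[OF \<xi>] late_levels[OF \<xi>(1,2)]]])
    show "\<forall>\<^sub>F t in at_top. \<forall>u. (\<forall>k. real k \<le> \<xi> * scale t \<longrightarrow>
        (\<exists>y. (1 - \<eta>) * \<alpha> 1 * real k \<le> of_int y \<and> half_line (env (param t) u) 0 k 0 y)) \<and>
      (\<forall>k. \<xi> * scale t < real k \<and> real k \<le> (1 - \<eta>) * (yc * scale t) \<longrightarrow>
        (\<exists>y. (1 - \<eta>) * scaled_shape \<beta> g t (real k) \<le> of_int y \<and> half_line (env (param t) u) 0 k 0 y)) \<longrightarrow>
      (\<forall>k. real k \<le> (1 - \<eta>) * (yc * scale t) \<longrightarrow>
        (\<exists>y. (1 - \<eta>) * scaled_shape \<beta> g t (real k) \<le> of_int y \<and> half_line (env (param t) u) 0 k 0 y))"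
      using eventually_gt_at_top[of 0]
    proof (eventually_elim, intro allI impI, elim conjE)
      fix t :: real and u k
      assume t: "t > 0"
        and E: "\<forall>k. real k \<le> \<xi> * scale t \<longrightarrow>
          (\<exists>y. (1 - \<eta>) * \<alpha> 1 * real k \<le> of_int y \<and> half_line (env (param t) u) 0 k 0 y)"
        and F: "\<forall>k. \<xi> * scale t < real k \<and> real k \<le> (1 - \<eta>) * (yc * scale t) \<longrightarrow>
          (\<exists>y. (1 - \<eta>) * scaled_shape \<beta> g t (real k) \<le> of_int y \<and> half_line (env (param t) u) 0 k 0 y)"
        and k: "real k \<le> (1 - \<eta>) * (yc * scale t)"
      show "\<exists>y. (1 - \<eta>) * scaled_shape \<beta> g t (real k) \<le> of_int y \<and> half_line (env (param t) u) 0 k 0 y"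
      proof (cases "\<xi> * scale t < real k")
        case True
        then show ?thesis using F k by blast
      next
        case False
        then obtain y where y: "(1 - \<eta>) * \<alpha> 1 * real k \<le> of_int y" "half_line (env (param t) u) 0 k 0 y"
          using E by (meson not_less)
        have T: "scale t > 0" using t by simp
        have "\<xi> * scale t \<le> yc * scale t" using \<xi>(2) T by (intro mult_right_mono) auto
        then have "real k \<le> yc * scale t" using False by linarith
        then have "real k / scale t \<le> yc" using T by (simp add: divide_le_eq)
        \<comment> \<open>The slope of \<open>g\<close> is greatest at 0, so a right edge of almost
          full speed is already beyond the shape.\<close>
        then have "g (real k / scale t) \<le> \<alpha> 1 * (real k / scale t)"
          using g_increment[of 0 "real k / scale t"] by (simp add: g_0 a_0)
        then have "(1 - \<eta>) * (scale t * g (real k / scale t)) \<le> (1 - \<eta>) * (scale t * (\<alpha> 1 * (real k / scale t)))"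
          using \<eta> T by (intro mult_left_mono) auto
        also have "\<dots> = (1 - \<eta>) * \<alpha> 1 * real k" using T by simp
        also note y(1)
        finally show ?thesis using y(2) unfolding scaled_shape_def by blast
      qed
    qed
  qed
qed

lemma scaled_shape_nonneg:
  assumes "t > 0" "real k \<le> (1 - \<eta>) * (yc * scale t)"
  shows "0 \<le> (1 - \<eta>) * scaled_shape \<beta> g t (real k)"
proof -
  have T: "scale t > 0" using assms(1) by simp
  have "(1 - \<eta>) * (yc * scale t) \<le> yc * scale t" using \<eta> yc T by (intro mult_left_le_one_le) auto
  then have "real k / scale t \<le> yc" using assms(2) T by (simp add: divide_le_eq)
  then have "0 \<le> g (real k / scale t)" using g_mono[of 0 "real k / scale t"] by (simp add: g_0)
  then show ?thesis using T \<eta> by (simp add: scaled_shape_def)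
qed

text \<open>Reflected labels have the same law, so the left edge is covered by the same estimate.
  Nonnegativity of the shape keeps both half-line edges on their own sides of 0 at every level up to
  \<open>K\<close>, which is the condition for the origin to catch up with them.\<close>

lemma cluster_edges:
  "whp at_top (\<lambda>t u. \<forall>k. real k \<le> (1 - \<eta>) * (yc * scale t) \<longrightarrow>
    (\<exists>x. of_int x \<le> - ((1 - \<eta>) * scaled_shape \<beta> g t (real k)) \<and> conn (env (param t) u) 0 k 0 x) \<and>
    (\<exists>x. (1 - \<eta>) * scaled_shape \<beta> g t (real k) \<le> of_int x \<and> conn (env (param t) u) 0 k 0 x))"
proof (rule whp_mono[OF whp_conj[OF right_edge_lower whp_reindex[OF right_edge_lower inj_reflect]]])
  let ?v = "\<lambda>t k. (1 - \<eta>) * scaled_shape \<beta> g t (real k)"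
  let ?R = "\<lambda>t u. \<forall>k. real k \<le> (1 - \<eta>) * (yc * scale t) \<longrightarrow>
    (\<exists>y. ?v t k \<le> of_int y \<and> half_line (env (param t) u) 0 k 0 y)"
  show "\<forall>\<^sub>F t in at_top. \<forall>u. ?R t u \<and> ?R t (u \<circ> reflect) \<longrightarrow>
    (\<forall>k. real k \<le> (1 - \<eta>) * (yc * scale t) \<longrightarrow>
      (\<exists>x. of_int x \<le> - ?v t k \<and> conn (env (param t) u) 0 k 0 x) \<and>
      (\<exists>x. ?v t k \<le> of_int x \<and> conn (env (param t) u) 0 k 0 x))"
    using eventually_gt_at_top[of 0]
  proof (eventually_elim, intro allI impI, elim conjE)
    fix t :: real and u K
    let ?\<omega> = "env (param t) u"
    assume t: "t > 0" and R: "?R t u" and L: "?R t (u \<circ> reflect)"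
      and K: "real K \<le> (1 - \<eta>) * (yc * scale t)"
    have R0: "\<exists>y\<ge>0. half_line ?\<omega> 0 k 0 y" if "k \<le> K" for k
    proof -
      have k: "real k \<le> (1 - \<eta>) * (yc * scale t)" using that K by linarith
      then obtain y where "?v t k \<le> of_int y" "half_line ?\<omega> 0 k 0 y" using R by blast
      then show ?thesis using scaled_shape_nonneg[OF t k] by (intro exI[of _ y]) linarith
    qed
    have L0: "\<exists>y\<ge>0. half_line (?\<omega> \<circ> reflect) 0 k 0 y" if "k \<le> K" for k
    proof -
      have k: "real k \<le> (1 - \<eta>) * (yc * scale t)" using that K by linarith
      then obtain y where "?v t k \<le> of_int y" "half_line (?\<omega> \<circ> reflect) 0 k 0 y"
        using L unfolding env_reflect by blast
      then show ?thesis using scaled_shape_nonneg[OF t k] by (intro exI[of _ y]) linarith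
    qed
    have refl2: "?\<omega> \<circ> reflect \<circ> reflect = ?\<omega>" by (auto simp: reflect_def fun_eq_iff)
    obtain y where y: "?v t K \<le> of_int y" "half_line ?\<omega> 0 K 0 y" using R K by blast
    obtain z where z: "z \<ge> y" "conn ?\<omega> 0 K 0 z"
      using origin_catches_half_line[OF R0 L0 order_refl y(2)] by blast
    obtain y' where y': "?v t K \<le> of_int y'" "half_line (?\<omega> \<circ> reflect) 0 K 0 y'"
      using L K unfolding env_reflect by blast
    have "\<exists>z\<ge>y'. conn (?\<omega> \<circ> reflect) 0 K 0 z"
      by (rule origin_catches_half_line[OF L0 _ order_refl y'(2)]) (use R0 in \<open>simp_all add: refl2\<close>)
    then obtain z' where z': "z' \<ge> y'" "conn ?\<omega> 0 K 0 (- z')" by (auto simp: conn_reflect)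
    have le: "real_of_int (- z') \<le> - ?v t K" "?v t K \<le> real_of_int z"
      using z(1) y(1) z'(1) y'(1) by linarith+
    show "(\<exists>x. of_int x \<le> - ?v t K \<and> conn ?\<omega> 0 K 0 x) \<and> (\<exists>x. ?v t K \<le> of_int x \<and> conn ?\<omega> 0 K 0 x)"
    proof
      show "\<exists>x. of_int x \<le> - ?v t K \<and> conn ?\<omega> 0 K 0 x"
        using le(1) z'(2) by blast
      show "\<exists>x. ?v t K \<le> of_int x \<and> conn ?\<omega> 0 K 0 x"
        using le(2) z(2) by blast
    qed
  qed
qed

end

section \<open>Poisson percolation\<close>

text \<open>The cluster has finitely many sites at each height, so the supremum is attained unless
  it is over the empty set, where it is below every real.\<close>

lemma cluster_right_ge: "ereal v \<le> cluster_right \<omega> k \<longleftrightarrow> (\<exists>x. v \<le> of_int x \<and> conn \<omega> 0 k 0 x)"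
proof
  assume v: "ereal v \<le> cluster_right \<omega> k"
  show "\<exists>x. v \<le> of_int x \<and> conn \<omega> 0 k 0 x"
  proof (rule ccontr)
    assume none: "\<nexists>x. v \<le> of_int x \<and> conn \<omega> 0 k 0 x"
    let ?S = "{x. conn \<omega> 0 k 0 x}"
    have "?S \<subseteq> {- int k..int k}" using conn_bound[of \<omega> 0 k 0] by force
    then have "finite ((\<lambda>x. ereal (of_int x)) ` ?S)" using finite_subset by blast
    moreover have "\<forall>x\<in>(\<lambda>x. ereal (of_int x)) ` ?S. x < ereal v" using none by (auto simp: not_le)
    ultimately have "Sup ((\<lambda>x. ereal (of_int x)) ` ?S) < ereal v"
      by (cases "?S = {}") (auto simp: bot_ereal_def cSup_eq_Max)
    then show False using v by (simp add: cluster_right_def cluster_conn not_le[symmetric])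
  qed
next
  assume "\<exists>x. v \<le> of_int x \<and> conn \<omega> 0 k 0 x"
  then show "ereal v \<le> cluster_right \<omega> k"
    unfolding cluster_right_def cluster_conn by (auto intro!: SUP_upper2)
qed

lemma cluster_left_le: "cluster_left \<omega> k \<le> ereal v \<longleftrightarrow> (\<exists>x. of_int x \<le> v \<and> conn \<omega> 0 k 0 x)"
proof
  assume v: "cluster_left \<omega> k \<le> ereal v"
  show "\<exists>x. of_int x \<le> v \<and> conn \<omega> 0 k 0 x"
  proof (rule ccontr)
    assume none: "\<nexists>x. of_int x \<le> v \<and> conn \<omega> 0 k 0 x"
    let ?S = "{x. conn \<omega> 0 k 0 x}"
    have "?S \<subseteq> {- int k..int k}" using conn_bound[of \<omega> 0 k 0] by force
    then have "finite ((\<lambda>x. ereal (of_int x)) ` ?S)" using finite_subset by blast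
    moreover have "\<forall>x\<in>(\<lambda>x. ereal (of_int x)) ` ?S. ereal v < x" using none by (auto simp: not_le)
    ultimately have "ereal v < Inf ((\<lambda>x. ereal (of_int x)) ` ?S)"
      by (cases "?S = {}") (auto simp: top_ereal_def cInf_eq_Min)
    then show False using v by (simp add: cluster_left_def cluster_conn not_le[symmetric])
  qed
next
  assume "\<exists>x. of_int x \<le> v \<and> conn \<omega> 0 k 0 x"
  then show "cluster_left \<omega> k \<le> ereal v"
    unfolding cluster_left_def cluster_conn by (auto intro!: INF_lower2)
qed

text \<open>Paths from the origin use only edges leaving levels \<open>n \<ge> 0\<close>. Their
  midpoints are at height \<open>n + 1/2 > 0\<close>, so they belong to the index set and their
  parameter depends on the level alone, as \<open>env\<close> requires.\<close>

lemma poisson_perc_prob: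
  assumes "t > 0"
  shows "measure (poisson_perc \<beta> t) {\<omega> \<in> space (poisson_perc \<beta> t). \<forall>k::nat. real k \<le> c \<longrightarrow>
      cluster_left \<omega> k \<le> ereal (l k) \<and> ereal (r k) \<le> cluster_right \<omega> k}
    = labels.prob {u. \<forall>k::nat. real k \<le> c \<longrightarrow>
      (\<exists>x. of_int x \<le> l k \<and> conn (env (\<lambda>n. rho \<beta> (of_int n + 1 / 2) t) u) 0 k 0 x) \<and>
      (\<exists>x. r k \<le> of_int x \<and> conn (env (\<lambda>n. rho \<beta> (of_int n + 1 / 2) t) u) 0 k 0 x)}"
proof -
  let ?I = "{e \<in> edges. mid_height e > 0}" and ?P = "\<lambda>n. rho \<beta> (of_int n + 1 / 2) t"
  let ?Q = "\<lambda>\<omega>. \<forall>k::nat. real k \<le> c \<longrightarrow> (\<exists>x. of_int x \<le> l k \<and> conn \<omega> 0 k 0 x) \<and>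
    (\<exists>x. r k \<le> of_int x \<and> conn \<omega> 0 k 0 x)"
  define f where "f u = (\<lambda>e\<in>?I. u e \<le> rho \<beta> (mid_height e) t)" for u
  let ?S = "{\<omega> \<in> space (poisson_perc \<beta> t). ?Q \<omega>}"
  have S: "?S \<in> sets (poisson_perc \<beta> t)" unfolding poisson_perc_def by measurable
  have m: "f \<in> labels \<rightarrow>\<^sub>M poisson_perc \<beta> t"
    using coupling_measurable[where I="?I" and r="\<lambda>e. rho \<beta> (mid_height e) t"]
    by (simp add: poisson_perc_def f_def[abs_def])
  have "distr labels (poisson_perc \<beta> t) f = poisson_perc \<beta> t"
    using distr_labels_bernoulli[OF edges_nonempty(2), of "\<lambda>e. rho \<beta> (mid_height e) t"] assms
    by (simp add: poisson_perc_def f_def[abs_def] rho_def)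
  then have "measure (poisson_perc \<beta> t) ?S = measure (distr labels (poisson_perc \<beta> t) f) ?S" by simp
  also have "\<dots> = labels.prob (f -` ?S \<inter> space labels)" by (rule measure_distr[OF m S])
  also have "f -` ?S \<inter> space labels = {u. ?Q (env ?P u)}"
  proof -
    have "conn (f u) 0 k 0 x = conn (env ?P u) 0 k 0 x" for u k x
    proof (rule conn_cong)
      fix x x' n assume "0 \<le> n" "((x, n), x', n + 1) \<in> edges"
      moreover have "mid_height ((x, n), (x', n + 1)) = of_int n + 1 / 2"
        by (simp add: mid_height_def field_simps)
      ultimately show "f u ((x, n), x', n + 1) = env ?P u ((x, n), x', n + 1)"
        by (simp add: f_def env_def)
    qed
    then show ?thesis using measurable_space[OF m] by auto
  qed
  finally show ?thesis by (simp only: cluster_left_le cluster_right_ge)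
qed

theorem theorem2:
  fixes \<beta> \<eta> :: real and \<alpha> g :: "real \<Rightarrow> real"
  assumes "\<beta> > 0"
    and "right_edge_speed \<alpha>"
    and "shape_function \<beta> \<alpha> g"
    and "\<eta> > 0"
  shows "((\<lambda>t. measure (poisson_perc \<beta> t)
            {\<omega> \<in> space (poisson_perc \<beta> t).
               \<forall>k::nat. real k \<le> (1 - \<eta>) * crit_height \<beta> t \<longrightarrow>
                 cluster_left \<omega> k \<le> ereal (- (1 - \<eta>) * scaled_shape \<beta> g t (real k)) \<and>
                 ereal ((1 - \<eta>) * scaled_shape \<beta> g t (real k)) \<le> cluster_right \<omega> k})
          \<longlongrightarrow> 1) at_top"
proof -
  let ?P = "\<lambda>t n. rho \<beta> (of_int n + 1 / 2) t"
  define E where "E t u \<longleftrightarrow> (\<forall>k::nat. real k \<le> (1 - \<eta>) * crit_height \<beta> t \<longrightarrow>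
      (\<exists>x. of_int x \<le> - (1 - \<eta>) * scaled_shape \<beta> g t (real k) \<and> conn (env (?P t) u) 0 k 0 x) \<and>
      (\<exists>x. (1 - \<eta>) * scaled_shape \<beta> g t (real k) \<le> of_int x \<and> conn (env (?P t) u) 0 k 0 x))" for t u
  have E_sets: "{u. E t u} \<in> sets labels" for t
  proof -
    have "{u \<in> space labels. E t u} \<in> sets labels" unfolding E_def by measurable
    then show ?thesis by simp
  qed
  have "whp at_top E"
  proof (cases "\<eta> < 1")
    case True
    interpret shape \<beta> \<eta> \<alpha> g using assms True by unfold_locales
    show ?thesis
      using cluster_edges
    proof (rule whp_mono)
      show "\<forall>\<^sub>F t in at_top. \<forall>u. (\<forall>k. real k \<le> (1 - \<eta>) * (yc * scale t) \<longrightarrow>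
        (\<exists>x. of_int x \<le> - ((1 - \<eta>) * scaled_shape \<beta> g t (real k)) \<and> conn (env (param t) u) 0 k 0 x) \<and>
        (\<exists>x. (1 - \<eta>) * scaled_shape \<beta> g t (real k) \<le> of_int x \<and> conn (env (param t) u) 0 k 0 x)) \<longrightarrow> E t u"
        using eventually_gt_at_top[of 0]
        by eventually_elim
          (simp only: E_def crit_height_eq[OF assms(1)] param_def[abs_def] minus_mult_left simp_thms)
    qed
  next
    \<comment> \<open>For \<eta> \<ge> 1 only height 0 remains, where the cluster is the origin and
      the shape vanishes.\<close>
    case False
    have "\<forall>\<^sub>F t in at_top. \<forall>u. True \<longrightarrow> E t u"
      using eventually_gt_at_top[of 0]
    proof (eventually_elim, intro allI impI)
      fix t :: real and u assume t: "t > 0"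
      have "0 \<le> crit_height \<beta> t" using crit_height_eq[OF assms(1) t] y_crit(1)[OF assms(1)] by simp
      then have "(1 - \<eta>) * crit_height \<beta> t \<le> 0" using False by (intro mult_nonpos_nonneg) auto
      then have "k = 0" if "real k \<le> (1 - \<eta>) * crit_height \<beta> t" for k using that by linarith
      moreover have "scaled_shape \<beta> g t (real 0) = 0"
        using assms(3) by (simp add: scaled_shape_def shape_function_def)
      ultimately show "E t u" unfolding E_def by (metis (no_types) conn.simps(1) even_zero add_0 mult_zero_right of_int_0 order_refl)
    qed
    moreover have "whp at_top (\<lambda>(t::real) u. True)" by (rule whp_always) simp
    ultimately show ?thesis by (rule whp_mono[rotated])
  qed
  then have "((\<lambda>t. labels.prob {u. E t u}) \<longlongrightarrow> 1) at_top" by (rule whp_imp_tendsto) (rule E_sets)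
  moreover have "\<forall>\<^sub>F t in at_top. labels.prob {u. E t u} = measure (poisson_perc \<beta> t)
            {\<omega> \<in> space (poisson_perc \<beta> t).
               \<forall>k::nat. real k \<le> (1 - \<eta>) * crit_height \<beta> t \<longrightarrow>
                 cluster_left \<omega> k \<le> ereal (- (1 - \<eta>) * scaled_shape \<beta> g t (real k)) \<and>
                 ereal ((1 - \<eta>) * scaled_shape \<beta> g t (real k)) \<le> cluster_right \<omega> k}"
    using eventually_gt_at_top[of 0]
    by eventually_elim (simp only: poisson_perc_prob E_def[abs_def])
  ultimately show ?thesis by (rule Lim_transform_eventually)
qed

end
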